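(* Let $\Omega\subset\mathbb{C}^n$ be a bounded $B$-regular domain, let $f:\overline{\Omega}\to\mathbb{R}$ be a positive continuous function and let $\varphi:\partial\Omega\to\mathbb{R}$ be continuous. Then the Dirichlet problem $$\Lambda_1(D^2_{\mathbb{C}}u)=f\ \text{ in }\Omega,\qquad u=\varphi\ \text{ on }\partial\Omega,$$ admits a unique viscosity solution $u\in C(\overline{\Omega})$.
   Context: For a $C^2$ function $w$, $D^2_{\mathbb{C}}w=\left(\frac{\partial^2 w}{\partial z_j\partial\bar z_k}\right)_{1\le j,k\le n}$ is the complex Hessian matrix, and $\Lambda_1(A)$ denotes the smallest eigenvalue of a Hermitian matrix $A$. $\mathrm{PSH}(\Omega)$ is the space of plurisubharmonic functions on $\Omega$. A bounded domain $\Omega\subset\mathbb{C}^n$ is $B$-regular if one of the following equivalent (Sibony) conditions holds: (i) for every $\zeta\in\partial\Omega$ there is $w\in \mathrm{PSH}(\Omega)$ with $\lim_{z\to \zeta}w(z)=0$ and $w^*<0$ on $\overline{\Omega}\setminus\{\zeta\}$, where $w^*(z)=\inf_{r>0}\sup\{w(y): y\in\Omega,\ |y-z|<r\}$; (ii) there is a smooth function $\psi<0$ on $\Omega$ with $\psi(z)\to0$ as $z\to\partial\Omega$ and $\sum_{j,k}\frac{\partial^2\psi}{\partial z_j\partial\bar z_k}\xi_j\bar\xi_k\ge|\xi|^2$ for all $\xi\in\mathbb{C}^n$; (iii) for every $g\in C(\partial\Omega)$ there is $w\in \mathrm{PSH}(\Omega)\cap C(\overline{\Omega})$ with $w|_{\partial\Omega}=g$.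 A function $q$ that is $C^2$ in a neighborhood of $z_0\in\Omega$ touches $w$ from above (resp. from below) at $z_0$ if $q(z_0)=w(z_0)$ and $q\ge w$ (resp. $q\le w$) in a neighborhood of $z_0$. Viscosity subsolution of $\Lambda_1(D^2_{\mathbb{C}}w)=f$ in $\Omega$: an upper semi-continuous function $w$ (not identically $-\infty$) such that for every $z_0\in\Omega$ and every $C^2$ function $q$ touching $w$ from above at $z_0$, $\Lambda_1(D^2_{\mathbb{C}}q)(z_0)\ge f(z_0)$. Viscosity supersolution: a lower semi-continuous function $w$ such that for every $z_0\in\Omega$ and every $C^2$ function $q$ touching $w$ from below at $z_0$, $[\Lambda_1(D^2_{\mathbb{C}}q)(z_0)]^+\le f(z_0)$, where $[t]^+=\max(t,0)$. A viscosity solution of the equation is a real-valued function on $\Omega$ which is both a viscosity subsolution and a viscosity supersolution; a viscosity solution of the Dirichlet problem moreover equals $\varphi$ on $\partial\Omega$. *)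

theory Defs
  imports "HOL-Analysis.Analysis"
begin

definition usc_on :: "'a::topological_space set \<Rightarrow> ('a \<Rightarrow> ereal) \<Rightarrow> bool" where
  "usc_on S w \<longleftrightarrow> (\<forall>x\<in>S. \<forall>a > w x. \<forall>\<^sub>F y in at x within S. w y < a)"

definition lsc_on :: "'a::topological_space set \<Rightarrow> ('a \<Rightarrow> ereal) \<Rightarrow> bool" where
  "lsc_on S w \<longleftrightarrow> (\<forall>x\<in>S. \<forall>a < w x. \<forall>\<^sub>F y in at x within S. a < w y)"

text \<open>Real differentiability of class C^k on an open set, through iterated partial derivatives.\<close>

primrec Ck_on :: "nat \<Rightarrow> 'a::euclidean_space set \<Rightarrow> ('a \<Rightarrow> real) \<Rightarrow> bool" where
  "Ck_on 0 U q \<longleftrightarrow> continuous_on U q"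
| "Ck_on (Suc k) U q \<longleftrightarrow> (\<forall>x\<in>U. q differentiable (at x)) \<and>
     (\<forall>b\<in>Basis. Ck_on k U (\<lambda>x. frechet_derivative q (at x) b))"

definition smooth_fun_on :: "'a::euclidean_space set \<Rightarrow> ('a \<Rightarrow> real) \<Rightarrow> bool" where
  "smooth_fun_on U q \<longleftrightarrow> (\<forall>k. Ck_on k U q)"

definition C2_near :: "'a::euclidean_space \<Rightarrow> ('a \<Rightarrow> real) \<Rightarrow> bool" where
  "C2_near z q \<longleftrightarrow> (\<exists>U. open U \<and> z \<in> U \<and> Ck_on 2 U q)"

text \<open>The Wirtinger derivatives \<open>\<partial>/\<partial>z\<^sub>j = (\<partial>/\<partial>x\<^sub>j - \<i> \<partial>/\<partial>y\<^sub>j) / 2\<close> and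
  \<open>\<partial>/\<partial>\<bar>z\<^sub>j = (\<partial>/\<partial>x\<^sub>j + \<i> \<partial>/\<partial>y\<^sub>j) / 2\<close>; the directions \<open>x\<^sub>j\<close> and \<open>y\<^sub>j\<close> are
  \<open>axis j 1\<close> and \<open>axis j \<i>\<close>.\<close>

definition wirtinger :: "'n::finite \<Rightarrow> (complex^'n \<Rightarrow> complex) \<Rightarrow> complex^'n \<Rightarrow> complex" where
  "wirtinger j F z = (frechet_derivative F (at z) (axis j 1)
     - \<i> * frechet_derivative F (at z) (axis j \<i>)) / 2"

definition wirtinger_bar :: "'n::finite \<Rightarrow> (complex^'n \<Rightarrow> complex) \<Rightarrow> complex^'n \<Rightarrow> complex" where
  "wirtinger_bar j F z = (frechet_derivative F (at z) (axis j 1)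
     + \<i> * frechet_derivative F (at z) (axis j \<i>)) / 2"

definition complex_hessian :: "(complex^'n::finite \<Rightarrow> real) \<Rightarrow> complex^'n \<Rightarrow> complex^'n^'n" where
  "complex_hessian w z =
     (\<chi> j k. wirtinger j (wirtinger_bar k (\<lambda>x. complex_of_real (w x))) z)"

text \<open>Meant for Hermitian matrices, whose eigenvalues are real and form a finite nonempty set.\<close>

definition smallest_eigenvalue :: "complex^'n^'n::finite \<Rightarrow> real" (\<open>\<Lambda>\<^sub>1\<close>) where
  "\<Lambda>\<^sub>1 A = Min {t::real. \<exists>v. v \<noteq> 0 \<and> A *v v = complex_of_real t *s v}"

text \<open>Mean over the circle parametrised by \<open>a + e\<^sup>i\<^sup>\<theta> \<xi>\<close>, split into positive and negative
  parts. The integral of the positive part is finite for an upper semicontinuous function below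
  \<open>\<infinity>\<close>, so the difference is a real number or \<open>-\<infinity>\<close>.\<close>

definition circle_mean :: "(complex^'n::finite \<Rightarrow> ereal) \<Rightarrow> complex^'n \<Rightarrow> complex^'n \<Rightarrow> ereal" where
  "circle_mean w a \<xi> =
     (enn2ereal (\<integral>\<^sup>+\<theta>\<in>{0..2*pi}. e2ennreal (w (a + cis \<theta> *s \<xi>)) \<partial>lborel)
      - enn2ereal (\<integral>\<^sup>+\<theta>\<in>{0..2*pi}. e2ennreal (- w (a + cis \<theta> *s \<xi>)) \<partial>lborel)) / ereal (2*pi)"

definition PSH :: "(complex^'n::finite) set \<Rightarrow> (complex^'n \<Rightarrow> ereal) set" where
  "PSH \<Omega> = {w. usc_on \<Omega> w \<and> (\<forall>z\<in>\<Omega>. w z < \<infinity>) \<and> (\<exists>z\<in>\<Omega>. w z \<noteq> -\<infinity>) \<and>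
     (\<forall>a \<xi>. {a + c *s \<xi> |c. cmod c \<le> 1} \<subseteq> \<Omega> \<longrightarrow> w a \<le> circle_mean w a \<xi>)}"

definition usc_reg :: "'a::metric_space set \<Rightarrow> ('a \<Rightarrow> ereal) \<Rightarrow> 'a \<Rightarrow> ereal" where
  "usc_reg \<Omega> w z = (INF r\<in>{0<..}. SUP y\<in>{y\<in>\<Omega>. dist y z < r}. w y)"

definition B_regular_barrier :: "(complex^'n::finite) set \<Rightarrow> bool" where
  "B_regular_barrier \<Omega> \<longleftrightarrow> (\<forall>\<zeta>\<in>frontier \<Omega>. \<exists>w\<in>PSH \<Omega>.
     (w \<longlongrightarrow> 0) (at \<zeta> within \<Omega>) \<and> (\<forall>z\<in>closure \<Omega> - {\<zeta>}. usc_reg \<Omega> w z < 0))"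

text \<open>The Levi form below is a complex number; it is real since the Hessian is Hermitian.\<close>

definition B_regular_exhaustion :: "(complex^'n::finite) set \<Rightarrow> bool" where
  "B_regular_exhaustion \<Omega> \<longleftrightarrow> (\<exists>\<psi>. smooth_fun_on \<Omega> \<psi> \<and> (\<forall>z\<in>\<Omega>. \<psi> z < 0) \<and>
     (\<forall>\<zeta>\<in>frontier \<Omega>. (\<psi> \<longlongrightarrow> 0) (at \<zeta> within \<Omega>)) \<and>
     (\<forall>z\<in>\<Omega>. \<forall>\<xi>. Re (\<Sum>j\<in>UNIV. \<Sum>k\<in>UNIV. complex_hessian \<psi> z $ j $ k * \<xi> $ j * cnj (\<xi> $ k))
        \<ge> (norm \<xi>)\<^sup>2))"

definition B_regular_extension :: "(complex^'n::finite) set \<Rightarrow> bool" where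
  "B_regular_extension \<Omega> \<longleftrightarrow> (\<forall>g::complex^'n \<Rightarrow> real. continuous_on (frontier \<Omega>) g \<longrightarrow>
     (\<exists>w::complex^'n \<Rightarrow> real. (\<lambda>z. ereal (w z)) \<in> PSH \<Omega> \<and> continuous_on (closure \<Omega>) w \<and>
        (\<forall>z\<in>frontier \<Omega>. w z = g z)))"

text \<open>By a theorem of Sibony the three conditions are equivalent on bounded domains.
  The disjunction avoids building that theorem into the definition.\<close>

definition B_regular :: "(complex^'n::finite) set \<Rightarrow> bool" where
  "B_regular \<Omega> \<longleftrightarrow>
     B_regular_barrier \<Omega> \<or> B_regular_exhaustion \<Omega> \<or> B_regular_extension \<Omega>"

definition touches_above :: "('a::topological_space \<Rightarrow> real) \<Rightarrow> ('a \<Rightarrow> ereal) \<Rightarrow> 'a \<Rightarrow> bool" where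
  "touches_above q w z \<longleftrightarrow> ereal (q z) = w z \<and> (\<forall>\<^sub>F y in nhds z. w y \<le> ereal (q y))"

definition touches_below :: "('a::topological_space \<Rightarrow> real) \<Rightarrow> ('a \<Rightarrow> ereal) \<Rightarrow> 'a \<Rightarrow> bool" where
  "touches_below q w z \<longleftrightarrow> ereal (q z) = w z \<and> (\<forall>\<^sub>F y in nhds z. ereal (q y) \<le> w y)"

definition viscosity_subsolution ::
    "(complex^'n::finite) set \<Rightarrow> (complex^'n \<Rightarrow> real) \<Rightarrow> (complex^'n \<Rightarrow> ereal) \<Rightarrow> bool" where
  "viscosity_subsolution \<Omega> f w \<longleftrightarrow>
     usc_on \<Omega> w \<and> (\<forall>z\<in>\<Omega>. w z < \<infinity>) \<and> (\<exists>z\<in>\<Omega>. w z \<noteq> -\<infinity>) \<and>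
     (\<forall>z\<in>\<Omega>. \<forall>q. C2_near z q \<and> touches_above q w z \<longrightarrow> \<Lambda>\<^sub>1 (complex_hessian q z) \<ge> f z)"

definition viscosity_supersolution ::
    "(complex^'n::finite) set \<Rightarrow> (complex^'n \<Rightarrow> real) \<Rightarrow> (complex^'n \<Rightarrow> ereal) \<Rightarrow> bool" where
  "viscosity_supersolution \<Omega> f w \<longleftrightarrow>
     lsc_on \<Omega> w \<and> (\<forall>z\<in>\<Omega>. w z > -\<infinity>) \<and>
     (\<forall>z\<in>\<Omega>. \<forall>q. C2_near z q \<and> touches_below q w z \<longrightarrow>
        max (\<Lambda>\<^sub>1 (complex_hessian q z)) 0 \<le> f z)"

definition viscosity_solution ::
    "(complex^'n::finite) set \<Rightarrow> (complex^'n \<Rightarrow> real) \<Rightarrow> (complex^'n \<Rightarrow> real) \<Rightarrow> bool" where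
  "viscosity_solution \<Omega> f u \<longleftrightarrow>
     viscosity_subsolution \<Omega> f (\<lambda>z. ereal (u z)) \<and> viscosity_supersolution \<Omega> f (\<lambda>z. ereal (u z))"

definition dirichlet_viscosity_solution ::
    "(complex^'n::finite) set \<Rightarrow> (complex^'n \<Rightarrow> real) \<Rightarrow> (complex^'n \<Rightarrow> real) \<Rightarrow>
     (complex^'n \<Rightarrow> real) \<Rightarrow> bool" where
  "dirichlet_viscosity_solution \<Omega> f \<phi> u \<longleftrightarrow>
     viscosity_solution \<Omega> f u \<and> (\<forall>z\<in>frontier \<Omega>. u z = \<phi> z)"

end

theory Submission
  imports Defs
begin

text \<open>
The inequality \<open>\<Lambda>\<^sub>1 \<ge> f\<close> says that \<open>u\<close> restricted to every complex line has Laplacian at least \<open>4 f\<close>.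
So a subsolution is a function that exceeds, on each small circle \<open>a + r e\<^sup>i\<^sup>\<theta> \<xi>\<close>, the submean
inequality by \<open>f a |\<xi>|\<^sup>2 r\<^sup>2\<close> up to lower order (\<open>local_submean\<close>). Three forms of this condition are used,
each where it is convenient. The local one is stable under sums, maxima and gluing and gives the
maximum principle at once. The viscosity one has the passage to suprema built in. The global one,
on whole discs (\<open>disc_submean\<close>), survives averaging of translates. For \<open>C\<^sup>2\<close> functions the local
condition is \<open>\<Lambda>\<^sub>1 \<ge> f\<close> itself, by the second-order expansion of circle averages
(\<open>C2_circle_avg_expansion\<close>). The essential step is from viscosity to discs
(\<open>submean_on_discs\<close>): if the disc inequality failed, a harmonic polynomial on the disc, strengthened
by \<open>c |z|\<^sup>2\<close> and by a large multiple of the squared distance to the complex line, would touch from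
above at an interior point.

Uniqueness. The operator \<open>\<Lambda>\<^sub>1\<close> is concave, so convolving a continuous subsolution with a \<open>C\<^sup>2\<close> kernel
gives a \<open>C\<^sup>2\<close> function, uniformly close to it, whose smallest eigenvalue is at least \<open>f - \<epsilon>\<close>
away from the boundary. Adding
\<open>\<gamma> |z|\<^sup>2\<close> makes it strict, and it is then an admissible test function from below for a supersolution
at an interior maximum of the difference (\<open>comparison_principle\<close>).

Existence. Each of the three forms of B-regularity provides, for every continuous boundary datum \<open>G\<close>,
every \<open>C \<ge> 0\<close> and every \<open>\<epsilon> > 0\<close>, an upper semicontinuous function below \<open>G\<close> and above \<open>G - \<epsilon>\<close> near the
boundary that satisfies the submean inequality with excess \<open>C\<close> (\<open>has_barriers\<close>): the local barriers
are truncated, scaled, corrected by \<open>C |z - \<zeta>|\<^sup>2\<close> and patched by a finite maximum; a multiple of the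
exhaustion is added to a mollified datum; the plurisubharmonic extension is taken for the datum
\<open>G - C |z|\<^sup>2\<close>. The barriers for \<open>\<phi>\<close> lie in the Perron family. The barriers for \<open>- \<phi>\<close> with \<open>C = 0\<close> bound the
family from above, by the maximum principle for a sum. Hence the Perron function has the right
boundary values. Since \<open>f\<close> is uniformly continuous, a translate of a subsolution plus a
small multiple of \<open>|z|\<^sup>2\<close> can be glued into the family (\<open>perron_family_translate\<close>, Walsh's argument), so
the Perron function is uniformly continuous. It is a subsolution as a supremum of
subsolutions, and a supersolution because a strict \<open>C\<^sup>2\<close> subsolution touching it from below could be lifted and
glued in.
\<close>

section \<open>The smallest eigenvalue as a minimum of the Rayleigh quotient\<close>

text \<open>Eigenvectors for distinct eigenvalues are orthogonal, so there are finitely many eigenvalues. The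
  minimum of the Rayleigh quotient is attained on the unit sphere, and its first variation in the
  direction \<open>T u - l u\<close> shows that a minimiser \<open>u\<close> is an eigenvector.\<close>

lemma selfadjoint_smallest_eigenvalue:
  fixes T :: "'a::euclidean_space \<Rightarrow> 'a"
  assumes lin: "linear T" and adj: "\<And>x y. x \<bullet> T y = T x \<bullet> y"
  defines "E \<equiv> {t::real. \<exists>v. v \<noteq> 0 \<and> T v = t *\<^sub>R v}"
  shows "finite E" and "c \<le> Min E \<longleftrightarrow> (\<forall>v. c * (norm v)\<^sup>2 \<le> v \<bullet> T v)"
proof -
  interpret linear T by fact
  define w where "w t = (SOME v. v \<noteq> 0 \<and> T v = t *\<^sub>R v)" for t
  have w: "w t \<noteq> 0" "T (w t) = t *\<^sub>R w t" if "t \<in> E" for t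
    using someI_ex[of "\<lambda>v. v \<noteq> 0 \<and> T v = t *\<^sub>R v"] that unfolding w_def E_def by blast+
  have orth: "w s \<bullet> w t = 0" if "s \<in> E" "t \<in> E" "s \<noteq> t" for s t
  proof -
    have "t * (w s \<bullet> w t) = s * (w s \<bullet> w t)"
      using adj[of "w s" "w t"] w that by simp
    then show ?thesis using that by simp
  qed
  have inj: "inj_on w E"
  proof (rule inj_onI)
    fix s t assume "s \<in> E" "t \<in> E" "w s = w t"
    then show "s = t" using orth[of s t] w(1)[of s] by auto
  qed
  have "pairwise orthogonal (w ` E)"
    unfolding pairwise_def orthogonal_def using orth by (metis imageE)
  moreover have "0 \<notin> w ` E" using w(1) by auto
  ultimately have "independent (w ` E)" by (rule pairwise_orthogonal_independent)
  then have "finite (w ` E)" by (rule independent_imp_finite)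
  then show fin: "finite E" using inj by (simp add: finite_image_iff)
  \<comment> \<open>A minimiser of the Rayleigh quotient on the unit sphere is an eigenvector.\<close>
  have cont: "continuous_on (sphere 0 1) (\<lambda>v. v \<bullet> T v)"
    by (intro continuous_on_inner continuous_on_id linear_continuous_on)
       (rule lin[unfolded linear_conv_bounded_linear])
  have ne: "sphere (0::'a) 1 \<noteq> {}"
    by (simp add: sphere_def) (metis nonempty_Basis norm_Basis ex_in_conv)
  obtain u where u: "norm u = 1" and umin: "\<And>v. norm v = 1 \<Longrightarrow> u \<bullet> T u \<le> v \<bullet> T v"
    using continuous_attains_inf[OF compact_sphere ne cont] by auto
  define l where "l = u \<bullet> T u"
  have low: "l * (norm v)\<^sup>2 \<le> v \<bullet> T v" for v
  proof (cases "v = 0")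
    case False
    have "l \<le> (v /\<^sub>R norm v) \<bullet> T (v /\<^sub>R norm v)"
      unfolding l_def by (rule umin) (use False in simp)
    also have "\<dots> = (v \<bullet> T v) / (norm v)\<^sup>2"
      by (simp add: scale power2_eq_square divide_simps)
    finally show ?thesis using False by (simp add: field_simps)
  qed (simp add: zero)
  \<comment> \<open>The quadratic form of \<open>T - l\<close> is nonnegative and vanishes at \<open>u\<close>; moving from \<open>u\<close> along \<open>z\<close> would make it negative unless \<open>z = 0\<close>.\<close>
  have "T u = l *\<^sub>R u"
  proof -
    define z where "z = T u - l *\<^sub>R u"
    define k where "k = z \<bullet> T z - l * (norm z)\<^sup>2"
    have key: "0 \<le> 2 * s * (norm z)\<^sup>2 + s\<^sup>2 * k" for s
    proof -
      have "0 \<le> (u + s *\<^sub>R z) \<bullet> T (u + s *\<^sub>R z) - l * ((u + s *\<^sub>R z) \<bullet> (u + s *\<^sub>R z))"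
        using low[of "u + s *\<^sub>R z"] by (simp add: power2_norm_eq_inner)
      also have "\<dots> = 2 * s * (z \<bullet> (T u - l *\<^sub>R u)) + s\<^sup>2 * k + (u \<bullet> T u - l * (u \<bullet> u))"
        using adj[of u z]
        unfolding k_def power2_norm_eq_inner
        by (simp add: add scale algebra_simps inner_commute power2_eq_square)
      also have "u \<bullet> T u - l * (u \<bullet> u) = 0"
        using u by (simp add: l_def dot_square_norm)
      finally show ?thesis by (simp add: z_def[symmetric] power2_norm_eq_inner)
    qed
    have "(norm z)\<^sup>2 = 0"
    proof (rule ccontr)
      assume "(norm z)\<^sup>2 \<noteq> 0"
      then have pos: "(norm z)\<^sup>2 > 0" by simp
      define s where "s = - (norm z)\<^sup>2 / (\<bar>k\<bar> + 1)"
      have "s\<^sup>2 * k \<le> s\<^sup>2 * (\<bar>k\<bar> + 1)" by (intro mult_left_mono) auto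
      also have "\<dots> = - s * (norm z)\<^sup>2" by (simp add: s_def power2_eq_square)
      finally have "0 \<le> s * (norm z)\<^sup>2" using key[of s] by simp
      then show False using pos by (simp add: s_def divide_simps zero_le_mult_iff mult_less_0_iff split: if_splits)
    qed
    then show ?thesis by (simp add: z_def)
  qed
  then have lE: "l \<in> E" unfolding E_def using u by (intro CollectI exI[of _ u]) auto
  have "l \<le> t" if "t \<in> E" for t
    using low[of "w t"] w[OF that] by (simp add: power2_norm_eq_inner)
  then have Min: "Min E = l" using fin lE by (intro Min_eqI) auto
  show "c \<le> Min E \<longleftrightarrow> (\<forall>v. c * (norm v)\<^sup>2 \<le> v \<bullet> T v)"
  proof
    assume "c \<le> Min E"
    then show "\<forall>v. c * (norm v)\<^sup>2 \<le> v \<bullet> T v"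
      unfolding Min by (metis low mult_right_mono order_trans zero_le_power2)
  next
    assume "\<forall>v. c * (norm v)\<^sup>2 \<le> v \<bullet> T v"
    from this[rule_format, of u] show "c \<le> Min E" unfolding Min using u by (simp add: l_def)
  qed
qed

lemma inner_matrix_vector_complex:
  fixes A :: "complex^'n^'n::finite"
  shows "x \<bullet> (A *v y) = Re (\<Sum>j\<in>UNIV. \<Sum>k\<in>UNIV. cnj (x $ j) * A $ j $ k * y $ k)"
proof -
  have inner: "a \<bullet> b = Re (cnj a * b)" for a b :: complex
    by (simp add: inner_complex_def)
  show ?thesis
    by (simp only: inner_vec_def matrix_vector_mult_def vec_lambda_beta inner sum_distrib_left
        Re_sum mult.assoc)
qed

text \<open>The Levi form pairs \<open>\<xi>\<close> with its conjugate in the opposite order to the Hermitian product, so the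
  vector \<open>\<xi>\<close> here is the conjugate of the one in the Rayleigh quotient.\<close>

lemma le_smallest_eigenvalue_iff:
  fixes A :: "complex^'n^'n::finite"
  assumes herm: "\<And>j k. A $ j $ k = cnj (A $ k $ j)"
  shows "c \<le> \<Lambda>\<^sub>1 A \<longleftrightarrow>
    (\<forall>\<xi>. c * (norm \<xi>)\<^sup>2 \<le> Re (\<Sum>j\<in>UNIV. \<Sum>k\<in>UNIV. A $ j $ k * \<xi> $ j * cnj (\<xi> $ k)))"
proof -
  define cj :: "complex^'n \<Rightarrow> complex^'n" where "cj v = (\<chi> i. cnj (v $ i))" for v
  have cj: "cj (cj v) = v" "norm (cj v) = norm v" for v
    by (simp_all add: cj_def vec_eq_iff norm_vec_def)
  have lin: "linear ((*v) A)"
    by (rule linearI)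
      (simp_all add: vec_eq_iff matrix_vector_mult_def scaleR_sum_right distrib_left sum.distrib)
  have adj: "x \<bullet> (A *v y) = (A *v x) \<bullet> y" for x y
  proof -
    have "x \<bullet> (A *v y) = Re (\<Sum>k\<in>UNIV. \<Sum>j\<in>UNIV. cnj (x $ j) * A $ j $ k * y $ k)"
      unfolding inner_matrix_vector_complex by (subst sum.swap) simp
    also have "\<dots> = Re (cnj (\<Sum>k\<in>UNIV. \<Sum>j\<in>UNIV. cnj (y $ k) * A $ k $ j * x $ j))"
      unfolding cnj_sum
      by (intro arg_cong[of _ _ Re] sum.cong refl) (metis (no_types, lifting) herm complex_cnj_cnj complex_cnj_mult mult.commute mult.left_commute)
    also have "\<dots> = y \<bullet> (A *v x)"
      unfolding inner_matrix_vector_complex by (simp only: cnj.simps)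
    finally show ?thesis by (simp add: inner_commute)
  qed
  have form: "v \<bullet> (A *v v) = Re (\<Sum>j\<in>UNIV. \<Sum>k\<in>UNIV. A $ j $ k * cj v $ j * cnj (cj v $ k))" for v
    by (simp add: inner_matrix_vector_complex cj_def mult_ac)
  have eq: "complex_of_real t *s v = t *\<^sub>R v" for t and v :: "complex^'n"
    by (simp add: vec_eq_iff) (simp add: scaleR_conv_of_real)
  have "c \<le> \<Lambda>\<^sub>1 A \<longleftrightarrow> (\<forall>v. c * (norm v)\<^sup>2 \<le> v \<bullet> (A *v v))"
    unfolding smallest_eigenvalue_def eq
    by (rule selfadjoint_smallest_eigenvalue(2)[OF lin adj])
  also have "\<dots> \<longleftrightarrow> (\<forall>\<xi>. c * (norm \<xi>)\<^sup>2 \<le> Re (\<Sum>j\<in>UNIV. \<Sum>k\<in>UNIV. A $ j $ k * \<xi> $ j * cnj (\<xi> $ k)))"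
    (is "_ \<longleftrightarrow> (\<forall>\<xi>. ?F \<xi>)")
  proof (intro iffI allI)
    fix \<xi> assume "\<forall>v. c * (norm v)\<^sup>2 \<le> v \<bullet> (A *v v)"
    from this[rule_format, of "cj \<xi>"] show "?F \<xi>" unfolding form cj .
  next
    fix v assume "\<forall>\<xi>. ?F \<xi>"
    from this[rule_format, of "cj v"] show "c * (norm v)\<^sup>2 \<le> v \<bullet> (A *v v)"
      unfolding form cj .
  qed
  finally show ?thesis .
qed

section \<open>Second derivatives and the Levi form\<close>

definition second_derivative :: "('a::euclidean_space \<Rightarrow> real) \<Rightarrow> 'a \<Rightarrow> 'a \<Rightarrow> 'a \<Rightarrow> real" where
  "second_derivative q x h v =
     frechet_derivative (\<lambda>y. frechet_derivative q (at y) v) (at x) h"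

text \<open>A quarter of the Laplacian of \<open>\<zeta> \<mapsto> q (z + \<zeta> \<xi>)\<close> at \<open>0\<close>.\<close>

definition levi_form :: "(complex^'n::finite \<Rightarrow> real) \<Rightarrow> complex^'n \<Rightarrow> complex^'n \<Rightarrow> real" where
  "levi_form q z \<xi> =
     (second_derivative q z \<xi> \<xi> + second_derivative q z (\<i> *s \<xi>) (\<i> *s \<xi>)) / 4"

lemma C2_onD:
  assumes "Ck_on 2 U q"
  shows "\<And>x. x \<in> U \<Longrightarrow> q differentiable (at x)"
    and "\<And>x b. x \<in> U \<Longrightarrow> b \<in> Basis \<Longrightarrow> (\<lambda>x. frechet_derivative q (at x) b) differentiable (at x)"
    and "\<And>a b. a \<in> Basis \<Longrightarrow> b \<in> Basis \<Longrightarrow> continuous_on U (\<lambda>x. second_derivative q x a b)"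
  using assms by (auto simp: numeral_2_eq_2 second_derivative_def)

context
  fixes U :: "'a::euclidean_space set" and q :: "'a \<Rightarrow> real"
  assumes U: "open U" and C2: "Ck_on 2 U q"
begin

lemma C2_has_derivative:
  "x \<in> U \<Longrightarrow> (q has_derivative frechet_derivative q (at x)) (at x)"
  using C2_onD(1)[OF C2] by (simp add: frechet_derivative_works[symmetric])

lemma C2_derivative_linear: "x \<in> U \<Longrightarrow> linear (frechet_derivative q (at x))"
  using C2_onD(1)[OF C2] by (rule linear_frechet_derivative)

lemma C2_derivative_basis:
  assumes "x \<in> U"
  shows "frechet_derivative q (at x) v = (\<Sum>b\<in>Basis. (v \<bullet> b) * frechet_derivative q (at x) b)"
proof -
  interpret linear "frechet_derivative q (at x)" using C2_derivative_linear[OF assms] .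
  have "frechet_derivative q (at x) v = frechet_derivative q (at x) (\<Sum>b\<in>Basis. (v \<bullet> b) *\<^sub>R b)"
    by (simp add: euclidean_representation)
  then show ?thesis by (simp add: sum scale)
qed

lemma C2_derivative_has_derivative:
  assumes x: "x \<in> U"
  shows "((\<lambda>y. frechet_derivative q (at y) v) has_derivative (\<lambda>h. second_derivative q x h v)) (at x)"
    and "second_derivative q x h v = (\<Sum>b\<in>Basis. (v \<bullet> b) * second_derivative q x h b)"
proof -
  have "((\<lambda>y. frechet_derivative q (at y) b) has_derivative (\<lambda>h. second_derivative q x h b)) (at x)"
    if "b \<in> Basis" for b
    using C2_onD(2)[OF C2 x that] unfolding second_derivative_def
    by (simp add: frechet_derivative_works[symmetric])
  then have "((\<lambda>y. \<Sum>b\<in>Basis. (v \<bullet> b) * frechet_derivative q (at y) b) has_derivative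
      (\<lambda>h. \<Sum>b\<in>Basis. (v \<bullet> b) * second_derivative q x h b)) (at x)"
    by (intro has_derivative_sum has_derivative_mult_right)
  then have *: "((\<lambda>y. frechet_derivative q (at y) v) has_derivative
      (\<lambda>h. \<Sum>b\<in>Basis. (v \<bullet> b) * second_derivative q x h b)) (at x)"
    by (rule has_derivative_transform_within_open[OF _ U x]) (simp add: C2_derivative_basis)
  have eq: "(\<lambda>h. second_derivative q x h v) = (\<lambda>h. \<Sum>b\<in>Basis. (v \<bullet> b) * second_derivative q x h b)"
    using frechet_derivative_at[OF *] by (simp add: second_derivative_def[of q x _ v])
  then show "second_derivative q x h v = (\<Sum>b\<in>Basis. (v \<bullet> b) * second_derivative q x h b)"
    by (rule fun_cong)
  show "((\<lambda>y. frechet_derivative q (at y) v) has_derivative (\<lambda>h. second_derivative q x h v)) (at x)"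
    using * by (simp only: eq)
qed

lemma second_derivative_linear:
  assumes x: "x \<in> U"
  shows "linear (\<lambda>h. second_derivative q x h v)" and "linear (second_derivative q x h)"
proof -
  show "linear (\<lambda>h. second_derivative q x h v)"
    using C2_derivative_has_derivative(1)[OF x] by (rule has_derivative_linear)
  have "linear (\<lambda>v. \<Sum>b\<in>Basis. (v \<bullet> b) * second_derivative q x h b)"
    by (rule linearI) (simp_all add: inner_add_left distrib_right sum.distrib sum_distrib_left mult.assoc)
  moreover have "second_derivative q x h = (\<lambda>v. \<Sum>b\<in>Basis. (v \<bullet> b) * second_derivative q x h b)"
    by (rule ext) (rule C2_derivative_has_derivative(2)[OF x])
  ultimately show "linear (second_derivative q x h)" by simp
qed

lemma second_derivative_basis:
  assumes x: "x \<in> U"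
  shows "second_derivative q x h v =
    (\<Sum>a\<in>Basis. \<Sum>b\<in>Basis. (h \<bullet> a) * (v \<bullet> b) * second_derivative q x a b)"
proof -
  interpret linear "\<lambda>h. second_derivative q x h v" using second_derivative_linear(1)[OF x] .
  have "second_derivative q x h v = second_derivative q x (\<Sum>a\<in>Basis. (h \<bullet> a) *\<^sub>R a) v"
    by (simp add: euclidean_representation)
  also have "\<dots> = (\<Sum>a\<in>Basis. (h \<bullet> a) * second_derivative q x a v)"
    by (simp only: sum scale real_scaleR_def)
  also have "\<dots> = (\<Sum>a\<in>Basis. \<Sum>b\<in>Basis. (h \<bullet> a) * (v \<bullet> b) * second_derivative q x a b)"
    by (intro sum.cong refl)
       (simp only: C2_derivative_has_derivative(2)[OF x, of _ v] sum_distrib_left mult.assoc)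
  finally show ?thesis .
qed

lemma second_derivative_continuous: "continuous_on U (\<lambda>x. second_derivative q x h v)"
proof -
  have "continuous_on U (\<lambda>x. \<Sum>a\<in>Basis. \<Sum>b\<in>Basis. (h \<bullet> a) * (v \<bullet> b) * second_derivative q x a b)"
    by (intro continuous_intros C2_onD(3)[OF C2])
  then show ?thesis
    by (rule continuous_on_eq) (rule second_derivative_basis[symmetric])
qed

text \<open>The second difference over a small parallelogram equals, by the mean value theorem applied
  twice, the mixed derivative at some point of the parallelogram, in either order.\<close>

lemma second_difference_mean_value:
  assumes s: "s > 0" and para: "\<And>t r. 0 \<le> t \<Longrightarrow> t \<le> s \<Longrightarrow> 0 \<le> r \<Longrightarrow> r \<le> s \<Longrightarrow> z + t *\<^sub>R b + r *\<^sub>R c \<in> U"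
  shows "\<exists>t r. 0 < t \<and> t < s \<and> 0 < r \<and> r < s \<and>
    q (z + s *\<^sub>R b + s *\<^sub>R c) - q (z + s *\<^sub>R b) - q (z + s *\<^sub>R c) + q z =
      s\<^sup>2 * second_derivative q (z + t *\<^sub>R b + r *\<^sub>R c) c b"
proof -
  define g where "g t = q (z + t *\<^sub>R b + s *\<^sub>R c) - q (z + t *\<^sub>R b)" for t
  have line: "((\<lambda>t. q (z + t *\<^sub>R b + r *\<^sub>R c)) has_real_derivative
      frechet_derivative q (at (z + t *\<^sub>R b + r *\<^sub>R c)) b) (at t)"
    if "0 \<le> t" "t \<le> s" "0 \<le> r" "r \<le> s" for t r
  proof -
    interpret linear "frechet_derivative q (at (z + t *\<^sub>R b + r *\<^sub>R c))"
      by (rule C2_derivative_linear) (rule para[OF that])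
    have "((\<lambda>t. q (z + t *\<^sub>R b + r *\<^sub>R c)) has_derivative
        (\<lambda>h. frechet_derivative q (at (z + t *\<^sub>R b + r *\<^sub>R c)) (h *\<^sub>R b))) (at t)"
      by (rule has_derivative_compose[where f="\<lambda>t. z + t *\<^sub>R b + r *\<^sub>R c" and g=q, OF _ C2_has_derivative[OF para[OF that]]])
         (auto intro!: derivative_eq_intros)
    then show ?thesis by (simp add: scale has_field_derivative_def mult.commute[of _ "frechet_derivative _ _ _"])
  qed
  have "\<exists>t. 0 < t \<and> t < s \<and> g s - g 0 = (s - 0) *
      (frechet_derivative q (at (z + t *\<^sub>R b + s *\<^sub>R c)) b - frechet_derivative q (at (z + t *\<^sub>R b)) b)"
    unfolding g_def
    by (rule MVT2[OF s]) (use line[of _ s] line[of _ 0] s in \<open>auto intro!: DERIV_diff\<close>)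
  then obtain t where t: "0 < t" "t < s" "g s - g 0 = s *
      (frechet_derivative q (at (z + t *\<^sub>R b + s *\<^sub>R c)) b - frechet_derivative q (at (z + t *\<^sub>R b)) b)"
    by auto
  have line2: "((\<lambda>r. frechet_derivative q (at (z + t *\<^sub>R b + r *\<^sub>R c)) b) has_real_derivative
      second_derivative q (z + t *\<^sub>R b + r *\<^sub>R c) c b) (at r)" if "0 \<le> r" "r \<le> s" for r
  proof -
    have in_U: "z + t *\<^sub>R b + r *\<^sub>R c \<in> U" using para[of t r] t that by simp
    interpret linear "\<lambda>h. second_derivative q (z + t *\<^sub>R b + r *\<^sub>R c) h b"
      using second_derivative_linear(1)[OF in_U] .
    have "((\<lambda>r. frechet_derivative q (at (z + t *\<^sub>R b + r *\<^sub>R c)) b) has_derivative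
        (\<lambda>h. second_derivative q (z + t *\<^sub>R b + r *\<^sub>R c) (h *\<^sub>R c) b)) (at r)"
      by (rule has_derivative_compose[where f="\<lambda>r. z + t *\<^sub>R b + r *\<^sub>R c"
            and g="\<lambda>y. frechet_derivative q (at y) b", OF _ C2_derivative_has_derivative(1)[OF in_U]])
         (auto intro!: derivative_eq_intros)
    then show ?thesis by (simp add: scale has_field_derivative_def mult.commute[of _ "second_derivative _ _ _ _"])
  qed
  have "\<exists>r. 0 < r \<and> r < s \<and>
      frechet_derivative q (at (z + t *\<^sub>R b + s *\<^sub>R c)) b - frechet_derivative q (at (z + t *\<^sub>R b + 0 *\<^sub>R c)) b =
      (s - 0) * second_derivative q (z + t *\<^sub>R b + r *\<^sub>R c) c b"
    by (rule MVT2[OF s]) (use line2 in auto)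
  then obtain r where r: "0 < r" "r < s"
    "frechet_derivative q (at (z + t *\<^sub>R b + s *\<^sub>R c)) b - frechet_derivative q (at (z + t *\<^sub>R b)) b =
      s * second_derivative q (z + t *\<^sub>R b + r *\<^sub>R c) c b" by auto
  have "g s - g 0 = s\<^sup>2 * second_derivative q (z + t *\<^sub>R b + r *\<^sub>R c) c b"
    unfolding t(3) r(3) by (simp add: power2_eq_square)
  moreover have "g s - g 0 = q (z + s *\<^sub>R b + s *\<^sub>R c) - q (z + s *\<^sub>R b) - q (z + s *\<^sub>R c) + q z"
    by (simp add: g_def)
  ultimately show ?thesis using t(1,2) r(1,2) by (intro exI[of _ t] exI[of _ r]) simp
qed

text \<open>Both mixed derivatives are limits of the same second difference. Symmetry is what makes the complex
  Hessian Hermitian.\<close>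

lemma second_derivative_symmetric:
  assumes z: "z \<in> U"
  shows "second_derivative q z b c = second_derivative q z c b"
proof -
  have "\<bar>second_derivative q z b c - second_derivative q z c b\<bar> \<le> e" if e: "e > 0" for e
  proof -
    have "\<forall>\<^sub>F x in nhds z. x \<in> U \<and> \<bar>second_derivative q x b c - second_derivative q z b c\<bar> < e / 2 \<and>
        \<bar>second_derivative q x c b - second_derivative q z c b\<bar> < e / 2"
    proof (intro eventually_conj)
      show "\<forall>\<^sub>F x in nhds z. x \<in> U" using U z by (rule eventually_nhds_in_open)
      have "\<forall>\<^sub>F x in nhds z. dist (second_derivative q x h v) (second_derivative q z h v) < e / 2" for h v
      proof -
        have "isCont (\<lambda>x. second_derivative q x h v) z"
          using second_derivative_continuous U z continuous_on_eq_continuous_at by blast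
        then show ?thesis
          using e by (auto simp: isCont_def tendsto_iff eventually_at_filter elim: eventually_mono
              dest!: spec[of _ "e / 2"])
      qed
      then show "\<forall>\<^sub>F x in nhds z. \<bar>second_derivative q x b c - second_derivative q z b c\<bar> < e / 2"
        "\<forall>\<^sub>F x in nhds z. \<bar>second_derivative q x c b - second_derivative q z c b\<bar> < e / 2"
        by (simp_all add: dist_real_def)
    qed
    then obtain d where d: "d > 0" and near: "\<And>x. dist x z < d \<Longrightarrow> x \<in> U \<and>
        \<bar>second_derivative q x b c - second_derivative q z b c\<bar> < e / 2 \<and>
        \<bar>second_derivative q x c b - second_derivative q z c b\<bar> < e / 2"
      unfolding eventually_nhds_metric by blast
    define s where "s = d / (norm b + norm c + 1)"
    have N: "norm b + norm c + 1 > 0" by (simp add: add_nonneg_pos)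
    have s: "s > 0" using d N by (simp add: s_def)
    have small: "dist (z + t *\<^sub>R b + r *\<^sub>R c) z < d" if "0 \<le> t" "t \<le> s" "0 \<le> r" "r \<le> s" for t r
    proof -
      have "norm (t *\<^sub>R b + r *\<^sub>R c) \<le> t * norm b + r * norm c"
        using that by (intro norm_triangle_le) simp
      also have "\<dots> \<le> s * norm b + s * norm c"
        using that by (intro add_mono mult_right_mono) auto
      also have "\<dots> < s * (norm b + norm c + 1)" using s by (simp add: distrib_left)
      also have "\<dots> = d" using N by (simp add: s_def)
      finally show ?thesis by (simp add: dist_norm add.assoc)
    qed
    obtain t r where 1: "0 < t" "t < s" "0 < r" "r < s"
      "q (z + s *\<^sub>R b + s *\<^sub>R c) - q (z + s *\<^sub>R b) - q (z + s *\<^sub>R c) + q z =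
      s\<^sup>2 * second_derivative q (z + t *\<^sub>R b + r *\<^sub>R c) c b"
      using second_difference_mean_value[OF s, of z b c] near small by blast
    have swap: "z + u *\<^sub>R c + w *\<^sub>R b = z + w *\<^sub>R b + u *\<^sub>R c" for u w by simp
    obtain t' r' where 2: "0 < t'" "t' < s" "0 < r'" "r' < s"
      "q (z + s *\<^sub>R c + s *\<^sub>R b) - q (z + s *\<^sub>R c) - q (z + s *\<^sub>R b) + q z =
      s\<^sup>2 * second_derivative q (z + t' *\<^sub>R c + r' *\<^sub>R b) b c"
      using second_difference_mean_value[OF s, of z c b] near small unfolding swap by blast
    have "q (z + s *\<^sub>R c + s *\<^sub>R b) = q (z + s *\<^sub>R b + s *\<^sub>R c)" by (simp only: swap[of s s])
    then have "s\<^sup>2 * second_derivative q (z + t *\<^sub>R b + r *\<^sub>R c) c b =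
        s\<^sup>2 * second_derivative q (z + t' *\<^sub>R c + r' *\<^sub>R b) b c"
      using 1(5) 2(5) by linarith
    then have "second_derivative q (z + t *\<^sub>R b + r *\<^sub>R c) c b =
        second_derivative q (z + t' *\<^sub>R c + r' *\<^sub>R b) b c" using s by simp
    moreover have "\<bar>second_derivative q (z + t *\<^sub>R b + r *\<^sub>R c) c b - second_derivative q z c b\<bar> < e / 2"
      using near[OF small[of t r]] 1 by simp
    moreover have "\<bar>second_derivative q (z + t' *\<^sub>R c + r' *\<^sub>R b) b c - second_derivative q z b c\<bar> < e / 2"
      using near[OF small[of r' t']] 2 by (simp add: swap)
    ultimately show ?thesis by linarith
  qed
  then show ?thesis using field_le_epsilon[of "\<bar>second_derivative q z b c - second_derivative q z c b\<bar>" 0] by simp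
qed

lemma second_derivative_close:
  assumes z: "z \<in> U" and e: "e > 0"
  shows "\<exists>d>0. ball z d \<subseteq> U \<and>
    (\<forall>x\<in>ball z d. \<forall>v. \<bar>second_derivative q x v v - second_derivative q z v v\<bar> \<le> e * (norm v)\<^sup>2)"
proof -
  define N where "N = real (DIM('a))"
  have N: "N > 0" by (simp add: N_def)
  have "\<forall>\<^sub>F x in nhds z. dist (second_derivative q x a b) (second_derivative q z a b) < e / N\<^sup>2" for a b
  proof -
    have "isCont (\<lambda>x. second_derivative q x a b) z"
      using second_derivative_continuous U z continuous_on_eq_continuous_at by blast
    moreover have "e / N\<^sup>2 > 0" using e N by simp
    ultimately show ?thesis
      by (auto simp: isCont_def tendsto_iff eventually_at_filter elim: eventually_mono
          dest!: spec[of _ "e / N\<^sup>2"])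
  qed
  then have "\<forall>\<^sub>F x in nhds z. x \<in> U \<and> (\<forall>a\<in>Basis. \<forall>b\<in>Basis.
      dist (second_derivative q x a b) (second_derivative q z a b) < e / N\<^sup>2)"
    by (intro eventually_conj eventually_nhds_in_open U z eventually_ball_finite ballI) auto
  then obtain d where d: "d > 0" and near: "\<And>x. dist x z < d \<Longrightarrow> x \<in> U \<and> (\<forall>a\<in>Basis. \<forall>b\<in>Basis.
      dist (second_derivative q x a b) (second_derivative q z a b) < e / N\<^sup>2)"
    unfolding eventually_nhds_metric by blast
  have "\<bar>second_derivative q x v v - second_derivative q z v v\<bar> \<le> e * (norm v)\<^sup>2" if "dist x z < d" for x v
  proof -
    have "second_derivative q x v v - second_derivative q z v v = (\<Sum>a\<in>Basis. \<Sum>b\<in>Basis.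
        (v \<bullet> a) * (v \<bullet> b) * (second_derivative q x a b - second_derivative q z a b))"
      using near[OF that] z
      by (simp add: second_derivative_basis[of _ v v] sum_subtractf right_diff_distrib)
    also have "\<bar>\<dots>\<bar> \<le> (\<Sum>a\<in>(Basis::'a set). \<Sum>b\<in>(Basis::'a set). (norm v)\<^sup>2 * (e / N\<^sup>2))"
    proof (rule order_trans[OF sum_abs], rule sum_mono, rule order_trans[OF sum_abs], rule sum_mono)
      fix a b :: 'a assume ab: "a \<in> Basis" "b \<in> Basis"
      have "\<bar>v \<bullet> a\<bar> * \<bar>v \<bullet> b\<bar> * \<bar>second_derivative q x a b - second_derivative q z a b\<bar> \<le>
          norm v * norm v * (e / N\<^sup>2)"
        using near[OF that] ab Basis_le_norm[of a v] Basis_le_norm[of b v]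
        by (intro mult_mono) (auto simp: dist_real_def less_imp_le)
      then show "\<bar>(v \<bullet> a) * (v \<bullet> b) * (second_derivative q x a b - second_derivative q z a b)\<bar> \<le>
          (norm v)\<^sup>2 * (e / N\<^sup>2)" by (simp add: abs_mult power2_eq_square)
    qed
    also have "\<dots> = e * (norm v)\<^sup>2" using N by (simp add: N_def power2_eq_square)
    finally show ?thesis .
  qed
  then show ?thesis using d near by (intro exI[of _ d]) (auto simp: dist_commute)
qed

lemma second_order_taylor:
  assumes z: "z \<in> U" and e: "e > 0"
  shows "\<exists>d>0. ball z d \<subseteq> U \<and> (\<forall>v. norm v < d \<longrightarrow>
    \<bar>q (z + v) - q z - frechet_derivative q (at z) v - second_derivative q z v v / 2\<bar> \<le> e * (norm v)\<^sup>2)"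
proof -
  from second_derivative_close[OF z, of "2 * e"] e obtain d where d: "d > 0" "ball z d \<subseteq> U" and
    close: "\<And>x v. x \<in> ball z d \<Longrightarrow>
      \<bar>second_derivative q x v v - second_derivative q z v v\<bar> \<le> 2 * e * (norm v)\<^sup>2" by auto
  have "\<bar>q (z + v) - q z - frechet_derivative q (at z) v - second_derivative q z v v / 2\<bar> \<le> e * (norm v)\<^sup>2"
    if v: "norm v < d" for v
  proof -
    have in_ball: "z + t *\<^sub>R v \<in> ball z d" if "0 \<le> t" "t \<le> 1" for t
    proof -
      have "\<bar>t\<bar> * norm v \<le> 1 * norm v" using that by (intro mult_right_mono) auto
      then show ?thesis using v by (simp add: dist_norm)
    qed
    define f where "f m = (if m = (0::nat) then (\<lambda>t. q (z + t *\<^sub>R v)) else if m = 1 then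
      (\<lambda>t. frechet_derivative q (at (z + t *\<^sub>R v)) v) else (\<lambda>t. second_derivative q (z + t *\<^sub>R v) v v))" for m
    have "\<exists>t. 0 < t \<and> t < 1 \<and> f 0 1 = (\<Sum>m<2. f m 0 / fact m * 1 ^ m) + f 2 t / fact 2 * 1 ^ 2"
    proof (rule Maclaurin[of 1 2 f "f 0"])
      show "\<forall>m t. m < 2 \<and> 0 \<le> t \<and> t \<le> 1 \<longrightarrow> (f m has_real_derivative f (Suc m) t) (at t)"
      proof (intro allI impI)
        fix m :: nat and t :: real assume mt: "m < 2 \<and> 0 \<le> t \<and> t \<le> 1"
        then have inU: "z + t *\<^sub>R v \<in> U" using in_ball d by blast
        interpret D: linear "frechet_derivative q (at (z + t *\<^sub>R v))" by (rule C2_derivative_linear[OF inU])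
        interpret DD: linear "\<lambda>h. second_derivative q (z + t *\<^sub>R v) h v"
          using second_derivative_linear(1)[OF inU] .
        have "((\<lambda>t. q (z + t *\<^sub>R v)) has_derivative
            (\<lambda>h. frechet_derivative q (at (z + t *\<^sub>R v)) (h *\<^sub>R v))) (at t)"
          by (rule has_derivative_compose[where f="\<lambda>t. z + t *\<^sub>R v" and g=q, OF _ C2_has_derivative[OF inU]])
             (auto intro!: derivative_eq_intros)
        moreover have "((\<lambda>t. frechet_derivative q (at (z + t *\<^sub>R v)) v) has_derivative
            (\<lambda>h. second_derivative q (z + t *\<^sub>R v) (h *\<^sub>R v) v)) (at t)"
          by (rule has_derivative_compose[where f="\<lambda>t. z + t *\<^sub>R v"
                and g="\<lambda>y. frechet_derivative q (at y) v", OF _ C2_derivative_has_derivative(1)[OF inU]])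
             (auto intro!: derivative_eq_intros)
        ultimately show "(f m has_real_derivative f (Suc m) t) (at t)"
          using mt by (auto simp: f_def less_2_cases_iff has_field_derivative_def D.scale DD.scale
              mult.commute[of _ "frechet_derivative _ _ _"] mult.commute[of _ "second_derivative _ _ _ _"])
      qed
    qed auto
    then obtain t where t: "0 < t" "t < 1" "q (z + v) = q z + frechet_derivative q (at z) v +
        second_derivative q (z + t *\<^sub>R v) v v / 2"
      by (auto simp: f_def numeral_2_eq_2)
    show ?thesis using close[of "z + t *\<^sub>R v" v] in_ball[of t] t by (simp add: abs_le_iff)
  qed
  then show ?thesis using d by auto
qed

end

lemma complex_hessian_entries:
  fixes q :: "complex^'n::finite \<Rightarrow> real"
  assumes U: "open U" and C2: "Ck_on 2 U q" and z: "z \<in> U"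
  shows "complex_hessian q z $ j $ k =
    Complex (second_derivative q z (axis j 1) (axis k 1) + second_derivative q z (axis j \<i>) (axis k \<i>))
      (second_derivative q z (axis j 1) (axis k \<i>) - second_derivative q z (axis j \<i>) (axis k 1)) / 4"
proof -
  let ?F = "\<lambda>y. (complex_of_real (frechet_derivative q (at y) (axis k 1))
      + \<i> * complex_of_real (frechet_derivative q (at y) (axis k \<i>))) / 2"
  have bar: "wirtinger_bar k (\<lambda>x. complex_of_real (q x)) y = ?F y" if "y \<in> U" for y
  proof -
    have "((\<lambda>x. complex_of_real (q x)) has_derivative
        (\<lambda>h. complex_of_real (frechet_derivative q (at y) h))) (at y)"
      by (rule has_derivative_of_real[OF C2_has_derivative[OF U C2 that]])
    from frechet_derivative_at[OF this, symmetric] show ?thesis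
      by (simp add: wirtinger_bar_def)
  qed
  have "(?F has_derivative (\<lambda>h. (complex_of_real (second_derivative q z h (axis k 1))
      + \<i> * complex_of_real (second_derivative q z h (axis k \<i>))) / 2)) (at z)"
    by (intro bounded_linear.has_derivative[OF bounded_linear_divide] has_derivative_add has_derivative_mult_right has_derivative_of_real
        C2_derivative_has_derivative(1)[OF U C2 z])
  then have "(wirtinger_bar k (\<lambda>x. complex_of_real (q x)) has_derivative
      (\<lambda>h. (complex_of_real (second_derivative q z h (axis k 1))
      + \<i> * complex_of_real (second_derivative q z h (axis k \<i>))) / 2)) (at z)"
    by (rule has_derivative_transform_within_open[OF _ U z]) (simp add: bar)
  from frechet_derivative_at[OF this, symmetric] show ?thesis
    by (simp add: complex_hessian_def wirtinger_def complex_eq_iff)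
qed

text \<open>Both sides are expanded in the real coordinates \<open>Re (\<xi> $ j)\<close> and \<open>Im (\<xi> $ j)\<close>.\<close>

lemma Levi_form_eq:
  fixes q :: "complex^'n::finite \<Rightarrow> real"
  assumes U: "open U" and C2: "Ck_on 2 U q" and z: "z \<in> U"
  shows "Re (\<Sum>j\<in>UNIV. \<Sum>k\<in>UNIV. complex_hessian q z $ j $ k * \<xi> $ j * cnj (\<xi> $ k)) = levi_form q z \<xi>"
proof -
  let ?B = "second_derivative q z"
  have lin1: "linear (\<lambda>h. ?B h v)" and lin2: "linear (?B h)" for h v
    using second_derivative_linear[OF U C2 z] by auto
  have expand: "v = (\<Sum>j\<in>UNIV. Re (v $ j) *\<^sub>R axis j 1 + Im (v $ j) *\<^sub>R axis j \<i>)" for v :: "complex^'n"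
    by (simp add: vec_eq_iff axis_def complex_eq_iff if_distrib if_distribR sum.delta' Re_sum Im_sum cong: if_cong)
  have B: "?B v v = (\<Sum>j\<in>UNIV. \<Sum>k\<in>UNIV.
      Re (v $ j) * Re (v $ k) * ?B (axis j 1) (axis k 1) + Re (v $ j) * Im (v $ k) * ?B (axis j 1) (axis k \<i>)
    + Im (v $ j) * Re (v $ k) * ?B (axis j \<i>) (axis k 1) + Im (v $ j) * Im (v $ k) * ?B (axis j \<i>) (axis k \<i>))"
    for v
  proof -
    have s2: "?B h v = (\<Sum>k\<in>UNIV. Re (v $ k) * ?B h (axis k 1) + Im (v $ k) * ?B h (axis k \<i>))" for h
    proof -
      interpret linear "?B h" by (rule lin2)
      show ?thesis by (subst expand) (simp add: sum add scale)
    qed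
    have "?B v v = (\<Sum>j\<in>UNIV. Re (v $ j) * ?B (axis j 1) v + Im (v $ j) * ?B (axis j \<i>) v)"
    proof -
      interpret linear "\<lambda>h. ?B h v" by (rule lin1)
      have "?B v v = ?B (\<Sum>j\<in>UNIV. Re (v $ j) *\<^sub>R axis j 1 + Im (v $ j) *\<^sub>R axis j \<i>) v"
        using expand[of v] by simp
      also have "\<dots> = (\<Sum>j\<in>UNIV. Re (v $ j) * ?B (axis j 1) v + Im (v $ j) * ?B (axis j \<i>) v)"
        by (simp only: sum add scale real_scaleR_def)
      finally show ?thesis .
    qed
    also have "\<dots> = (\<Sum>j\<in>UNIV. \<Sum>k\<in>UNIV.
      Re (v $ j) * Re (v $ k) * ?B (axis j 1) (axis k 1) + Re (v $ j) * Im (v $ k) * ?B (axis j 1) (axis k \<i>)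
    + Im (v $ j) * Re (v $ k) * ?B (axis j \<i>) (axis k 1) + Im (v $ j) * Im (v $ k) * ?B (axis j \<i>) (axis k \<i>))"
      unfolding s2 by (simp add: sum_distrib_left sum.distrib algebra_simps)
    finally show ?thesis .
  qed
  show ?thesis
    unfolding levi_form_def B Re_sum sum.distrib[symmetric] sum_divide_distrib
    by (intro sum.cong refl) (simp add: complex_hessian_entries[OF U C2 z] field_simps)
qed

lemma le_smallest_eigenvalue_complex_hessian_iff:
  fixes q :: "complex^'n::finite \<Rightarrow> real"
  assumes U: "open U" and C2: "Ck_on 2 U q" and z: "z \<in> U"
  shows "c \<le> \<Lambda>\<^sub>1 (complex_hessian q z) \<longleftrightarrow> (\<forall>\<xi>. c * (norm \<xi>)\<^sup>2 \<le> levi_form q z \<xi>)"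
proof -
  have "complex_hessian q z $ j $ k = cnj (complex_hessian q z $ k $ j)" for j k
    using second_derivative_symmetric[OF U C2 z]
    by (simp add: complex_hessian_entries[OF U C2 z] complex_eq_iff)
  from le_smallest_eigenvalue_iff[OF this] show ?thesis unfolding Levi_form_eq[OF U C2 z] .
qed

text \<open>The Levi forms at nearby points differ by at most \<open>e |\<xi>|\<^sup>2\<close>, uniformly in \<open>\<xi>\<close>.\<close>

lemma smallest_eigenvalue_greater_nearby:
  fixes q :: "complex^'n::finite \<Rightarrow> real"
  assumes U: "open U" and C2: "Ck_on 2 U q" and z: "z \<in> U" and c: "c < \<Lambda>\<^sub>1 (complex_hessian q z)"
  shows "\<exists>d>0. ball z d \<subseteq> U \<and> (\<forall>x\<in>ball z d. c < \<Lambda>\<^sub>1 (complex_hessian q x))"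
proof -
  define e where "e = (\<Lambda>\<^sub>1 (complex_hessian q z) - c) / 2"
  have e: "e > 0" using c by (simp add: e_def)
  obtain d where d: "d > 0" "ball z d \<subseteq> U" and
    close: "\<And>x v. x \<in> ball z d \<Longrightarrow>
      \<bar>second_derivative q x v v - second_derivative q z v v\<bar> \<le> e * (norm v)\<^sup>2"
    using second_derivative_close[OF U C2 z e] by auto
  have "c < \<Lambda>\<^sub>1 (complex_hessian q x)" if x: "x \<in> ball z d" for x
  proof -
    have "c + e \<le> \<Lambda>\<^sub>1 (complex_hessian q x)"
      unfolding le_smallest_eigenvalue_complex_hessian_iff[OF U C2 set_mp[OF d(2) x]]
    proof
      fix \<xi> :: "complex^'n"
      have ni: "norm (\<i> *s \<xi>) = norm \<xi>" by (simp add: norm_vec_def norm_mult)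
      define E where "E = e * (norm \<xi>)\<^sup>2"
      have "0 \<le> E" using e by (simp add: E_def)
      then have "levi_form q x \<xi> \<ge> levi_form q z \<xi> - E"
        using close[OF x, of \<xi>, folded E_def] close[OF x, of "\<i> *s \<xi>", unfolded ni, folded E_def]
        unfolding levi_form_def abs_le_iff by (simp add: field_simps)
      moreover have "c + 2 * e \<le> \<Lambda>\<^sub>1 (complex_hessian q z)" by (simp add: e_def field_simps)
      then have "(c + 2 * e) * (norm \<xi>)\<^sup>2 \<le> levi_form q z \<xi>"
        unfolding le_smallest_eigenvalue_complex_hessian_iff[OF U C2 z] by blast
      ultimately show "(c + e) * (norm \<xi>)\<^sup>2 \<le> levi_form q x \<xi>" by (simp add: E_def algebra_simps)
    qed
    then show ?thesis using e by simp
  qed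
  then show ?thesis using d by auto
qed

section \<open>Averages over circles in complex lines\<close>

text \<open>The radius is the norm of \<open>\<xi>\<close>; the circle lies in the complex line through \<open>a\<close> in the direction \<open>\<xi>\<close>.\<close>

definition circle_avg :: "(complex^'n::finite \<Rightarrow> real) \<Rightarrow> complex^'n \<Rightarrow> complex^'n \<Rightarrow> real" where
  "circle_avg w a \<xi> = (LINT \<theta>:{0..2*pi}|lborel. w (a + cis \<theta> *s \<xi>)) / (2*pi)"

definition circle_integrable :: "(complex^'n::finite \<Rightarrow> real) \<Rightarrow> complex^'n \<Rightarrow> complex^'n \<Rightarrow> bool" where
  "circle_integrable w a \<xi> \<longleftrightarrow> set_integrable lborel {0..2*pi} (\<lambda>\<theta>. w (a + cis \<theta> *s \<xi>))"

lemma continuous_cis_smult [continuous_intros]: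
  "continuous_on S g \<Longrightarrow> continuous_on S (\<lambda>x. cis (g x) *s (\<xi>::complex^'n::finite))"
  unfolding vector_scalar_mult_def by (intro continuous_intros)

lemma norm_smult_complex: "norm (c *s (\<xi>::complex^'n::finite)) = cmod c * norm \<xi>"
  by (simp add: norm_vec_def norm_mult L2_set_right_distrib)

lemma smult_scaleR: "c *s (r *\<^sub>R (\<xi>::complex^'n::finite)) = (of_real r * c) *s \<xi>"
  by (simp add: vec_eq_iff) (simp add: scaleR_conv_of_real mult_ac)

lemma smult_add_left: "(c + d) *s (\<xi>::complex^'n::finite) = c *s \<xi> + d *s \<xi>"
  by (simp add: vec_eq_iff distrib_right)

lemma smult_of_real: "of_real r *s (\<xi>::complex^'n::finite) = r *\<^sub>R \<xi>"
  by (simp add: vec_eq_iff) (simp add: scaleR_conv_of_real)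

lemma circle_integrable_continuous:
  assumes "continuous_on S w" and "\<And>\<theta>. a + cis \<theta> *s \<xi> \<in> S"
  shows "circle_integrable w a \<xi>"
proof -
  have "continuous_on {0..2*pi} (\<lambda>\<theta>. w (a + cis \<theta> *s \<xi>))"
    by (rule continuous_on_compose2[OF assms(1)]) (use assms(2) in \<open>auto intro!: continuous_intros\<close>)
  then show ?thesis unfolding circle_integrable_def by (rule borel_integrable_atLeastAtMost')
qed

lemma circle_avg_FTC:
  assumes "\<And>\<theta>. (G has_real_derivative w (a + cis \<theta> *s \<xi>)) (at \<theta>)"
    and "continuous_on {0..2*pi} (\<lambda>\<theta>. w (a + cis \<theta> *s \<xi>))"
  shows "circle_avg w a \<xi> = (G (2*pi) - G 0) / (2*pi)"
proof -
  have "(LINT \<theta>:{0..2*pi}|lborel. w (a + cis \<theta> *s \<xi>)) = G (2*pi) - G 0"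
    unfolding set_lebesgue_integral_def
    by (rule integral_FTC_Icc)
       (use assms in \<open>auto simp: has_real_derivative_iff_has_vector_derivative[symmetric]
          intro: has_field_derivative_at_within\<close>)
  then show ?thesis by (simp add: circle_avg_def)
qed

lemma circle_avg_const [simp]: "circle_avg (\<lambda>_. k) a \<xi> = k"
  by (subst circle_avg_FTC[where G="\<lambda>\<theta>. k * \<theta>"]) (auto intro!: derivative_eq_intros)

lemma circle_integrable_const [simp]: "circle_integrable (\<lambda>_. k) a \<xi>"
  by (rule circle_integrable_continuous[of UNIV]) auto

lemma circle_avg_zero_radius [simp]: "circle_avg w a 0 = w a"
  unfolding circle_avg_def using circle_avg_const[of "w a" a 0, unfolded circle_avg_def] by simp

lemma circle_integrable_add:
  "circle_integrable w a \<xi> \<Longrightarrow> circle_integrable v a \<xi> \<Longrightarrow> circle_integrable (\<lambda>z. w z + v z) a \<xi>"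
  unfolding circle_integrable_def by (rule set_integral_add)

lemma circle_avg_add:
  "circle_integrable w a \<xi> \<Longrightarrow> circle_integrable v a \<xi> \<Longrightarrow>
    circle_avg (\<lambda>z. w z + v z) a \<xi> = circle_avg w a \<xi> + circle_avg v a \<xi>"
  unfolding circle_integrable_def circle_avg_def by (simp add: set_integral_add add_divide_distrib)

lemma circle_avg_cmult: "circle_avg (\<lambda>z. k * w z) a \<xi> = k * circle_avg w a \<xi>"
  unfolding circle_avg_def by simp

lemma circle_avg_mono:
  assumes "circle_integrable w a \<xi>" "circle_integrable v a \<xi>"
    and "\<And>\<theta>. w (a + cis \<theta> *s \<xi>) \<le> v (a + cis \<theta> *s \<xi>)"
  shows "circle_avg w a \<xi> \<le> circle_avg v a \<xi>"
  using assms unfolding circle_integrable_def circle_avg_def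
  by (intro divide_right_mono set_integral_mono) auto

lemma circle_avg_translate:
  "circle_avg (\<lambda>z. w (z + h)) a \<xi> = circle_avg w (a + h) \<xi>"
  "circle_integrable (\<lambda>z. w (z + h)) a \<xi> \<longleftrightarrow> circle_integrable w (a + h) \<xi>"
  unfolding circle_avg_def circle_integrable_def by (simp_all add: algebra_simps)

lemma circle_avg_cong:
  assumes "\<And>\<theta>. w (a + cis \<theta> *s \<xi>) = v (a + cis \<theta> *s \<xi>)"
  shows "circle_avg w a \<xi> = circle_avg v a \<xi>"
  unfolding circle_avg_def assms ..

lemma circle_avg_norm_squared:
  "circle_avg (\<lambda>z. (norm (z - p))\<^sup>2) a \<xi> = (norm (a - p))\<^sup>2 + (norm \<xi>)\<^sup>2"
proof -
  let ?G = "\<lambda>\<theta>. ((norm (a - p))\<^sup>2 + (norm \<xi>)\<^sup>2) * \<theta> + 2 * ((a - p) \<bullet> \<xi>) * sin \<theta>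
      - 2 * ((a - p) \<bullet> (\<i> *s \<xi>)) * cos \<theta>"
  have split: "cis \<theta> *s \<xi> = cos \<theta> *\<^sub>R \<xi> + sin \<theta> *\<^sub>R (\<i> *s \<xi>)" for \<theta>
    by (simp add: vec_eq_iff complex_eq_iff)
  have eq: "(norm (a + cis \<theta> *s \<xi> - p))\<^sup>2 = (norm (a - p))\<^sup>2 + (norm \<xi>)\<^sup>2
      + 2 * ((a - p) \<bullet> \<xi>) * cos \<theta> + 2 * ((a - p) \<bullet> (\<i> *s \<xi>)) * sin \<theta>" for \<theta>
  proof -
    have "(norm (a + cis \<theta> *s \<xi> - p))\<^sup>2 = (norm ((a - p) + cis \<theta> *s \<xi>))\<^sup>2" by (simp add: algebra_simps)
    also have "\<dots> = (norm (a - p))\<^sup>2 + (norm (cis \<theta> *s \<xi>))\<^sup>2 + 2 * ((a - p) \<bullet> (cis \<theta> *s \<xi>))"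
      by (simp only: power2_norm_eq_inner inner_add_left inner_add_right inner_commute)
    finally show ?thesis by (simp add: norm_smult_complex) (simp add: split inner_add_right)
  qed
  have "circle_avg (\<lambda>z. (norm (z - p))\<^sup>2) a \<xi> = (?G (2*pi) - ?G 0) / (2*pi)"
    by (rule circle_avg_FTC)
       (unfold eq, auto intro!: derivative_eq_intros continuous_intros)
  then show ?thesis by simp
qed

lemma eventually_small_disc:
  fixes a \<xi> :: "complex^'n::finite"
  assumes "\<forall>\<^sub>F z in nhds a. P z"
  shows "\<forall>\<^sub>F r in at_right (0::real). \<forall>c. cmod c \<le> 1 \<longrightarrow> P (a + c *s (r *\<^sub>R \<xi>))"
proof -
  obtain d where d: "d > 0" "\<And>z. dist z a < d \<Longrightarrow> P z"
    using assms unfolding eventually_nhds_metric by blast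
  have "\<forall>\<^sub>F r in at_right (0::real). r < d / (norm \<xi> + 1)"
    using d by (intro order_tendstoD(2)[OF tendsto_ident_at] divide_pos_pos add_nonneg_pos) auto
  moreover have "\<forall>\<^sub>F r in at_right (0::real). 0 < r" by (rule eventually_at_right_less)
  ultimately show ?thesis
  proof eventually_elim
    case (elim r)
    show ?case
    proof (intro allI impI)
      fix c :: complex assume c: "cmod c \<le> 1"
      have N: "norm \<xi> + 1 > 0" by (simp add: add_nonneg_pos)
      have "cmod c * (r * norm \<xi>) \<le> 1 * (r * norm \<xi>)"
        using c elim by (intro mult_right_mono) auto
      also have "\<dots> < r * (norm \<xi> + 1)" using elim by (simp add: distrib_left)
      also have "\<dots> < d" using elim N by (simp add: field_simps)
      finally show "P (a + c *s (r *\<^sub>R \<xi>))"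
        using elim by (intro d) (simp add: dist_norm norm_smult_complex)
    qed
  qed
qed

corollary eventually_small_circle:
  fixes a \<xi> :: "complex^'n::finite"
  assumes "\<forall>\<^sub>F z in nhds a. P z"
  shows "\<forall>\<^sub>F r in at_right (0::real). \<forall>\<theta>. P (a + cis \<theta> *s (r *\<^sub>R \<xi>))"
  using eventually_small_disc[OF assms, of \<xi>] by eventually_elim auto

section \<open>Upper semicontinuous functions\<close>

text \<open>Upper semicontinuity already bounds the function locally from above. The bound from below makes it
  integrable on all small circles.\<close>

definition usc_locally_bounded :: "'a::metric_space set \<Rightarrow> ('a \<Rightarrow> real) \<Rightarrow> bool" where
  "usc_locally_bounded V w \<longleftrightarrow> open V \<and> (\<forall>t. open {z\<in>V. w z < t}) \<and>
     (\<forall>a\<in>V. \<exists>B. \<forall>\<^sub>F z in nhds a. B \<le> w z)"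

lemma usc_locally_boundedD:
  assumes "usc_locally_bounded V w"
  shows "open V" and "\<And>t. open {z\<in>V. w z < t}" and "\<And>a. a \<in> V \<Longrightarrow> \<exists>B. \<forall>\<^sub>F z in nhds a. B \<le> w z"
    and "\<And>a t. a \<in> V \<Longrightarrow> w a < t \<Longrightarrow> \<forall>\<^sub>F z in nhds a. w z < t"
proof -
  show *: "open V" "\<And>t. open {z\<in>V. w z < t}" "\<And>a. a \<in> V \<Longrightarrow> \<exists>B. \<forall>\<^sub>F z in nhds a. B \<le> w z"
    using assms unfolding usc_locally_bounded_def by auto
  fix a t assume "a \<in> V" "w a < t"
  then have "\<forall>\<^sub>F z in nhds a. z \<in> {z\<in>V. w z < t}" using *(2) by (intro eventually_nhds_in_open) auto
  then show "\<forall>\<^sub>F z in nhds a. w z < t" by eventually_elim auto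
qed

lemma usc_locally_boundedI:
  assumes "open V" and "\<And>a t. a \<in> V \<Longrightarrow> w a < t \<Longrightarrow> \<forall>\<^sub>F z in nhds a. w z < t"
    and "\<And>a. a \<in> V \<Longrightarrow> \<exists>B. \<forall>\<^sub>F z in nhds a. B \<le> w z"
  shows "usc_locally_bounded V w"
proof -
  have "open {z\<in>V. w z < t}" for t
  proof (subst open_subopen, intro ballI)
    fix a assume "a \<in> {z\<in>V. w z < t}"
    then have "\<forall>\<^sub>F z in nhds a. z \<in> V \<and> w z < t"
      using assms by (intro eventually_conj eventually_nhds_in_open) auto
    then show "\<exists>T. open T \<and> a \<in> T \<and> T \<subseteq> {z\<in>V. w z < t}"
      unfolding eventually_nhds by blast
  qed
  then show ?thesis unfolding usc_locally_bounded_def using assms by blast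
qed

lemma usc_locally_bounded_subset:
  assumes "usc_locally_bounded V w" "open W" "W \<subseteq> V"
  shows "usc_locally_bounded W w"
  using usc_locally_boundedD[OF assms(1)] assms by (intro usc_locally_boundedI) auto

lemma usc_locally_bounded_continuous:
  assumes "open V" "continuous_on V w"
  shows "usc_locally_bounded V w"
proof -
  have tends: "(w \<longlongrightarrow> w a) (nhds a)" if "a \<in> V" for a
    using assms that continuous_on_eq_continuous_at isCont_def tendsto_at_iff_tendsto_nhds by blast
  show ?thesis
  proof (rule usc_locally_boundedI)
    fix a assume "a \<in> V"
    then have "\<forall>\<^sub>F z in nhds a. w a - 1 < w z" by (intro order_tendstoD(1)[OF tends]) auto
    then show "\<exists>B. \<forall>\<^sub>F z in nhds a. B \<le> w z" by (auto elim!: eventually_mono intro!: exI less_imp_le)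
  qed (use assms order_tendstoD(2)[OF tends] in auto)
qed

lemma usc_locally_bounded_max:
  assumes "usc_locally_bounded V w" "usc_locally_bounded V v"
  shows "usc_locally_bounded V (\<lambda>z. max (w z) (v z))"
proof (rule usc_locally_boundedI)
  show "open V" using usc_locally_boundedD(1)[OF assms(1)] .
  show "\<forall>\<^sub>F z in nhds a. max (w z) (v z) < t" if "a \<in> V" "max (w a) (v a) < t" for a t
    using usc_locally_boundedD(4)[OF assms(1), of a t] usc_locally_boundedD(4)[OF assms(2), of a t] that
    by (auto intro: eventually_conj)
  show "\<exists>B. \<forall>\<^sub>F z in nhds a. B \<le> max (w z) (v z)" if a: "a \<in> V" for a
  proof -
    obtain B where "\<forall>\<^sub>F z in nhds a. B \<le> w z" using usc_locally_boundedD(3)[OF assms(1) a] ..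
    then have "\<forall>\<^sub>F z in nhds a. B \<le> max (w z) (v z)" by eventually_elim auto
    then show ?thesis ..
  qed
qed

lemma usc_locally_bounded_add:
  assumes "usc_locally_bounded V w" "usc_locally_bounded V v"
  shows "usc_locally_bounded V (\<lambda>z. w z + v z)"
proof (rule usc_locally_boundedI)
  show "open V" using usc_locally_boundedD(1)[OF assms(1)] .
  show "\<forall>\<^sub>F z in nhds a. w z + v z < t" if a: "a \<in> V" and t: "w a + v a < t" for a t
  proof -
    define e where "e = (t - w a - v a) / 2"
    have e: "e > 0" using t by (simp add: e_def)
    have "\<forall>\<^sub>F z in nhds a. w z < w a + e" "\<forall>\<^sub>F z in nhds a. v z < v a + e"
      using usc_locally_boundedD(4)[OF assms(1) a, of "w a + e"]
        usc_locally_boundedD(4)[OF assms(2) a, of "v a + e"] e by auto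
    then show ?thesis by eventually_elim (simp add: e_def field_simps)
  qed
  show "\<exists>B. \<forall>\<^sub>F z in nhds a. B \<le> w z + v z" if a: "a \<in> V" for a
  proof -
    obtain B C where "\<forall>\<^sub>F z in nhds a. B \<le> w z" "\<forall>\<^sub>F z in nhds a. C \<le> v z"
      using usc_locally_boundedD(3)[OF assms(1) a] usc_locally_boundedD(3)[OF assms(2) a] by auto
    then have "\<forall>\<^sub>F z in nhds a. B + C \<le> w z + v z" by eventually_elim auto
    then show ?thesis ..
  qed
qed

lemma usc_locally_bounded_cmult:
  assumes "usc_locally_bounded V w" "k > 0"
  shows "usc_locally_bounded V (\<lambda>z. k * w z)"
proof (rule usc_locally_boundedI)
  show "open V" using usc_locally_boundedD(1)[OF assms(1)] .
  show "\<forall>\<^sub>F z in nhds a. k * w z < t" if a: "a \<in> V" and t: "k * w a < t" for a t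
    using usc_locally_boundedD(4)[OF assms(1) a, of "t / k"] t assms(2)
    by (simp add: field_simps)
  show "\<exists>B. \<forall>\<^sub>F z in nhds a. B \<le> k * w z" if a: "a \<in> V" for a
  proof -
    obtain B where "\<forall>\<^sub>F z in nhds a. B \<le> w z" using usc_locally_boundedD(3)[OF assms(1) a] ..
    then have "\<forall>\<^sub>F z in nhds a. k * B \<le> k * w z"
      by eventually_elim (use assms(2) in simp)
    then show ?thesis ..
  qed
qed

lemma usc_locally_bounded_translate:
  fixes V :: "'a::real_normed_vector set"
  assumes "usc_locally_bounded V w"
  shows "usc_locally_bounded {z. z + h \<in> V} (\<lambda>z. w (z + h))"
proof -
  have tr: "\<forall>\<^sub>F z in nhds a. P (z + h)" if "\<forall>\<^sub>F z in nhds (a + h). P z" for a P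
  proof -
    have "((\<lambda>z. z + h) \<longlongrightarrow> a + h) (nhds a)" by (intro tendsto_add filterlim_ident tendsto_const)
    then show ?thesis using that by (simp add: filterlim_iff)
  qed
  have "open ((\<lambda>z. z + h) -` V)"
    by (intro open_vimage usc_locally_boundedD(1)[OF assms] continuous_intros)
  then have "open {z. z + h \<in> V}" by (simp add: vimage_def)
  moreover have "\<exists>B. \<forall>\<^sub>F z in nhds a. B \<le> w (z + h)" if a: "a + h \<in> V" for a
  proof -
    obtain B where "\<forall>\<^sub>F z in nhds (a + h). B \<le> w z" using usc_locally_boundedD(3)[OF assms a] ..
    then show ?thesis by (intro exI tr)
  qed
  moreover have "\<forall>\<^sub>F z in nhds a. w (z + h) < t" if "a + h \<in> V" "w (a + h) < t" for a t
    using usc_locally_boundedD(4)[OF assms that] by (rule tr)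
  ultimately show ?thesis by (intro usc_locally_boundedI) auto
qed

lemma usc_attains_max:
  assumes usc: "usc_locally_bounded V w" and K: "compact K" "K \<noteq> {}" "K \<subseteq> V"
  shows "\<exists>x\<in>K. \<forall>y\<in>K. w y \<le> w x"
proof (rule ccontr)
  assume "\<not> ?thesis"
  then have "\<forall>x\<in>K. \<exists>y\<in>K. w x < w y" by (auto simp: not_le)
  then have "K \<subseteq> (\<Union>y\<in>K. {z\<in>V. w z < w y})" using K(3) by blast
  then obtain C where C: "C \<subseteq> K" "finite C" "K \<subseteq> (\<Union>y\<in>C. {z\<in>V. w z < w y})"
    using compactE_image[OF K(1), of K "\<lambda>y. {z\<in>V. w z < w y}"] usc_locally_boundedD(2)[OF usc] by auto
  have "C \<noteq> {}" using C K(2) by auto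
  then have "Max (w ` C) \<in> w ` C" using C(2) by (intro Max_in) auto
  then obtain m where "m \<in> C" "Max (w ` C) = w m" by blast
  then have m: "m \<in> C" "\<forall>y\<in>C. w y \<le> w m"
    using Max_ge[OF finite_imageI[OF C(2), of w]] by auto
  then obtain y where "y \<in> C" "w m < w y" using C by blast
  then show False using m by force
qed

lemma usc_eventually_circle_integrable:
  fixes w :: "complex^'n::finite \<Rightarrow> real"
  assumes usc: "usc_locally_bounded V w" and a: "a \<in> V"
  shows "\<forall>\<^sub>F r in at_right (0::real). circle_integrable w a (r *\<^sub>R \<xi>)"
proof -
  obtain B where B: "\<forall>\<^sub>F z in nhds a. B \<le> w z" using usc_locally_boundedD(3)[OF usc a] ..
  have "\<forall>\<^sub>F z in nhds a. z \<in> V \<and> B \<le> w z \<and> w z < w a + 1"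
    using usc_locally_boundedD(1)[OF usc] a B
    by (intro eventually_conj eventually_nhds_in_open usc_locally_boundedD(4)[OF usc]) auto
  then have "\<forall>\<^sub>F r in at_right (0::real). \<forall>\<theta>. a + cis \<theta> *s (r *\<^sub>R \<xi>) \<in> V \<and>
      B \<le> w (a + cis \<theta> *s (r *\<^sub>R \<xi>)) \<and> w (a + cis \<theta> *s (r *\<^sub>R \<xi>)) < w a + 1"
    by (rule eventually_small_circle)
  then show ?thesis
  proof eventually_elim
    case (elim r)
    let ?p = "\<lambda>\<theta>. a + cis \<theta> *s (r *\<^sub>R \<xi>)"
    have "open {\<theta>. w (?p \<theta>) < t}" for t
    proof -
      have "open (?p -` {z\<in>V. w z < t})"
        by (intro open_vimage usc_locally_boundedD(2)[OF usc] continuous_intros)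
      moreover have "?p -` {z\<in>V. w z < t} = {\<theta>. w (?p \<theta>) < t}" using elim by auto
      ultimately show ?thesis by simp
    qed
    then have "(\<lambda>\<theta>. w (?p \<theta>)) \<in> borel_measurable borel"
      by (intro borel_measurableI_less) (simp add: borel_open)
    then have meas: "(\<lambda>\<theta>. w (?p \<theta>)) \<in> borel_measurable lborel" by simp
    have "\<bar>w (?p \<theta>)\<bar> \<le> \<bar>B\<bar> + \<bar>w a + 1\<bar>" for \<theta>
      using elim[rule_format, of \<theta>] by linarith
    then have "integrable lborel (\<lambda>\<theta>. indicator {0..2*pi} \<theta> *\<^sub>R w (?p \<theta>))"
      by (intro integrableI_bounded_set_indicator[where B="\<bar>B\<bar> + \<bar>w a + 1\<bar>"] meas) auto
    then show ?case by (simp add: circle_integrable_def set_integrable_def)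
  qed
qed

section \<open>Functions of class \<open>C\<^sup>k\<close>\<close>

lemma Ck_on_cong:
  assumes "open U" and "\<And>x. x \<in> U \<Longrightarrow> f x = g x" and "Ck_on k U f"
  shows "Ck_on k U g"
  using assms(2,3)
proof (induction k arbitrary: f g)
  case 0
  then show ?case by (simp cong: continuous_on_cong)
next
  case (Suc k)
  have D: "(g has_derivative frechet_derivative f (at x)) (at x)" if x: "x \<in> U" for x
  proof -
    have "(f has_derivative frechet_derivative f (at x)) (at x)"
      using Suc.prems(2) x by (simp add: frechet_derivative_works[symmetric])
    then show ?thesis
      by (rule has_derivative_transform_within_open[OF _ assms(1) x]) (rule Suc.prems(1))
  qed
  have "Ck_on k U (\<lambda>x. frechet_derivative g (at x) b)" if b: "b \<in> Basis" for b
  proof (rule Suc.IH)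
    show "Ck_on k U (\<lambda>x. frechet_derivative f (at x) b)" using Suc.prems(2) b by simp
    show "frechet_derivative f (at x) b = frechet_derivative g (at x) b" if "x \<in> U" for x
      using frechet_derivative_at[OF D[OF that]] by simp
  qed
  then show ?case using D by (auto simp: differentiable_def)
qed

lemma Ck_on_SucI:
  assumes "open U" and D: "\<And>x. x \<in> U \<Longrightarrow> (q has_derivative q' x) (at x)"
    and Ck: "\<And>b. b \<in> Basis \<Longrightarrow> Ck_on k U (\<lambda>x. q' x b)"
  shows "Ck_on (Suc k) U q"
proof -
  have "Ck_on k U (\<lambda>x. frechet_derivative q (at x) b)" if "b \<in> Basis" for b
  proof (rule Ck_on_cong[OF assms(1) _ Ck[OF that]])
    show "q' x b = frechet_derivative q (at x) b" if "x \<in> U" for x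
      using frechet_derivative_at[OF D[OF that]] by simp
  qed
  then show ?thesis using D by (auto simp: differentiable_def)
qed

lemma Ck_on_subset: "Ck_on k U q \<Longrightarrow> V \<subseteq> U \<Longrightarrow> Ck_on k V q"
  by (induction k arbitrary: q) (auto intro: continuous_on_subset)

lemma Ck_on_const: "open U \<Longrightarrow> Ck_on k U (\<lambda>_. c)"
proof (induction k arbitrary: c)
  case (Suc k)
  show ?case by (rule Ck_on_SucI[where q'="\<lambda>_ _. 0"]) (use Suc in auto)
qed simp

lemma Ck_on_add:
  assumes "open U" "Ck_on k U f" "Ck_on k U g"
  shows "Ck_on k U (\<lambda>x. f x + g x)"
  using assms(2,3)
proof (induction k arbitrary: f g)
  case (Suc k)
  show ?case
  proof (rule Ck_on_SucI[OF assms(1)])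
    fix x assume "x \<in> U"
    then show "((\<lambda>x. f x + g x) has_derivative
        (\<lambda>h. frechet_derivative f (at x) h + frechet_derivative g (at x) h)) (at x)"
      using Suc.prems by (intro has_derivative_add) (simp_all add: frechet_derivative_works[symmetric])
  qed (use Suc in auto)
qed (auto intro: continuous_intros)

lemma Ck_on_cmult:
  assumes "open U" "Ck_on k U f"
  shows "Ck_on k U (\<lambda>x. c * f x)"
  using assms(2)
proof (induction k arbitrary: f)
  case (Suc k)
  show ?case
  proof (rule Ck_on_SucI[OF assms(1)])
    fix x assume "x \<in> U"
    then show "((\<lambda>x. c * f x) has_derivative (\<lambda>h. c * frechet_derivative f (at x) h)) (at x)"
      using Suc.prems by (intro has_derivative_mult_right) (simp_all add: frechet_derivative_works[symmetric])
  qed (use Suc in auto)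
qed (auto intro: continuous_intros)

lemma Ck_on_bounded_linear:
  assumes "open U" "bounded_linear M"
  shows "Ck_on k U M"
proof (cases k)
  case 0
  then show ?thesis using assms by (simp add: linear_continuous_on)
next
  case (Suc m)
  then show ?thesis
    using Ck_on_SucI[OF assms(1), of M "\<lambda>_. M" m] bounded_linear_imp_has_derivative[OF assms(2)]
      Ck_on_const[OF assms(1)] by simp
qed

lemma Ck_on_norm_squared_affine:
  fixes M :: "'a::euclidean_space \<Rightarrow> 'b::real_inner"
  assumes U: "open U" and M: "bounded_linear M"
  shows "Ck_on k U (\<lambda>x. (norm (M x + p))\<^sup>2)"
proof (cases k)
  case 0
  then show ?thesis by (simp, intro continuous_intros linear_continuous_on M)
next
  case (Suc m)
  have "((\<lambda>x. (norm (M x + p))\<^sup>2) has_derivative (\<lambda>h. 2 * (M x \<bullet> M h) + 2 * (p \<bullet> M h))) (at x)" for x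
  proof -
    have "((\<lambda>x. M x + p) has_derivative (\<lambda>h. M h + 0)) (at x)"
      by (intro has_derivative_add bounded_linear_imp_has_derivative[OF M] has_derivative_const)
    from has_derivative_inner[OF this this] show ?thesis
      unfolding power2_norm_eq_inner by (simp add: inner_add_left inner_add_right inner_commute)
  qed
  moreover have "Ck_on m U (\<lambda>x. 2 * (M x \<bullet> M h) + 2 * (p \<bullet> M h))" for h
    by (intro Ck_on_add Ck_on_cmult Ck_on_const U Ck_on_bounded_linear)
       (rule bounded_linear_compose[OF bounded_linear_inner_left M])
  ultimately show ?thesis
    unfolding Suc by (intro Ck_on_SucI[OF U])
qed

corollary Ck_on_norm_squared:
  fixes p :: "'a::euclidean_space"
  assumes "open U"
  shows "Ck_on k U (\<lambda>x. (norm (x - p))\<^sup>2)"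
  using Ck_on_norm_squared_affine[OF assms bounded_linear_ident, of k "-p"] by simp

lemma Ck_on_Re_poly:
  fixes M :: "'a::euclidean_space \<Rightarrow> complex"
  assumes U: "open U" and M: "bounded_linear M"
  shows "Ck_on k U (\<lambda>x. Re (poly p (M x + m)))"
proof (induction k arbitrary: p)
  case 0
  show ?case by (simp, intro continuous_intros linear_continuous_on M)
next
  case (Suc k)
  show ?case
  proof (rule Ck_on_SucI[OF U])
    fix x
    have "((\<lambda>x. M x + m) has_derivative M) (at x)"
      using has_derivative_add[OF bounded_linear_imp_has_derivative[OF M] has_derivative_const[of m]] by simp
    from has_derivative_compose[OF this poly_DERIV[of p "M x + m", unfolded has_field_derivative_def]]
    show "((\<lambda>x. Re (poly p (M x + m))) has_derivative (\<lambda>h. Re (poly (smult (M h) (pderiv p)) (M x + m)))) (at x)"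
      by (intro has_derivative_Re) (simp add: mult.commute)
  qed (rule Suc)
qed

section \<open>Smallest eigenvalue and circle averages\<close>

text \<open>Averaging the Taylor polynomial over the circle kills the linear part, and
  the quadratic part contributes \<open>r\<^sup>2\<close> times half the mean of the second derivatives along \<open>\<xi>\<close> and \<open>\<i> \<xi>\<close>.\<close>

lemma C2_circle_avg_expansion:
  fixes q :: "complex^'n::finite \<Rightarrow> real"
  assumes U: "open U" and C2: "Ck_on 2 U q" and z: "z \<in> U" and e: "e > 0"
  shows "\<forall>\<^sub>F r in at_right 0. \<bar>circle_avg q z (r *\<^sub>R \<xi>) - q z - levi_form q z \<xi> * r\<^sup>2\<bar> \<le> e * r\<^sup>2"
proof -
  define N where "N = (norm \<xi>)\<^sup>2 + 1"
  have N: "N > 0" by (simp add: N_def add_nonneg_pos)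
  obtain d where d: "d > 0" "ball z d \<subseteq> U" and
    taylor: "\<And>v. norm v < d \<Longrightarrow> \<bar>q (z + v) - q z - frechet_derivative q (at z) v
      - second_derivative q z v v / 2\<bar> \<le> e / N * (norm v)\<^sup>2"
    using second_order_taylor[OF U C2 z, of "e / N"] e N by auto
  define T where "T y = q z + frechet_derivative q (at z) (y - z) + second_derivative q z (y - z) (y - z) / 2" for y
  have "\<forall>\<^sub>F y in nhds z. y \<in> ball z d" using d by (intro eventually_nhds_in_open) auto
  then have "\<forall>\<^sub>F r in at_right (0::real). \<forall>\<theta>. z + cis \<theta> *s (r *\<^sub>R \<xi>) \<in> ball z d"
    by (rule eventually_small_circle)
  then show ?thesis
  proof eventually_elim
    case (elim r)
    interpret D: linear "frechet_derivative q (at z)" by (rule C2_derivative_linear[OF U C2 z])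
    interpret D1: linear "\<lambda>h. second_derivative q z h v" for v
      using second_derivative_linear(1)[OF U C2 z] .
    interpret D2: linear "second_derivative q z h" for h
      using second_derivative_linear(2)[OF U C2 z] .
    let ?A = "frechet_derivative q (at z) \<xi>" let ?B = "frechet_derivative q (at z) (\<i> *s \<xi>)"
    let ?C = "second_derivative q z \<xi> \<xi>" let ?E = "second_derivative q z (\<i> *s \<xi>) (\<i> *s \<xi>)"
    let ?F = "second_derivative q z \<xi> (\<i> *s \<xi>) + second_derivative q z (\<i> *s \<xi>) \<xi>"
    have split: "cis \<theta> *s (r *\<^sub>R \<xi>) = (r * cos \<theta>) *\<^sub>R \<xi> + (r * sin \<theta>) *\<^sub>R (\<i> *s \<xi>)" for \<theta>
      by (simp add: vec_eq_iff complex_eq_iff algebra_simps)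
    have T: "T (z + cis \<theta> *s (r *\<^sub>R \<xi>)) = q z + r * cos \<theta> * ?A + r * sin \<theta> * ?B
        + r\<^sup>2 / 2 * ((cos \<theta>)\<^sup>2 * ?C + cos \<theta> * sin \<theta> * ?F + (sin \<theta>)\<^sup>2 * ?E)" for \<theta>
      unfolding T_def
      by (simp add: split D.add D.scale D1.add D1.scale D2.add D2.scale power2_eq_square algebra_simps)
    let ?G = "\<lambda>\<theta>. q z * \<theta> + r * ?A * sin \<theta> - r * ?B * cos \<theta> + r\<^sup>2 / 2 * (?C * ((\<theta> + sin \<theta> * cos \<theta>) / 2)
        + ?F * ((sin \<theta>)\<^sup>2 / 2) + ?E * ((\<theta> - sin \<theta> * cos \<theta>) / 2))"
    have G: "(?G has_real_derivative T (z + cis \<theta> *s (r *\<^sub>R \<xi>))) (at \<theta>)" for \<theta>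
    proof -
      have s: "(sin \<theta>)\<^sup>2 = 1 - (cos \<theta>)\<^sup>2" by (simp add: sin_squared_eq)
      show ?thesis
        unfolding T by (rule derivative_eq_intros refl | simp)+
          (simp add: power2_eq_square[symmetric] s field_simps)
    qed
    have contT: "continuous_on {0..2*pi} (\<lambda>\<theta>. T (z + cis \<theta> *s (r *\<^sub>R \<xi>)))"
      unfolding T by (intro continuous_intros)
    have "circle_avg T z (r *\<^sub>R \<xi>) = (?G (2*pi) - ?G 0) / (2*pi)"
      by (rule circle_avg_FTC[OF G contT])
    also have "\<dots> = q z + levi_form q z \<xi> * r\<^sup>2"
      by (simp add: levi_form_def field_simps)
    finally have avgT: "circle_avg T z (r *\<^sub>R \<xi>) = q z + levi_form q z \<xi> * r\<^sup>2" .
    have intT: "circle_integrable T z (r *\<^sub>R \<xi>)"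
      unfolding circle_integrable_def using contT by (rule borel_integrable_atLeastAtMost')
    have "continuous_on (ball z d) q"
      using C2_onD(1)[OF C2] d(2) by (intro continuous_at_imp_continuous_on) (auto intro: differentiable_imp_continuous_within)
    then have intq: "circle_integrable q z (r *\<^sub>R \<xi>)"
      by (rule circle_integrable_continuous) (rule elim[rule_format])
    have close: "\<bar>q (z + cis \<theta> *s (r *\<^sub>R \<xi>)) - T (z + cis \<theta> *s (r *\<^sub>R \<xi>))\<bar> \<le> e * r\<^sup>2" for \<theta>
    proof -
      have "norm (cis \<theta> *s (r *\<^sub>R \<xi>)) < d" using elim[rule_format, of \<theta>] by (simp add: dist_norm)
      from taylor[OF this] have "\<bar>q (z + cis \<theta> *s (r *\<^sub>R \<xi>)) - T (z + cis \<theta> *s (r *\<^sub>R \<xi>))\<bar>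
          \<le> e / N * (norm (cis \<theta> *s (r *\<^sub>R \<xi>)))\<^sup>2"
        by (simp add: T_def diff_diff_eq add.assoc)
      also have "\<dots> = e * (((norm \<xi>)\<^sup>2 / N) * r\<^sup>2)"
        by (simp add: norm_smult_complex power_mult_distrib)
      also have "\<dots> \<le> e * (1 * r\<^sup>2)"
        using e N by (intro mult_left_mono mult_right_mono) (auto simp: N_def)
      finally show ?thesis by simp
    qed
    have "circle_avg q z (r *\<^sub>R \<xi>) \<le> circle_avg (\<lambda>y. T y + e * r\<^sup>2) z (r *\<^sub>R \<xi>)"
      using close by (intro circle_avg_mono intq circle_integrable_add intT circle_integrable_const)
        (simp add: abs_le_iff algebra_simps)
    moreover have "circle_avg (\<lambda>y. T y + (- e * r\<^sup>2)) z (r *\<^sub>R \<xi>) \<le> circle_avg q z (r *\<^sub>R \<xi>)"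
      using close by (intro circle_avg_mono intq circle_integrable_add intT circle_integrable_const)
        (simp add: abs_le_iff algebra_simps)
    ultimately show ?case
      unfolding circle_avg_add[OF intT circle_integrable_const] circle_avg_const avgT abs_le_iff
      by (simp add: algebra_simps)
  qed
qed

lemma smallest_eigenvalue_imp_submean:
  fixes q :: "complex^'n::finite \<Rightarrow> real"
  assumes U: "open U" and C2: "Ck_on 2 U q" and z: "z \<in> U" and c: "c < \<Lambda>\<^sub>1 (complex_hessian q z)"
  shows "\<forall>\<^sub>F r in at_right 0. q z + c * (norm \<xi>)\<^sup>2 * r\<^sup>2 \<le> circle_avg q z (r *\<^sub>R \<xi>)"
proof (cases "\<xi> = 0")
  case False
  define L where "L = \<Lambda>\<^sub>1 (complex_hessian q z)"
  have pos: "(L - c) * (norm \<xi>)\<^sup>2 > 0" using False c by (simp add: L_def)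
  have lev: "L * (norm \<xi>)\<^sup>2 \<le> levi_form q z \<xi>"
    using le_smallest_eigenvalue_complex_hessian_iff[OF U C2 z, of L] by (simp add: L_def)
  from C2_circle_avg_expansion[OF U C2 z pos, of \<xi>] show ?thesis
  proof eventually_elim
    case (elim r)
    have "L * (norm \<xi>)\<^sup>2 * r\<^sup>2 \<le> levi_form q z \<xi> * r\<^sup>2" using lev by (intro mult_right_mono) auto
    then show ?case using elim unfolding abs_le_iff by (simp add: algebra_simps)
  qed
qed simp

text \<open>With \<open>smallest_eigenvalue_imp_submean\<close> this translates between the eigenvalue condition and circle
  averages, so that Hessians need not be handled below.\<close>

lemma submean_imp_le_smallest_eigenvalue:
  fixes q :: "complex^'n::finite \<Rightarrow> real"
  assumes U: "open U" and C2: "Ck_on 2 U q" and z: "z \<in> U"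
    and sub: "\<And>c \<xi>. c < k \<Longrightarrow> \<forall>\<^sub>F r in at_right 0. q z + c * (norm \<xi>)\<^sup>2 * r\<^sup>2 \<le> circle_avg q z (r *\<^sub>R \<xi>)"
  shows "k \<le> \<Lambda>\<^sub>1 (complex_hessian q z)"
proof (rule dense_le)
  fix c assume c: "c < k"
  show "c \<le> \<Lambda>\<^sub>1 (complex_hessian q z)"
    unfolding le_smallest_eigenvalue_complex_hessian_iff[OF U C2 z]
  proof (rule allI, rule field_le_epsilon)
    fix \<xi> :: "complex^'n" and e :: real assume e: "e > 0"
    have "\<forall>\<^sub>F r in at_right (0::real). 0 < r" by (rule eventually_at_right_less)
    then have "\<forall>\<^sub>F r in at_right (0::real). c * (norm \<xi>)\<^sup>2 \<le> levi_form q z \<xi> + e"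
      using sub[OF c, of \<xi>] C2_circle_avg_expansion[OF U C2 z e, of \<xi>]
    proof eventually_elim
      case (elim r)
      then have "c * (norm \<xi>)\<^sup>2 * r\<^sup>2 \<le> (levi_form q z \<xi> + e) * r\<^sup>2"
        unfolding abs_le_iff by (simp add: algebra_simps)
      then show ?case using elim(1) by simp
    qed
    then show "c * (norm \<xi>)\<^sup>2 \<le> levi_form q z \<xi> + e" by (simp add: eventually_const_iff)
  qed
qed

section \<open>Local submean functions and the global mean value inequality\<close>

text \<open>The constant \<open>c\<close> is strictly below \<open>f a\<close> and the admissible radii depend on \<open>a\<close>, \<open>\<xi>\<close> and \<open>c\<close>: this absorbs
  the error of second-order expansions and makes the condition local.\<close>

definition local_submean ::
    "(complex^'n::finite) set \<Rightarrow> (complex^'n \<Rightarrow> real) \<Rightarrow> (complex^'n \<Rightarrow> real) \<Rightarrow> bool" where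
  "local_submean V f w \<longleftrightarrow> (\<forall>a\<in>V. \<forall>\<xi> c. c < f a \<longrightarrow>
     (\<forall>\<^sub>F r in at_right 0. w a + c * (norm \<xi>)\<^sup>2 * r\<^sup>2 \<le> circle_avg w a (r *\<^sub>R \<xi>)))"

lemma local_submeanD:
  "local_submean V f w \<Longrightarrow> a \<in> V \<Longrightarrow> c < f a \<Longrightarrow>
    \<forall>\<^sub>F r in at_right 0. w a + c * (norm \<xi>)\<^sup>2 * r\<^sup>2 \<le> circle_avg w a (r *\<^sub>R \<xi>)"
  unfolding local_submean_def by blast

text \<open>The viscosity condition, restricted to test functions whose circle averages in the direction \<open>\<xi>\<close> have
  no error term. Local submean functions and viscosity subsolutions both satisfy it, so that one proof
  of the disc inequality serves both.\<close>

definition model_tested ::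
    "(complex^'n::finite) set \<Rightarrow> (complex^'n \<Rightarrow> real) \<Rightarrow> (complex^'n \<Rightarrow> real) \<Rightarrow> bool" where
  "model_tested V f w \<longleftrightarrow> (\<forall>z\<in>V. \<forall>Q \<xi> c. \<xi> \<noteq> 0 \<longrightarrow> Ck_on 2 UNIV Q \<longrightarrow>
     (\<forall>x. \<forall>r>0. circle_avg Q x (r *\<^sub>R \<xi>) = Q x + c * (norm \<xi>)\<^sup>2 * r\<^sup>2) \<longrightarrow>
     (\<forall>\<^sub>F y in nhds z. w y - Q y \<le> w z - Q z) \<longrightarrow> f z \<le> c)"

lemma C2_on_imp_continuous: "Ck_on 2 U q \<Longrightarrow> continuous_on U q"
  by (intro continuous_at_imp_continuous_on ballI differentiable_imp_continuous_within C2_onD(1))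

lemma submean_below_exact:
  assumes xi: "\<xi> \<noteq> 0"
    and 1: "\<forall>\<^sub>F r in at_right 0. (A::real) + c * (norm \<xi>)\<^sup>2 * r\<^sup>2 \<le> A + c' * (norm \<xi>)\<^sup>2 * r\<^sup>2"
  shows "c \<le> c'"
proof -
  have "\<forall>\<^sub>F r in at_right (0::real). c \<le> c'"
    using 1 eventually_at_right_less[of "0::real"]
  proof eventually_elim
    case (elim r)
    then have "c * ((norm \<xi>)\<^sup>2 * r\<^sup>2) \<le> c' * ((norm \<xi>)\<^sup>2 * r\<^sup>2)" by (simp add: mult.assoc)
    then show ?case by (rule mult_right_le_imp_le) (use xi elim in simp)
  qed
  then show ?thesis by (simp add: eventually_const_iff)
qed

lemma local_submean_imp_model_tested:
  fixes w :: "complex^'n::finite \<Rightarrow> real"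
  assumes usc: "usc_locally_bounded V w" and sub: "local_submean V f w"
  shows "model_tested V f w"
  unfolding model_tested_def
proof (intro ballI allI impI)
  fix z Q \<xi> c
  assume z: "z \<in> V" and xi: "\<xi> \<noteq> (0::complex^'n)" and C2: "Ck_on 2 UNIV Q"
    and exact: "\<forall>x. \<forall>r>0. circle_avg Q x (r *\<^sub>R \<xi>) = Q x + c * (norm \<xi>)\<^sup>2 * r\<^sup>2"
    and touch: "\<forall>\<^sub>F y in nhds z. w y - Q y \<le> w z - Q z"
  have contQ: "continuous_on UNIV Q" using C2 by (rule C2_on_imp_continuous)
  show "f z \<le> c"
  proof (rule dense_le)
    fix c' assume "c' < f z"
    from local_submeanD[OF sub z this, of \<xi>] eventually_small_circle[OF touch, of \<xi>]
      usc_eventually_circle_integrable[OF usc z, of \<xi>] eventually_at_right_less[of "0::real"]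
    have "\<forall>\<^sub>F r in at_right 0. w z + c' * (norm \<xi>)\<^sup>2 * r\<^sup>2 \<le> w z + c * (norm \<xi>)\<^sup>2 * r\<^sup>2"
    proof eventually_elim
      case (elim r)
      have intQ: "circle_integrable Q z (r *\<^sub>R \<xi>)" by (rule circle_integrable_continuous[OF contQ]) simp
      have "circle_avg w z (r *\<^sub>R \<xi>) \<le> circle_avg (\<lambda>y. Q y + (w z - Q z)) z (r *\<^sub>R \<xi>)"
        using elim(2) by (intro circle_avg_mono elim circle_integrable_add intQ circle_integrable_const)
          (simp add: algebra_simps)
      also have "\<dots> = w z + c * (norm \<xi>)\<^sup>2 * r\<^sup>2"
        using exact elim(4) by (simp add: circle_avg_add[OF intQ circle_integrable_const])
      finally show ?case using elim(1) by simp
    qed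
    then show "c' \<le> c" by (rule submean_below_exact[OF xi])
  qed
qed

lemma viscosity_subsolution_imp_model_tested:
  fixes w :: "complex^'n::finite \<Rightarrow> real"
  assumes sub: "viscosity_subsolution V f (\<lambda>z. ereal (w z))"
  shows "model_tested V f w"
  unfolding model_tested_def
proof (intro ballI allI impI)
  fix z Q \<xi> c
  assume z: "z \<in> V" and xi: "\<xi> \<noteq> (0::complex^'n)" and C2: "Ck_on 2 UNIV Q"
    and exact: "\<forall>x. \<forall>r>0. circle_avg Q x (r *\<^sub>R \<xi>) = Q x + c * (norm \<xi>)\<^sup>2 * r\<^sup>2"
    and touch: "\<forall>\<^sub>F y in nhds z. w y - Q y \<le> w z - Q z"
  have contQ: "continuous_on UNIV Q" using C2 by (rule C2_on_imp_continuous)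
  define q where "q y = Q y + (w z - Q z)" for y
  have q: "Ck_on 2 UNIV q" unfolding q_def by (intro Ck_on_add Ck_on_const C2) auto
  have "\<forall>\<^sub>F y in nhds z. ereal (w y) \<le> ereal (q y)"
    using touch by eventually_elim (simp add: q_def algebra_simps)
  then have "touches_above q (\<lambda>z. ereal (w z)) z" by (simp add: touches_above_def q_def)
  moreover have "C2_near z q" unfolding C2_near_def using q by (intro exI[of _ UNIV]) auto
  ultimately have f: "f z \<le> \<Lambda>\<^sub>1 (complex_hessian q z)"
    using sub z unfolding viscosity_subsolution_def by blast
  show "f z \<le> c"
  proof (rule dense_le)
    fix c' assume "c' < f z"
    then have "c' < \<Lambda>\<^sub>1 (complex_hessian q z)" using f by simp
    from smallest_eigenvalue_imp_submean[OF open_UNIV q UNIV_I this, of \<xi>] eventually_at_right_less[of "0::real"]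
    have "\<forall>\<^sub>F r in at_right 0. q z + c' * (norm \<xi>)\<^sup>2 * r\<^sup>2 \<le> q z + c * (norm \<xi>)\<^sup>2 * r\<^sup>2"
    proof eventually_elim
      case (elim r)
      have intQ: "circle_integrable Q z (r *\<^sub>R \<xi>)" by (rule circle_integrable_continuous[OF contQ]) simp
      have "circle_avg q z (r *\<^sub>R \<xi>) = q z + c * (norm \<xi>)\<^sup>2 * r\<^sup>2"
        using exact elim(2) unfolding q_def by (simp add: circle_avg_add[OF intQ circle_integrable_const])
      then show ?case using elim(1) by simp
    qed
    then show "c' \<le> c" by (rule submean_below_exact[OF xi])
  qed
qed

subsection \<open>Harmonic polynomials on the unit circle\<close>

text \<open>On the unit circle \<open>\<zeta>\<close> and its conjugate are inverse to each other, so products of a polynomial and a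
  conjugate polynomial reduce, up to taking real parts, to a polynomial. Since
  \<open>2 Re A Re B = Re (A B) + Re (A (cnj B))\<close>, boundary values of harmonic polynomials thus form an algebra,
  and the theorem of Stone and Weierstrass applies to them.\<close>

lemma Re_poly_mult_cnj_on_circle:
  "\<exists>s. \<forall>\<zeta>. cmod \<zeta> = 1 \<longrightarrow> Re (poly p \<zeta> * cnj (poly q \<zeta>)) = Re (poly s \<zeta>)"
proof (induction p arbitrary: q)
  case 0
  show ?case by (rule exI[of _ 0]) simp
next
  case (pCons a p)
  obtain b q' where q: "q = pCons b q'" by (rule pCons_cases)
  obtain s where s: "\<And>\<zeta>. cmod \<zeta> = 1 \<Longrightarrow> Re (poly p \<zeta> * cnj (poly q' \<zeta>)) = Re (poly s \<zeta>)"
    using pCons.IH by blast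
  have "Re (poly (pCons a p) \<zeta> * cnj (poly q \<zeta>)) =
      Re (poly (smult (cnj a) (pCons b q') + smult (cnj b) (pCons 0 p) + s) \<zeta>)" if \<zeta>: "cmod \<zeta> = 1" for \<zeta>
  proof -
    have one: "\<zeta> * cnj \<zeta> = 1" using \<zeta> complex_norm_square[of \<zeta>] by simp
    have "poly (pCons a p) \<zeta> * cnj (poly q \<zeta>) = a * cnj (b + \<zeta> * poly q' \<zeta>) + cnj b * (\<zeta> * poly p \<zeta>)
        + (\<zeta> * cnj \<zeta>) * (poly p \<zeta> * cnj (poly q' \<zeta>))"
      by (simp add: q algebra_simps)
    then have "Re (poly (pCons a p) \<zeta> * cnj (poly q \<zeta>)) = Re (a * cnj (b + \<zeta> * poly q' \<zeta>))
        + Re (cnj b * (\<zeta> * poly p \<zeta>)) + Re (poly p \<zeta> * cnj (poly q' \<zeta>))"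
      by (simp only: one mult_1_left plus_complex.sel)
    also have "Re (a * cnj (b + \<zeta> * poly q' \<zeta>)) = Re (cnj a * (b + \<zeta> * poly q' \<zeta>))"
      by (simp add: algebra_simps)
    finally show ?thesis
      by (simp only: s[OF \<zeta>] poly_add poly_smult poly_pCons plus_complex.sel add_0_left)
  qed
  then show ?case by blast
qed

lemma harmonic_polynomial_approximation:
  fixes g :: "complex \<Rightarrow> real"
  assumes "continuous_on (sphere 0 1) g" and "e > 0"
  shows "\<exists>p. \<forall>\<zeta>. cmod \<zeta> = 1 \<longrightarrow> \<bar>g \<zeta> - Re (poly p \<zeta>)\<bar> < e"
proof -
  define R :: "(complex \<Rightarrow> real) set" where
    "R = {h. \<exists>p. \<forall>\<zeta>. cmod \<zeta> = 1 \<longrightarrow> h \<zeta> = Re (poly p \<zeta>)}"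
  interpret function_ring_on R "sphere 0 1"
  proof
    show "compact (sphere (0::complex) 1)" by simp
  next
    fix h assume "h \<in> R"
    then obtain p where p: "\<And>\<zeta>. cmod \<zeta> = 1 \<Longrightarrow> h \<zeta> = Re (poly p \<zeta>)" by (auto simp: R_def)
    have "continuous_on (sphere 0 1) (\<lambda>\<zeta>. Re (poly p \<zeta>))" by (intro continuous_intros)
    then show "continuous_on (sphere 0 1) h" by (rule continuous_on_eq) (simp add: p)
  next
    fix h1 h2 assume "h1 \<in> R" "h2 \<in> R"
    then obtain p1 p2 where p: "\<And>\<zeta>. cmod \<zeta> = 1 \<Longrightarrow> h1 \<zeta> = Re (poly p1 \<zeta>)"
      "\<And>\<zeta>. cmod \<zeta> = 1 \<Longrightarrow> h2 \<zeta> = Re (poly p2 \<zeta>)" by (auto simp: R_def)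
    show "(\<lambda>x. h1 x + h2 x) \<in> R" unfolding R_def using p by (auto intro!: exI[of _ "p1 + p2"])
    obtain s where s: "\<And>\<zeta>. cmod \<zeta> = 1 \<Longrightarrow> Re (poly p1 \<zeta> * cnj (poly p2 \<zeta>)) = Re (poly s \<zeta>)"
      using Re_poly_mult_cnj_on_circle by blast
    have "h1 \<zeta> * h2 \<zeta> = Re (poly (smult (1/2) (p1 * p2 + s)) \<zeta>)" if "cmod \<zeta> = 1" for \<zeta>
      using s[OF that] p[OF that] by (simp add: field_simps)
    then show "(\<lambda>x. h1 x * h2 x) \<in> R" unfolding R_def by blast
  next
    fix c :: real
    show "(\<lambda>_. c) \<in> R" unfolding R_def by (auto intro!: exI[of _ "[:complex_of_real c:]"])
  next
    fix x y :: complex assume "x \<noteq> y"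
    then have "Re x \<noteq> Re y \<or> Im x \<noteq> Im y" by (simp add: complex_eq_iff)
    moreover have "Re \<in> R" unfolding R_def by (auto intro!: exI[of _ "[:0, 1:]"])
    moreover have "Im \<in> R" unfolding R_def by (auto intro!: exI[of _ "[:0, - \<i>:]"])
    ultimately show "\<exists>f\<in>R. f x \<noteq> f y" by blast
  qed
  obtain h where "h \<in> R" "\<forall>x\<in>sphere 0 1. \<bar>g x - h x\<bar> < e"
    using Stone_Weierstrass_basic[OF assms] by blast
  then show ?thesis unfolding R_def by force
qed

lemma poly_antiderivative: "\<exists>P. pderiv P = (q :: complex poly)"
proof
  show "pderiv (\<Sum>i\<le>degree q. monom (coeff q i / of_nat (Suc i)) (Suc i)) = q"
    by (simp add: higher_pderiv_sum[of 1, simplified] pderiv_monom poly_as_sum_of_monoms del: of_nat_Suc)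
qed

lemma Re_poly_mean_value:
  fixes M :: "complex^'n::finite \<Rightarrow> complex"
  assumes M: "\<And>c. M (x + c *s \<xi>) = M x + c"
  shows "circle_avg (\<lambda>z. Re (poly p (M z))) x (r *\<^sub>R \<xi>) = Re (poly p (M x))"
proof -
  define p' where "p' = pcompose p [:M x, of_real r:]"
  have p': "poly p (M (x + cis \<theta> *s (r *\<^sub>R \<xi>))) = poly p' (cis \<theta>)" for \<theta>
    unfolding smult_scaleR M by (simp add: p'_def poly_pcompose mult.commute)
  obtain a q where q: "p' = pCons a q" by (rule pCons_cases)
  obtain P where P: "pderiv P = q" using poly_antiderivative by blast
  define G where "G \<theta> = Re a * \<theta> + Re (- \<i> * poly P (cis \<theta>))" for \<theta>
  have "circle_avg (\<lambda>z. Re (poly p (M z))) x (r *\<^sub>R \<xi>) = (G (2*pi) - G 0) / (2*pi)"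
  proof (rule circle_avg_FTC)
    fix \<theta> :: real
    have "(cis has_vector_derivative \<i> * cis \<theta>) (at \<theta>)"
      unfolding has_vector_derivative_def using has_derivative_cis[OF has_derivative_ident] .
    from field_vector_diff_chain_at[OF this poly_DERIV[of P "cis \<theta>"]]
    have "((\<lambda>\<theta>. poly P (cis \<theta>)) has_vector_derivative (\<i> * cis \<theta>) * poly q (cis \<theta>)) (at \<theta>)"
      by (simp add: o_def P)
    then have "((\<lambda>\<theta>. - \<i> * poly P (cis \<theta>)) has_vector_derivative cis \<theta> * poly q (cis \<theta>)) (at \<theta>)"
      by (rule has_vector_derivative_eq_rhs[OF has_vector_derivative_mult_right])
        (simp add: mult.assoc[symmetric])
    from bounded_linear.has_vector_derivative[OF bounded_linear_Re this]
    have "((\<lambda>\<theta>. Re (- \<i> * poly P (cis \<theta>))) has_real_derivative Re (cis \<theta> * poly q (cis \<theta>))) (at \<theta>)"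
      by (simp only: has_real_derivative_iff_has_vector_derivative)
    moreover have "((\<lambda>\<theta>. Re a * \<theta>) has_real_derivative Re a) (at \<theta>)"
      by (auto intro!: derivative_eq_intros)
    ultimately have "(G has_real_derivative Re a + Re (cis \<theta> * poly q (cis \<theta>))) (at \<theta>)"
      unfolding G_def[abs_def] by (intro DERIV_add)
    then show "(G has_real_derivative Re (poly p (M (x + cis \<theta> *s (r *\<^sub>R \<xi>))))) (at \<theta>)"
      by (simp add: p' q)
  next
    show "continuous_on {0..2*pi} (\<lambda>\<theta>. Re (poly p (M (x + cis \<theta> *s (r *\<^sub>R \<xi>)))))"
      unfolding p' by (intro continuous_intros)
  qed
  also have "\<dots> = Re a" by (simp add: G_def)
  also have "a = poly p (M x)"
    using arg_cong[OF q, of "\<lambda>s. poly s 0"] by (simp add: p'_def poly_pcompose)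
  finally show ?thesis .
qed

subsection \<open>The mean value inequality on discs\<close>

text \<open>Let \<open>L\<close> be the coordinate along the complex line through \<open>a\<close> in the direction \<open>\<xi>\<close> and \<open>P\<close> the component
  orthogonal to it. If the inequality fails, choose a harmonic polynomial \<open>Re p\<close> slightly above \<open>u\<close> on the
  circle and add \<open>c1 (|z - a|\<^sup>2 - |\<xi>|\<^sup>2)\<close>, where \<open>c1\<close> is slightly below \<open>k\<close>. The result \<open>H\<close> exceeds \<open>u\<close> on the
  circle, but not at the centre. Adding \<open>K |P|\<^sup>2\<close> with large \<open>K\<close> gives \<open>Q\<close> that dominates \<open>u\<close> on the whole
  boundary of a thin polydisc around the disc. Then \<open>w - Q\<close> has an interior maximum for \<open>w \<le> u\<close> close to
  \<open>u\<close> at \<open>a\<close>, which contradicts the test because \<open>Q\<close> has excess \<open>c1 < f\<close>.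

  The approximation hypothesis covers both a subsolution (\<open>w = u\<close>) and a supremum of subsolutions.\<close>

theorem submean_on_discs:
  fixes u f :: "complex^'n::finite \<Rightarrow> real"
  assumes \<Omega>: "open \<Omega>" and u: "continuous_on \<Omega> u" and f: "continuous_on \<Omega> f"
    and approx: "\<And>x \<eta>. x \<in> \<Omega> \<Longrightarrow> \<eta> > 0 \<Longrightarrow> \<exists>w. usc_locally_bounded \<Omega> w \<and> (\<forall>z\<in>\<Omega>. w z \<le> u z) \<and>
      u x - \<eta> < w x \<and> model_tested \<Omega> f w"
    and disc: "\<And>c. cmod c \<le> 1 \<Longrightarrow> a + c *s \<xi> \<in> \<Omega> \<and> k \<le> f (a + c *s \<xi>)"
  shows "u a + k * (norm \<xi>)\<^sup>2 \<le> circle_avg u a \<xi>"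
proof (cases "\<xi> = 0")
  case False
  show ?thesis
  proof (rule ccontr)
    assume neg: "\<not> ?thesis"
    define gap where "gap = u a + k * (norm \<xi>)\<^sup>2 - circle_avg u a \<xi>"
    have gap: "gap > 0" using neg by (simp add: gap_def)
    have nxi: "(norm \<xi>)\<^sup>2 > 0" using False by simp
    \<comment> \<open>A quarter of the gap is given to \<open>c1\<close> and half of it to the polynomial approximation.\<close>
    define c1 where "c1 = k - gap / (4 * (norm \<xi>)\<^sup>2)"
    have c1: "c1 < k" using gap nxi by (simp add: c1_def)
    have c1': "u a + c1 * (norm \<xi>)\<^sup>2 = circle_avg u a \<xi> + 3/4 * gap"
      using nxi by (simp add: c1_def gap_def field_simps)
    define hp :: "complex^'n \<Rightarrow> complex" where
      "hp z = (\<Sum>j\<in>UNIV. z $ j * cnj (\<xi> $ j)) / of_real ((norm \<xi>)\<^sup>2)" for z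
    have hp_smult: "hp (c *s z) = c * hp z" for c z
      by (simp add: hp_def sum_distrib_left mult.assoc)
    have hp_add: "hp (y + z) = hp y + hp z" for y z
      by (simp add: hp_def sum.distrib distrib_right add_divide_distrib)
    have "(\<Sum>j\<in>UNIV. \<xi> $ j * cnj (\<xi> $ j)) = of_real ((norm \<xi>)\<^sup>2)"
      by (simp add: complex_norm_square[symmetric] norm_vec_def L2_set_def sum_nonneg)
    then have hp_xi: "hp \<xi> = 1" using nxi by (simp add: hp_def)
    have hp: "bounded_linear hp"
    proof (rule linear_conv_bounded_linear[THEN iffD1], rule linearI)
      show "hp (r *\<^sub>R z) = r *\<^sub>R hp z" for r z
        using hp_smult[of "of_real r" z] by (simp add: smult_of_real scaleR_conv_of_real)
    qed (rule hp_add)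
    define L where "L z = hp z + (- hp a)" for z
    define M where "M z = z + (- (hp z *s \<xi>))" for z
    have M: "bounded_linear M"
    proof (rule linear_conv_bounded_linear[THEN iffD1], rule linearI)
      show "M (y + z) = M y + M z" for y z by (simp add: M_def hp_add smult_add_left)
      show "M (r *\<^sub>R z) = r *\<^sub>R M z" for r z
        using hp_smult[of "of_real r" z]
        by (simp add: M_def smult_of_real vec_eq_iff algebra_simps) (simp add: scaleR_conv_of_real)
    qed
    define P where "P z = M z + (- M a)" for z
    have split: "z = a + L z *s \<xi> + P z" for z
      by (simp add: P_def M_def L_def vec_eq_iff algebra_simps)
    have L_line: "L (z + c *s \<xi>) = L z + c" for z c
      by (simp add: L_def hp_add hp_smult hp_xi)
    have P_line: "P (z + c *s \<xi>) = P z" for z c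
      by (simp add: P_def M_def hp_add hp_smult hp_xi smult_add_left)
    have La: "L a = 0" and Pa: "P a = 0" by (simp_all add: L_def P_def)
    have contL: "continuous_on UNIV L" and contP: "continuous_on UNIV P"
      unfolding L_def[abs_def] P_def[abs_def]
      by (intro continuous_intros linear_continuous_on hp M)+
    have "continuous_on (sphere 0 1) (\<lambda>\<zeta>. u (a + \<zeta> *s \<xi>) + gap / 4)"
      unfolding vector_scalar_mult_def
      by (intro continuous_intros continuous_on_compose2[OF u])
         (use disc in \<open>auto simp: vector_scalar_mult_def\<close>)
    from harmonic_polynomial_approximation[OF this, of "gap / 4"] gap obtain p where
      p0: "\<And>\<zeta>. cmod \<zeta> = 1 \<Longrightarrow> \<bar>u (a + \<zeta> *s \<xi>) + gap / 4 - Re (poly p \<zeta>)\<bar> < gap / 4" by auto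
    then have p: "u (a + \<zeta> *s \<xi>) < Re (poly p \<zeta>) \<and> Re (poly p \<zeta>) < u (a + \<zeta> *s \<xi>) + gap / 2"
      if "cmod \<zeta> = 1" for \<zeta>
      using p0[OF that] by (intro conjI; linarith)
    define H where "H z = Re (poly p (L z)) + c1 * ((norm (z - a))\<^sup>2 - (norm \<xi>)\<^sup>2)" for z
    have contH: "continuous_on S H" for S
      unfolding H_def[abs_def]
      by (intro continuous_intros continuous_on_subset[OF contL]) auto
    have center: "H a < u a"
    proof -
      have "Re (poly p 0) = circle_avg (\<lambda>z. Re (poly p (L z))) a \<xi>"
        using Re_poly_mean_value[of L a \<xi> p 1] by (simp add: L_line La)
      also have "\<dots> \<le> circle_avg (\<lambda>z. u z + gap / 2) a \<xi>"
      proof (rule circle_avg_mono)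
        show "circle_integrable (\<lambda>z. Re (poly p (L z))) a \<xi>"
          by (rule circle_integrable_continuous[of UNIV]) (intro continuous_intros contL, simp)
        show "circle_integrable (\<lambda>z. u z + gap / 2) a \<xi>"
          using disc by (intro circle_integrable_continuous[of \<Omega>] continuous_intros u) auto
        show "Re (poly p (L (a + cis \<theta> *s \<xi>))) \<le> u (a + cis \<theta> *s \<xi>) + gap / 2" for \<theta>
          using p[of "cis \<theta>"] by (simp add: L_line La)
      qed
      also have "\<dots> = circle_avg u a \<xi> + gap / 2"
        using disc by (subst circle_avg_add) (auto intro!: circle_integrable_continuous[of \<Omega>] u)
      finally show ?thesis using c1' gap by (simp add: H_def La algebra_simps)
    qed
    define D where "D = (\<lambda>c. a + c *s \<xi>) ` cball 0 1"
    define V where "V = {z\<in>\<Omega>. c1 < f z} \<inter> ({z. cmod (L z) < 1} \<union> {z\<in>\<Omega>. u z < H z})"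
    \<comment> \<open>The neighbourhood of the disc in which the thin polydisc \<open>E\<close> has to lie.\<close>
    have "open V"
    proof -
      have "usc_locally_bounded \<Omega> (\<lambda>z. - f z)" "usc_locally_bounded \<Omega> (\<lambda>z. u z - H z)"
        by (intro usc_locally_bounded_continuous \<Omega> continuous_intros f u contH)+
      from usc_locally_boundedD(2)[OF this(1), of "- c1"] usc_locally_boundedD(2)[OF this(2), of 0]
      have "open {z\<in>\<Omega>. c1 < f z}" "open {z\<in>\<Omega>. u z < H z}" by simp_all
      moreover have "open {z. cmod (L z) < 1}"
        by (intro open_Collect_less continuous_intros contL)
      ultimately show ?thesis unfolding V_def by blast
    qed
    moreover have "compact D"
      unfolding D_def vector_scalar_mult_def by (intro compact_continuous_image continuous_intros) auto
    moreover have "D \<subseteq> V"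
    proof
      fix z assume "z \<in> D"
      then obtain c where "c \<in> cball 0 1" and c: "z = a + c *s \<xi>" unfolding D_def by (rule imageE)
      then have c': "cmod c \<le> 1" by simp
      have "cmod (L z) < 1 \<or> u z < H z"
      proof (cases "cmod c = 1")
        case True
        then have "norm (z - a) = norm \<xi>" by (simp add: c norm_smult_complex)
        then show ?thesis using p[OF True] by (simp add: H_def L_line La c)
      qed (use c' in \<open>simp add: c L_line La\<close>)
      then show "z \<in> V" using disc[OF c'] c1 unfolding V_def by (auto simp: c)
    qed
    ultimately obtain d where d: "d > 0" "(\<Union>x\<in>D. ball x d) \<subseteq> V"
      using compact_subset_open_imp_ball_epsilon_subset[of D V] by blast
    define \<delta> where "\<delta> = d / 2"
    have \<delta>: "\<delta> > 0" "\<delta> < d" using d by (simp_all add: \<delta>_def)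
    define E where "E = {z. cmod (L z) \<le> 1} \<inter> {z. norm (P z) \<le> \<delta>}"
    have EV: "E \<subseteq> V"
    proof
      fix z assume z: "z \<in> E"
      then have "a + L z *s \<xi> \<in> D" unfolding E_def D_def by auto
      moreover have "dist (a + L z *s \<xi>) z < d"
        using z \<delta> by (subst (2) split[of z]) (simp add: E_def dist_norm)
      ultimately have "z \<in> (\<Union>x\<in>D. ball x d)" by (intro UN_I) simp_all
      then show "z \<in> V" using d(2) by blast
    qed
    have "closed E" unfolding E_def
      by (intro closed_Int closed_Collect_le continuous_intros contL contP)
    moreover have "E \<subseteq> cball a (norm \<xi> + \<delta>)"
    proof
      fix z assume z: "z \<in> E"
      have "norm (z - a) = norm (L z *s \<xi> + P z)" by (subst split[of z]) simp
      also have "\<dots> \<le> cmod (L z) * norm \<xi> + norm (P z)"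
        using norm_triangle_ineq[of "L z *s \<xi>" "P z"] by (simp add: norm_smult_complex)
      also have "\<dots> \<le> 1 * norm \<xi> + \<delta>" using z by (intro add_mono mult_right_mono) (auto simp: E_def)
      finally show "z \<in> cball a (norm \<xi> + \<delta>)" by (simp add: dist_norm norm_minus_commute)
    qed
    ultimately have E: "compact E" using compact_eq_bounded_closed bounded_subset bounded_cball by blast
    have aE: "a \<in> E" using \<delta> by (simp add: E_def La Pa)
    have E\<Omega>: "E \<subseteq> \<Omega>" using EV by (auto simp: V_def)
    have "continuous_on E (\<lambda>z. u z - H z)"
      by (intro continuous_intros contH continuous_on_subset[OF u E\<Omega>])
    from continuous_attains_sup[OF E _ this] aE obtain B where B: "\<And>z. z \<in> E \<Longrightarrow> u z - H z \<le> B" by blast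
    define K where "K = \<bar>B\<bar> / \<delta>\<^sup>2"
    have K: "K \<ge> 0" "K * \<delta>\<^sup>2 \<ge> B" using \<delta> by (simp_all add: K_def)
    define Q where "Q z = H z + K * (norm (P z))\<^sup>2" for z
    have C2Q: "Ck_on 2 UNIV Q"
    proof -
      have "Ck_on 2 UNIV (\<lambda>z. (Re (poly p (L z)) + (c1 * (norm (z - a))\<^sup>2 + (- c1 * (norm \<xi>)\<^sup>2)))
          + K * (norm (P z))\<^sup>2)"
        unfolding L_def P_def
        by (intro Ck_on_add Ck_on_cmult Ck_on_const Ck_on_Re_poly Ck_on_norm_squared Ck_on_norm_squared_affine
            open_UNIV hp M)
      then show ?thesis by (simp add: Q_def[abs_def] H_def[abs_def] algebra_simps)
    qed
    have contQ: "continuous_on S Q" for S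
      unfolding Q_def[abs_def] by (intro continuous_intros contH continuous_on_subset[OF contP]) auto
    have exact: "circle_avg Q x (r *\<^sub>R \<xi>) = Q x + c1 * (norm \<xi>)\<^sup>2 * r\<^sup>2" for x r
    proof -
      have i1: "circle_integrable (\<lambda>z. Re (poly p (L z))) x (r *\<^sub>R \<xi>)"
        by (rule circle_integrable_continuous[of UNIV]) (intro continuous_intros contL, simp)
      have i2: "circle_integrable (\<lambda>z. c1 * (norm (z - a))\<^sup>2) x (r *\<^sub>R \<xi>)"
        by (rule circle_integrable_continuous[of UNIV]) (intro continuous_intros, simp)
      let ?k = "K * (norm (P x))\<^sup>2 - c1 * (norm \<xi>)\<^sup>2"
      have "circle_avg Q x (r *\<^sub>R \<xi>) = circle_avg (\<lambda>z. (Re (poly p (L z)) + c1 * (norm (z - a))\<^sup>2) + ?k) x (r *\<^sub>R \<xi>)"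
        by (rule circle_avg_cong) (simp add: Q_def H_def P_line smult_scaleR algebra_simps)
      also have "\<dots> = Re (poly p (L x)) + c1 * ((norm (x - a))\<^sup>2 + (norm (r *\<^sub>R \<xi>))\<^sup>2) + ?k"
        by (simp add: circle_avg_add circle_integrable_add i1 i2 circle_avg_cmult circle_avg_norm_squared
            Re_poly_mean_value L_line)
      also have "\<dots> = Q x + c1 * (norm \<xi>)\<^sup>2 * r\<^sup>2"
        by (simp add: Q_def H_def power_mult_distrib algebra_simps)
      finally show ?thesis .
    qed
    obtain w where w: "usc_locally_bounded \<Omega> w" "\<And>z. z \<in> \<Omega> \<Longrightarrow> w z \<le> u z" "u a - (u a - H a) < w a"
      "model_tested \<Omega> f w"
      using approx[of a "u a - H a"] center aE E\<Omega> by auto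
    have "continuous_on \<Omega> (\<lambda>z. - Q z)" by (intro continuous_intros contQ)
    from usc_locally_bounded_add[OF w(1) usc_locally_bounded_continuous[OF \<Omega> this]]
    have uscQ: "usc_locally_bounded \<Omega> (\<lambda>z. w z - Q z)" by simp
    obtain z where z: "z \<in> E" and zmax: "\<And>y. y \<in> E \<Longrightarrow> w y - Q y \<le> w z - Q z"
      using usc_attains_max[OF uscQ E _ E\<Omega>] aE by blast
    have "0 < w a - Q a" using w(3) by (simp add: Q_def Pa)
    also have "\<dots> \<le> w z - Q z" by (rule zmax[OF aE])
    also have "\<dots> \<le> u z - Q z" using w(2) z E\<Omega> by auto
    finally have pos: "Q z < u z" by simp
    have "cmod (L z) < 1"
    proof (rule ccontr)
      assume "\<not> cmod (L z) < 1"
      then have "u z < H z" using z EV unfolding V_def by blast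
      moreover have "H z \<le> Q z" using K by (simp add: Q_def)
      ultimately show False using pos by simp
    qed
    moreover have "norm (P z) < \<delta>"
    proof (rule ccontr)
      assume "\<not> norm (P z) < \<delta>"
      then have "norm (P z) = \<delta>" using z by (simp add: E_def)
      then have "Q z \<ge> H z + B" using K by (simp add: Q_def)
      then show False using pos B[OF z] by simp
    qed
    moreover have "open ({z. cmod (L z) < 1} \<inter> {z. norm (P z) < \<delta>})"
      by (intro open_Int open_Collect_less continuous_intros contL contP)
    ultimately have "\<forall>\<^sub>F y in nhds z. y \<in> {z. cmod (L z) < 1} \<inter> {z. norm (P z) < \<delta>}"
      by (intro eventually_nhds_in_open) auto
    then have touch: "\<forall>\<^sub>F y in nhds z. w y - Q y \<le> w z - Q z"
      by eventually_elim (rule zmax, simp add: E_def)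
    have "f z \<le> c1"
      using w(4)[unfolded model_tested_def, rule_format, of z \<xi> Q c1] z E\<Omega> False C2Q exact touch by blast
    moreover have "c1 < f z" using z EV by (auto simp: V_def)
    ultimately show False by simp
  qed
qed simp

lemma submean_on_discs_imp_local_submean:
  fixes u f :: "complex^'n::finite \<Rightarrow> real"
  assumes \<Omega>: "open \<Omega>" and f: "continuous_on \<Omega> f"
    and sub: "\<And>a \<xi> k. (\<And>c. cmod c \<le> 1 \<Longrightarrow> a + c *s \<xi> \<in> \<Omega> \<and> k \<le> f (a + c *s \<xi>)) \<Longrightarrow>
      u a + k * (norm \<xi>)\<^sup>2 \<le> circle_avg u a \<xi>"
  shows "local_submean \<Omega> f u"
  unfolding local_submean_def
proof (intro ballI allI impI)
  fix a \<xi> c assume a: "a \<in> \<Omega>" and c: "c < f a"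
  have "usc_locally_bounded \<Omega> (\<lambda>z. - f z)"
    by (intro usc_locally_bounded_continuous \<Omega> continuous_intros f)
  from usc_locally_boundedD(4)[OF this a, of "- c"] c have "\<forall>\<^sub>F z in nhds a. c < f z" by simp
  moreover have "\<forall>\<^sub>F z in nhds a. z \<in> \<Omega>" using \<Omega> a by (rule eventually_nhds_in_open)
  ultimately have "\<forall>\<^sub>F z in nhds a. z \<in> \<Omega> \<and> c \<le> f z" by eventually_elim auto
  from eventually_small_disc[OF this, of \<xi>]
  show "\<forall>\<^sub>F r in at_right 0. u a + c * (norm \<xi>)\<^sup>2 * r\<^sup>2 \<le> circle_avg u a (r *\<^sub>R \<xi>)"
  proof eventually_elim
    case (elim r)
    show ?case using sub[OF elim[rule_format]] by (simp add: power_mult_distrib mult_ac)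
  qed
qed

section \<open>Mollification\<close>

lemma has_real_derivative_max_0_power:
  "((\<lambda>s. max 0 s ^ Suc (Suc n)) has_real_derivative real (Suc (Suc n)) * max 0 s ^ Suc n) (at (s::real))"
proof -
  consider "s < 0" | "s = 0" | "s > 0" by linarith
  then show ?thesis
  proof cases
    case 1
    have "((\<lambda>s. 0) has_real_derivative real (Suc (Suc n)) * max 0 s ^ Suc n) (at s)" using 1 by simp
    then show ?thesis
      by (rule has_field_derivative_transform_within_open[of _ _ _ "{..<0}"]) (use 1 in \<open>auto simp: max_def\<close>)
  next
    case 2
    have "\<exists>g. (\<forall>z. max 0 z ^ Suc (Suc n) - max 0 (0::real) ^ Suc (Suc n) = g z * (z - 0)) \<and> isCont g 0 \<and> g 0 = 0"
    proof (intro exI[of _ "\<lambda>z. max 0 z ^ Suc n"] conjI allI)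
      show "isCont (\<lambda>z::real. max 0 z ^ Suc n) 0" by (intro continuous_intros)
    qed (auto simp: max_def)
    then show ?thesis unfolding 2 by (simp add: CARAT_DERIV)
  next
    case 3
    have "((\<lambda>s. s ^ Suc (Suc n)) has_real_derivative real (Suc (Suc n)) * max 0 s ^ Suc n) (at s)"
      by (rule derivative_eq_intros refl)+ (use 3 in \<open>auto simp: max_def algebra_simps\<close>)
    then show ?thesis
      by (rule has_field_derivative_transform_within_open[of _ _ _ "{0<..}"]) (use 3 in \<open>auto simp: max_def\<close>)
  qed
qed

text \<open>A compactly supported kernel of class \<open>C\<^sup>2\<close>: the third power is the least that makes
  the truncation at \<open>0\<close> twice continuously differentiable.\<close>

definition bump :: "real \<Rightarrow> 'a::euclidean_space \<Rightarrow> real" where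
  "bump h v = max 0 (h\<^sup>2 - (norm v)\<^sup>2) ^ 3"

definition mollify :: "real \<Rightarrow> ('a::euclidean_space \<Rightarrow> real) \<Rightarrow> 'a \<Rightarrow> real" where
  "mollify h u x = integral (cbox (- h *\<^sub>R One) (h *\<^sub>R One)) (\<lambda>y. u (x + y) * bump h y) /
     integral (cbox (- h *\<^sub>R One) (h *\<^sub>R One)) (bump h :: 'a \<Rightarrow> real)"

lemma bump_nonneg: "bump h v \<ge> 0" by (simp add: bump_def)

lemma bump_continuous [continuous_intros]: "continuous_on S g \<Longrightarrow> continuous_on S (\<lambda>x. bump h (g x))"
  unfolding bump_def by (intro continuous_intros)

lemma bump_eq_0: "h \<ge> 0 \<Longrightarrow> norm v \<ge> h \<Longrightarrow> bump h v = 0"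
  using power_mono[of h "norm v" 2] by (simp add: bump_def max_def)

lemma norm_le_imp_mem_cube: "norm (y::'a::euclidean_space) \<le> h \<Longrightarrow> y \<in> cbox (- h *\<^sub>R One) (h *\<^sub>R One)"
  by (auto simp: mem_box abs_le_iff dest: order_trans[OF Basis_le_norm] intro: order_trans[OF Basis_le_norm])

lemma bump_integral_pos:
  assumes h: "h > 0"
  shows "integral (cbox (- h *\<^sub>R One) (h *\<^sub>R One)) (bump h :: 'a::euclidean_space \<Rightarrow> real) > 0"
proof -
  let ?C = "cbox (- h *\<^sub>R One) (h *\<^sub>R One) :: 'a set"
  have cont: "continuous_on ?C (bump h)" using bump_continuous[of ?C "\<lambda>x. x" h] by simp
  have int: "bump h integrable_on ?C" by (rule integrable_continuous[OF cont])
  have "integral ?C (bump h) \<ge> 0" by (rule integral_nonneg[OF int]) (rule bump_nonneg)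
  moreover have "integral ?C (bump h) \<noteq> 0"
  proof
    assume "integral ?C (bump h) = 0"
    then have "(bump h has_integral 0) ?C" using int by (metis integrable_integral)
    from has_integral_0_cbox_imp_0[OF cont bump_nonneg this]
    have "bump h (0::'a) = 0" using h by (simp add: mem_box box_ne_empty)
    then show False using h by (simp add: bump_def max_def)
  qed
  ultimately show ?thesis by simp
qed

text \<open>The values of \<open>mollify h u\<close> are weighted means over balls of radius \<open>h\<close>.\<close>

lemma mollify_close:
  assumes h: "h > 0" and u: "continuous_on UNIV u"
    and close: "\<And>y. norm y \<le> h \<Longrightarrow> \<bar>u (x + y) - u x\<bar> \<le> e"
  shows "\<bar>mollify h u x - u x\<bar> \<le> e"
proof -
  let ?C = "cbox (- h *\<^sub>R One) (h *\<^sub>R One) :: 'a set"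
  let ?Z = "integral ?C (bump h)"
  have Z: "?Z > 0" by (rule bump_integral_pos[OF h])
  have cu: "continuous_on S (\<lambda>y. u (x + y))" for S
    by (rule continuous_on_compose2[OF u]) (auto intro!: continuous_intros)
  have int: "bump h integrable_on ?C" "(\<lambda>y. u (x + y) * bump h y) integrable_on ?C"
    by (intro integrable_continuous continuous_intros cu bump_continuous[of _ "\<lambda>x. x" h, simplified])+
  have "(\<lambda>y. (u x + s * e) * bump h y) integrable_on ?C" for s
    using integrable_on_cmult_left[OF int(1)] by simp
  note int' = this
  have pt: "\<bar>(u (x + y) - u x) * bump h y\<bar> \<le> e * bump h y" for y
  proof (cases "norm y \<le> h")
    case True
    then show ?thesis using close[of y] by (simp add: abs_mult bump_nonneg mult_right_mono)
  qed (use h in \<open>simp add: bump_eq_0\<close>)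
  have "integral ?C (\<lambda>y. u (x + y) * bump h y) \<le> integral ?C (\<lambda>y. (u x + 1 * e) * bump h y)"
    by (rule integral_le[OF int(2) int']) (use pt in \<open>simp add: abs_le_iff algebra_simps\<close>)
  moreover have "integral ?C (\<lambda>y. (u x + (-1) * e) * bump h y) \<le> integral ?C (\<lambda>y. u (x + y) * bump h y)"
  proof (rule integral_le[OF int' int(2)])
    show "(u x + (-1) * e) * bump h y \<le> u (x + y) * bump h y" for y
      using pt[of y] unfolding abs_le_iff by (simp add: algebra_simps)
  qed
  ultimately have "integral ?C (\<lambda>y. u (x + y) * bump h y) \<le> (u x + e) * ?Z"
    "(u x - e) * ?Z \<le> integral ?C (\<lambda>y. u (x + y) * bump h y)"
    by (simp_all add: integral_mult_right)
  then have "mollify h u x \<le> u x + e" "u x - e \<le> mollify h u x"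
    using Z by (simp_all add: mollify_def pos_divide_le_eq pos_le_divide_eq)
  then show ?thesis by (simp add: abs_le_iff)
qed

lemma mollify_uniformly_close:
  fixes u :: "'a::euclidean_space \<Rightarrow> real"
  assumes u: "continuous_on UNIV u" and S: "compact S" and e: "e > 0" and d: "d > 0"
  shows "\<exists>h>0. h \<le> d \<and> (\<forall>x\<in>S. \<bar>mollify h u x - u x\<bar> \<le> e)"
proof -
  define T where "T = (\<lambda>(x, y). x + y) ` (S \<times> cball (0::'a) 1)"
  have T: "x + y \<in> T" if "x \<in> S" "norm y \<le> 1" for x y
    using that unfolding T_def by force
  have "compact T"
    unfolding T_def case_prod_beta by (intro compact_continuous_image continuous_intros compact_Times S) auto
  then have "uniformly_continuous_on T u"
    by (rule compact_uniformly_continuous[OF continuous_on_subset[OF u subset_UNIV]])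
  from this[unfolded uniformly_continuous_on_def, rule_format, OF e] obtain \<delta> where
    \<delta>: "\<delta> > 0" "\<And>x y. x \<in> T \<Longrightarrow> y \<in> T \<Longrightarrow> dist y x < \<delta> \<Longrightarrow> dist (u y) (u x) < e" by blast
  define h where "h = min (min d 1) (\<delta> / 2)"
  have h: "h > 0" "h \<le> d" "h \<le> 1" "h < \<delta>" using d \<delta>(1) by (auto simp: h_def)
  have "\<bar>mollify h u x - u x\<bar> \<le> e" if x: "x \<in> S" for x
  proof (rule mollify_close[OF h(1) u])
    fix y :: 'a assume "norm y \<le> h"
    then have "dist (u (x + y)) (u x) < e"
      using T[OF x, of 0] T[OF x, of y] h by (intro \<delta>(2)) (simp_all add: dist_norm)
    then show "\<bar>u (x + y) - u x\<bar> \<le> e" by (simp add: dist_real_def)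
  qed
  then show ?thesis using h by blast
qed

text \<open>Differentiation under the integral sign puts every derivative on the kernel.\<close>

lemma convolution_has_derivative:
  fixes g :: "'a::euclidean_space \<Rightarrow> real" and l r :: 'a
  assumes u: "continuous_on UNIV u" and g: "\<And>v. (g has_derivative g' v) (at v)"
    and g': "\<And>b. continuous_on UNIV (\<lambda>v. g' v b)"
  shows "((\<lambda>x. integral (cbox l r) (\<lambda>y. u y * g (x - y))) has_derivative
    (\<lambda>b. integral (cbox l r) (\<lambda>y. u y * g' (x0 - y) b))) (at x0)"
proof -
  have bl: "bounded_linear (g' v)" for v using g by (rule has_derivative_bounded_linear)
  define F where "F x t = Blinfun (\<lambda>b. u t * g' (x - t) b)" for x t
  have F: "blinfun_apply (F x t) = (\<lambda>b. u t * g' (x - t) b)" for x t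
    unfolding F_def by (rule bounded_linear_Blinfun_apply) (intro bounded_linear_const_mult bl)
  have cg: "continuous_on UNIV g"
    using g by (intro continuous_at_imp_continuous_on) (auto intro: has_derivative_continuous)
  have cu: "continuous_on S (\<lambda>t. u (k t))" if "continuous_on S k" for S and k :: "'c::topological_space \<Rightarrow> 'a"
    by (rule continuous_on_compose2[OF u that]) auto
  have cF: "continuous_on (UNIV \<times> cbox l r) (\<lambda>(x, t). F x t)"
  proof (rule continuous_on_blinfun_componentwise)
    fix b :: 'a assume "b \<in> Basis"
    have "continuous_on (UNIV \<times> cbox l r) (\<lambda>z. u (snd z) * g' (fst z - snd z) b)"
      by (intro continuous_intros cu continuous_on_compose2[OF g']) auto
    then show "continuous_on (UNIV \<times> cbox l r) (\<lambda>z. blinfun_apply (case z of (x, t) \<Rightarrow> F x t) b)"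
      by (simp add: case_prod_beta F)
  qed
  have "((\<lambda>x. integral (cbox l r) (\<lambda>y. u y * g (x - y))) has_derivative
      blinfun_apply (integral (cbox l r) (F x0))) (at x0 within UNIV)"
  proof (rule leibniz_rule[OF _ _ cF])
    fix x t :: 'a
    have "((\<lambda>x. x - t) has_derivative (\<lambda>b. b)) (at x)" by (auto intro!: derivative_eq_intros)
    from has_derivative_mult_right[OF has_derivative_compose[OF this g]]
    show "((\<lambda>x. u t * g (x - t)) has_derivative blinfun_apply (F x t)) (at x within UNIV)"
      unfolding F .
  next
    fix x :: 'a
    show "(\<lambda>y. u y * g (x - y)) integrable_on cbox l r"
      by (intro integrable_continuous continuous_intros cu continuous_on_compose2[OF cg]) auto
  qed auto
  moreover have int: "F x0 integrable_on cbox l r"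
  proof (intro integrable_continuous)
    have "continuous_on (cbox l r) (\<lambda>t. (\<lambda>(x, t). F x t) (x0, t))"
      by (rule continuous_on_compose2[OF cF]) (auto intro!: continuous_intros)
    then show "continuous_on (cbox l r) (F x0)" by simp
  qed
  moreover have "blinfun_apply (integral (cbox l r) (F x0)) =
      (\<lambda>b. integral (cbox l r) (\<lambda>y. u y * g' (x0 - y) b))"
    by (rule ext) (simp only: blinfun_apply_integral[OF int] F)
  ultimately show ?thesis by simp
qed

lemma bump_derivatives:
  fixes v b :: "'a::euclidean_space"
  shows "(bump h has_derivative (\<lambda>b. - 6 * max 0 (h\<^sup>2 - (norm v)\<^sup>2) ^ 2 * (v \<bullet> b))) (at v)"
    and "((\<lambda>v. - 6 * max 0 (h\<^sup>2 - (norm v)\<^sup>2) ^ 2 * (v \<bullet> b)) has_derivative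
      (\<lambda>c. 24 * max 0 (h\<^sup>2 - (norm v)\<^sup>2) * (v \<bullet> c) * (v \<bullet> b) - 6 * max 0 (h\<^sup>2 - (norm v)\<^sup>2) ^ 2 * (c \<bullet> b))) (at v)"
proof -
  have "((\<lambda>v. v \<bullet> v) has_derivative (\<lambda>b. v \<bullet> b + b \<bullet> v)) (at v)"
    by (rule has_derivative_inner[OF has_derivative_ident has_derivative_ident])
  from has_derivative_diff[OF has_derivative_const[of "h\<^sup>2"] this]
  have inner: "((\<lambda>v. h\<^sup>2 - (norm v)\<^sup>2) has_derivative (\<lambda>b. - 2 * (v \<bullet> b))) (at v)"
    by (simp add: power2_norm_eq_inner inner_commute)
  have outer: "((\<lambda>v. max 0 (h\<^sup>2 - (norm v)\<^sup>2) ^ Suc (Suc n)) has_derivative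
      (\<lambda>b. real (Suc (Suc n)) * max 0 (h\<^sup>2 - (norm v)\<^sup>2) ^ Suc n * (- 2 * (v \<bullet> b)))) (at v)" for n
    by (rule has_derivative_compose[OF inner
          has_real_derivative_max_0_power[of n "h\<^sup>2 - (norm v)\<^sup>2", unfolded has_field_derivative_def]])
  show "(bump h has_derivative (\<lambda>b. - 6 * max 0 (h\<^sup>2 - (norm v)\<^sup>2) ^ 2 * (v \<bullet> b))) (at v)"
    using outer[of 1] unfolding bump_def[abs_def] by (simp add: numeral_3_eq_3 numeral_2_eq_2 mult_ac)
  have lin: "((\<lambda>v. v \<bullet> b) has_derivative (\<lambda>c. c \<bullet> b)) (at v)"
    by (rule bounded_linear_imp_has_derivative) (rule bounded_linear_inner_left)
  have "((\<lambda>v. - 6 * (max 0 (h\<^sup>2 - (norm v)\<^sup>2) ^ Suc (Suc 0) * (v \<bullet> b))) has_derivative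
      (\<lambda>c. - 6 * (max 0 (h\<^sup>2 - (norm v)\<^sup>2) ^ Suc (Suc 0) * (c \<bullet> b) +
        real (Suc (Suc 0)) * max 0 (h\<^sup>2 - (norm v)\<^sup>2) ^ Suc 0 * (- 2 * (v \<bullet> c)) * (v \<bullet> b)))) (at v)"
    by (rule has_derivative_mult_right[OF has_derivative_mult[OF outer[of 0] lin]])
  then show "((\<lambda>v. - 6 * max 0 (h\<^sup>2 - (norm v)\<^sup>2) ^ 2 * (v \<bullet> b)) has_derivative
      (\<lambda>c. 24 * max 0 (h\<^sup>2 - (norm v)\<^sup>2) * (v \<bullet> c) * (v \<bullet> b) - 6 * max 0 (h\<^sup>2 - (norm v)\<^sup>2) ^ 2 * (c \<bullet> b))) (at v)"
    by (simp add: numeral_2_eq_2 algebra_simps)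
qed

lemma C2_convolution_bump:
  fixes l r :: "'a::euclidean_space"
  assumes u: "continuous_on UNIV u"
  shows "Ck_on 2 UNIV (\<lambda>x. integral (cbox l r) (\<lambda>y. u y * bump h (x - y)))"
proof -
  have cu: "continuous_on S (\<lambda>t. u (k t))" if "continuous_on S k" for S and k :: "'c::topological_space \<Rightarrow> 'a"
    by (rule continuous_on_compose2[OF u that]) auto
  have "Ck_on (Suc (Suc 0)) UNIV (\<lambda>x. integral (cbox l r) (\<lambda>y. u y * bump h (x - y)))"
  proof (rule Ck_on_SucI[OF open_UNIV], rule convolution_has_derivative[OF u bump_derivatives(1)])
    show "continuous_on UNIV (\<lambda>v::'a. - 6 * max 0 (h\<^sup>2 - (norm v)\<^sup>2) ^ 2 * (v \<bullet> b))" for b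
      by (intro continuous_intros)
    fix b :: 'a
    show "Ck_on (Suc 0) UNIV (\<lambda>x. integral (cbox l r)
        (\<lambda>y. u y * (- 6 * max 0 (h\<^sup>2 - (norm (x - y))\<^sup>2) ^ 2 * ((x - y) \<bullet> b))))"
    proof (rule Ck_on_SucI[OF open_UNIV], rule convolution_has_derivative[OF u bump_derivatives(2)])
      show "continuous_on UNIV (\<lambda>v::'a. 24 * max 0 (h\<^sup>2 - (norm v)\<^sup>2) * (v \<bullet> c) * (v \<bullet> b)
          - 6 * max 0 (h\<^sup>2 - (norm v)\<^sup>2) ^ 2 * (c \<bullet> b))" for c
        by (intro continuous_intros)
      fix c :: 'a
      have "continuous_on UNIV (\<lambda>x. integral (cbox l r) (\<lambda>y. u y * (24 * max 0 (h\<^sup>2 - (norm (x - y))\<^sup>2) *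
          ((x - y) \<bullet> c) * ((x - y) \<bullet> b) - 6 * max 0 (h\<^sup>2 - (norm (x - y))\<^sup>2) ^ 2 * (c \<bullet> b))))"
        by (rule integral_continuous_on_param)
           (unfold case_prod_beta, intro continuous_intros cu)
      then show "Ck_on 0 UNIV (\<lambda>x. integral (cbox l r) (\<lambda>y. u y * (24 * max 0 (h\<^sup>2 - (norm (x - y))\<^sup>2) *
          ((x - y) \<bullet> c) * ((x - y) \<bullet> b) - 6 * max 0 (h\<^sup>2 - (norm (x - y))\<^sup>2) ^ 2 * (c \<bullet> b))))"
        by simp
    qed
  qed
  then show ?thesis by (simp only: numeral_2_eq_2)
qed

text \<open>After the substitution \<open>y \<mapsto> x + y\<close> the kernel carries the variable \<open>x\<close>. The domain of integration can then be
  enlarged to a cube independent of \<open>x\<close>, since the kernel vanishes outside.\<close>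

lemma mollify_C2:
  fixes u :: "'a::euclidean_space \<Rightarrow> real"
  assumes h: "h > 0" and u: "continuous_on UNIV u"
  shows "Ck_on 2 (ball 0 R) (mollify h u)"
proof -
  let ?C = "cbox (- h *\<^sub>R One) (h *\<^sub>R One) :: 'a set"
  let ?B = "cbox (- (R + h) *\<^sub>R One) ((R + h) *\<^sub>R One) :: 'a set"
  have eq: "integral ?B (\<lambda>y. u y * bump h (x - y)) / integral ?C (bump h) = mollify h u x"
    if x: "x \<in> ball 0 R" for x
  proof -
    let ?f = "\<lambda>y. u y * bump h (x - y)"
    have sub: "S \<inter> {y. norm (x - y) < h} = {y. norm (x - y) < h}" if "\<And>y. norm (x - y) < h \<Longrightarrow> y \<in> S" for S
      using that by auto
    have "integral ?B ?f = integral {y. norm (x - y) < h} ?f"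
    proof -
      have "y \<in> ?B" if "norm (x - y) < h" for y
      proof (rule norm_le_imp_mem_cube)
        have "norm y \<le> norm x + norm (x - y)" by (metis norm_triangle_sub norm_minus_commute)
        then show "norm y \<le> R + h" using that x by simp
      qed
      then have "integral ?B ?f = integral (?B \<inter> {y. norm (x - y) < h}) ?f"
        by (intro integral_spike_set negligible_subset[OF negligible_empty])
           (use h bump_eq_0[of h "x - _"] in \<open>auto simp: not_less\<close>)
      then show ?thesis using sub \<open>\<And>y. norm (x - y) < h \<Longrightarrow> y \<in> ?B\<close> by simp
    qed
    also have "\<dots> = integral (cbox (- h *\<^sub>R One + x) (h *\<^sub>R One + x)) ?f"
    proof -
      have mem: "y \<in> cbox (- h *\<^sub>R One + x) (h *\<^sub>R One + x)" if "norm (x - y) < h" for y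
        using norm_le_imp_mem_cube[of "y - x" h] that
        by (simp add: mem_box norm_minus_commute inner_diff_left inner_add_left algebra_simps)
      then have "integral (cbox (- h *\<^sub>R One + x) (h *\<^sub>R One + x)) ?f =
          integral (cbox (- h *\<^sub>R One + x) (h *\<^sub>R One + x) \<inter> {y. norm (x - y) < h}) ?f"
        by (intro integral_spike_set negligible_subset[OF negligible_empty])
           (use h bump_eq_0[of h "x - _"] in \<open>auto simp: not_less\<close>)
      then show ?thesis using sub mem by simp
    qed
    also have "\<dots> = integral ?C (?f \<circ> (+) x)" by (rule integral_shift_cbox_plus[symmetric])
    also have "?f \<circ> (+) x = (\<lambda>y. u (x + y) * bump h y)"
      by (auto simp: bump_def)
    finally show ?thesis by (simp add: mollify_def)
  qed
  have "Ck_on 2 (ball 0 R) (\<lambda>x. (1 / integral ?C (bump h)) * integral ?B (\<lambda>y. u y * bump h (x - y)))"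
    by (intro Ck_on_cmult Ck_on_subset[OF C2_convolution_bump[OF u]]) auto
  then show ?thesis by (rule Ck_on_cong[rotated 2]) (simp_all add: eq[symmetric])
qed

lemma mollify_continuous:
  fixes u :: "'a::euclidean_space \<Rightarrow> real"
  assumes h: "h > 0" and u: "continuous_on UNIV u"
  shows "continuous_on S (mollify h u)"
proof -
  have "isCont (mollify h u) x" for x :: 'a
    by (rule continuous_on_interior[OF C2_on_imp_continuous[OF mollify_C2[OF assms, of "norm x + 1"]]]) simp
  then show ?thesis by (simp add: continuous_at_imp_continuous_on)
qed

lemma circle_avg_eq_integral:
  assumes "continuous_on UNIV w"
  shows "circle_avg w a \<xi> = integral {0..2*pi} (\<lambda>\<theta>. w (a + cis \<theta> *s \<xi>)) / (2*pi)"
  using circle_integrable_continuous[OF assms, of a \<xi>]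
  unfolding circle_avg_def circle_integrable_def by (simp add: set_borel_integral_eq_integral(2))

text \<open>Exchange the averages over the circle and over the kernel.\<close>

lemma mollify_submean:
  fixes u :: "complex^'n::finite \<Rightarrow> real"
  assumes h: "h > 0" and u: "continuous_on UNIV u"
    and sub: "\<And>y. norm y \<le> h \<Longrightarrow> u (x + y) + k \<le> circle_avg u (x + y) \<xi>"
  shows "mollify h u x + k \<le> circle_avg (mollify h u) x \<xi>"
proof -
  let ?C = "cbox (- h *\<^sub>R One) (h *\<^sub>R One) :: (complex^'n) set"
  let ?Z = "integral ?C (bump h)"
  have Z: "?Z > 0" by (rule bump_integral_pos[OF h])
  have cu: "continuous_on S (\<lambda>t. u (k t))" if "continuous_on S k" for S and k :: "'c::topological_space \<Rightarrow> complex^'n"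
    by (rule continuous_on_compose2[OF u that]) auto
  have cb: "continuous_on ?C (bump h)" using bump_continuous[of ?C "\<lambda>x. x" h] by simp
  have cm: "continuous_on UNIV (mollify h u)" by (rule mollify_continuous[OF h u])
  have "circle_avg (mollify h u) x \<xi> * (2*pi) * ?Z =
      integral {0..2*pi} (\<lambda>\<theta>. integral ?C (\<lambda>y. u (x + cis \<theta> *s \<xi> + y) * bump h y))"
    unfolding circle_avg_eq_integral[OF cm] using Z by (simp add: mollify_def)
  also have "\<dots> = integral ?C (\<lambda>y. integral {0..2*pi} (\<lambda>\<theta>. u (x + cis \<theta> *s \<xi> + y) * bump h y))"
  proof -
    have "continuous_on (cbox (0, - h *\<^sub>R One) (2*pi, h *\<^sub>R One))
        (\<lambda>(\<theta>, y::complex^'n). u (x + cis \<theta> *s \<xi> + y) * bump h y)"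
      unfolding case_prod_beta by (intro continuous_intros cu)
    from integral_swap_continuous[OF this] show ?thesis by simp
  qed
  also have "\<dots> = integral ?C (\<lambda>y. circle_avg u (x + y) \<xi> * (2*pi) * bump h y)"
  proof (rule integral_cong)
    fix y
    have "integral {0..2*pi} (\<lambda>\<theta>. u (x + cis \<theta> *s \<xi> + y) * bump h y) =
        integral {0..2*pi} (\<lambda>\<theta>. u (x + y + cis \<theta> *s \<xi>)) * bump h y"
      by (simp add: integral_mult_left add_ac)
    then show "integral {0..2*pi} (\<lambda>\<theta>. u (x + cis \<theta> *s \<xi> + y) * bump h y) =
        circle_avg u (x + y) \<xi> * (2*pi) * bump h y"
      unfolding circle_avg_eq_integral[OF u] by simp
  qed
  also have "\<dots> \<ge> integral ?C (\<lambda>y. (u (x + y) + k) * (2*pi) * bump h y)"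
  proof (rule integral_le)
    show "(\<lambda>y. (u (x + y) + k) * (2*pi) * bump h y) integrable_on ?C"
      by (intro integrable_continuous continuous_intros cu cb)
    have "continuous_on ?C (\<lambda>y. integral (cbox 0 (2*pi)) (\<lambda>\<theta>. u (x + y + cis \<theta> *s \<xi>)))"
      by (rule integral_continuous_on_param) (unfold case_prod_beta, intro continuous_intros cu)
    then show "(\<lambda>y. circle_avg u (x + y) \<xi> * (2*pi) * bump h y) integrable_on ?C"
      unfolding circle_avg_eq_integral[OF u]
      by (intro integrable_continuous continuous_intros cb) auto
    fix y :: "complex^'n"
    show "(u (x + y) + k) * (2*pi) * bump h y \<le> circle_avg u (x + y) \<xi> * (2*pi) * bump h y"
    proof (cases "norm y \<le> h")
      case True
      then show ?thesis using sub by (intro mult_right_mono bump_nonneg) auto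
    qed (use h in \<open>simp add: bump_eq_0\<close>)
  qed
  also have "integral ?C (\<lambda>y. (u (x + y) + k) * (2*pi) * bump h y) =
      (2*pi) * (integral ?C (\<lambda>y. u (x + y) * bump h y) + k * ?Z)"
  proof -
    have i: "(\<lambda>y. u (x + y) * bump h y) integrable_on ?C" "(\<lambda>y. k * bump h y) integrable_on ?C"
      by (intro integrable_continuous continuous_intros cu cb)+
    have "integral ?C (\<lambda>y. (u (x + y) + k) * (2*pi) * bump h y) =
        integral ?C (\<lambda>y. (2*pi) * (u (x + y) * bump h y + k * bump h y))"
      by (simp add: algebra_simps)
    also have "\<dots> = (2*pi) * (integral ?C (\<lambda>y. u (x + y) * bump h y) + integral ?C (\<lambda>y. k * bump h y))"
      by (simp only: integral_mult_right integral_add[OF i])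
    finally show ?thesis by simp
  qed
  also have "integral ?C (\<lambda>y. u (x + y) * bump h y) = mollify h u x * ?Z"
    using Z by (simp add: mollify_def)
  finally have "(mollify h u x + k) * (2 * pi * ?Z) \<le> circle_avg (mollify h u) x \<xi> * (2 * pi * ?Z)"
    by (simp add: algebra_simps)
  then show ?thesis by (rule mult_right_le_imp_le) (use Z in simp)
qed

section \<open>Comparison\<close>

definition disc_submean ::
    "(complex^'n::finite) set \<Rightarrow> (complex^'n \<Rightarrow> real) \<Rightarrow> (complex^'n \<Rightarrow> real) \<Rightarrow> bool" where
  "disc_submean \<Omega> f u \<longleftrightarrow> (\<forall>a \<xi> k. (\<forall>c. cmod c \<le> 1 \<longrightarrow> a + c *s \<xi> \<in> \<Omega> \<and> k \<le> f (a + c *s \<xi>)) \<longrightarrow>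
     u a + k * (norm \<xi>)\<^sup>2 \<le> circle_avg u a \<xi>)"

text \<open>The case of \<open>submean_on_discs\<close> in which the approximating functions are \<open>u\<close> itself.\<close>

lemma viscosity_subsolution_disc_submean:
  fixes u f :: "complex^'n::finite \<Rightarrow> real"
  assumes \<Omega>: "open \<Omega>" and u: "continuous_on \<Omega> u" and f: "continuous_on \<Omega> f"
    and sub: "viscosity_subsolution \<Omega> f (\<lambda>z. ereal (u z))"
  shows "disc_submean \<Omega> f u"
  unfolding disc_submean_def
proof (intro allI impI)
  fix a \<xi> k assume disc: "\<forall>c. cmod c \<le> 1 \<longrightarrow> a + c *s \<xi> \<in> \<Omega> \<and> k \<le> f (a + c *s \<xi>)"
  show "u a + k * (norm \<xi>)\<^sup>2 \<le> circle_avg u a \<xi>"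
  proof (rule submean_on_discs[OF \<Omega> u f _ disc[rule_format]])
    fix x :: "complex^'n" and \<eta> :: real assume "\<eta> > 0"
    then show "\<exists>w. usc_locally_bounded \<Omega> w \<and> (\<forall>z\<in>\<Omega>. w z \<le> u z) \<and> u x - \<eta> < w x \<and> model_tested \<Omega> f w"
      using usc_locally_bounded_continuous[OF \<Omega> u] viscosity_subsolution_imp_model_tested[OF sub]
      by (intro exI[of _ u]) auto
  qed
qed

text \<open>If \<open>u - v\<close> is positive somewhere, then for small \<open>h\<close> and \<open>\<gamma>\<close> the function \<open>mollify h U + \<gamma> |z|\<^sup>2 - v\<close> attains
  its maximum over the closure in the compact set \<open>K\<close>, away from the boundary. There the mollified
  function has excess at least \<open>f - \<gamma> / 2\<close>, and \<open>\<gamma> |z|\<^sup>2\<close> contributes \<open>\<gamma>\<close>, against the supersolution property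
  of \<open>v\<close>.\<close>

lemma comparison_principle:
  fixes u v f :: "complex^'n::finite \<Rightarrow> real"
  assumes \<Omega>: "open \<Omega>" "bounded \<Omega>" and u: "continuous_on (closure \<Omega>) u"
    and v: "continuous_on (closure \<Omega>) v" and f: "continuous_on (closure \<Omega>) f"
    and sub: "disc_submean \<Omega> f u" and super: "viscosity_supersolution \<Omega> f (\<lambda>z. ereal (v z))"
    and bd: "\<And>z. z \<in> frontier \<Omega> \<Longrightarrow> u z \<le> v z" and z: "z0 \<in> closure \<Omega>"
  shows "u z0 \<le> v z0"
proof (rule ccontr)
  assume neg: "\<not> u z0 \<le> v z0"
  have comp: "compact (closure \<Omega>)" using \<Omega>(2) by simp
  obtain R where R: "R > 0" "\<And>z. z \<in> closure \<Omega> \<Longrightarrow> norm z \<le> R"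
    using compact_imp_bounded[OF comp] unfolding bounded_pos by blast
  obtain U where U: "continuous_on UNIV U" "\<And>z. z \<in> closure \<Omega> \<Longrightarrow> U z = u z"
    using Tietze_unbounded[OF u, of UNIV] by auto
  define \<eta> where "\<eta> = (u z0 - v z0) / 3"
  have \<eta>: "\<eta> > 0" using neg by (simp add: \<eta>_def)
  \<comment> \<open>Then \<open>\<gamma> |z|\<^sup>2 \<le> \<eta>\<close> on the closure, so that the perturbation cannot move the maximum out of \<open>K\<close>.\<close>
  define \<gamma> where "\<gamma> = \<eta> / R\<^sup>2"
  have \<gamma>: "\<gamma> > 0" "\<gamma> * R\<^sup>2 = \<eta>" using \<eta> R(1) by (simp_all add: \<gamma>_def)
  define K where "K = {z\<in>closure \<Omega>. \<eta> \<le> u z - v z}"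
  have "compact K"
  proof -
    have "closed K" unfolding K_def
      by (intro continuous_on_closed_Collect_le continuous_intros u v) auto
    then have "compact (closure \<Omega> \<inter> K)" by (rule compact_Int_closed[OF comp])
    moreover have "closure \<Omega> \<inter> K = K" by (auto simp: K_def)
    ultimately show ?thesis by simp
  qed
  moreover have K\<Omega>: "K \<subseteq> \<Omega>"
  proof
    fix z assume z: "z \<in> K"
    show "z \<in> \<Omega>"
    proof (rule ccontr)
      assume "z \<notin> \<Omega>"
      then have "z \<in> frontier \<Omega>" using z \<Omega>(1) by (simp add: K_def frontier_def interior_open)
      then show False using bd[of z] z \<eta> by (simp add: K_def)
    qed
  qed
  ultimately obtain d where d: "d > 0" "(\<Union>x\<in>K. ball x d) \<subseteq> \<Omega>"
    using compact_subset_open_imp_ball_epsilon_subset[of K \<Omega>] \<Omega>(1) by blast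
  have "\<gamma> / 2 > 0" using \<gamma>(1) by simp
  from compact_uniformly_continuous[OF f comp, unfolded uniformly_continuous_on_def, rule_format, OF this]
  obtain e where e: "e > 0" "\<And>x y. x \<in> closure \<Omega> \<Longrightarrow> y \<in> closure \<Omega> \<Longrightarrow> dist y x < e \<Longrightarrow> \<bar>f y - f x\<bar> < \<gamma> / 2"
    unfolding dist_real_def by blast
  have "\<eta> / 4 > 0" "min d e / 2 > 0" using \<eta> d(1) e(1) by simp_all
  from mollify_uniformly_close[OF U(1) comp this] obtain h where
    h: "h > 0" "h \<le> min d e / 2" and "\<forall>z\<in>closure \<Omega>. \<bar>mollify h U z - U z\<bar> \<le> \<eta> / 4" by blast
  then have close: "\<bar>mollify h U z - u z\<bar> \<le> \<eta> / 4" if "z \<in> closure \<Omega>" for z using U(2) that by fastforce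
  have h2: "2 * h \<le> d" "2 * h \<le> e" using h(2) by simp_all
  let ?m = "mollify h U"
  define s where "s z = ?m z + \<gamma> * (norm z)\<^sup>2 - v z" for z
  have "continuous_on (closure \<Omega>) s"
    unfolding s_def[abs_def] by (intro continuous_intros v mollify_continuous h U)
  moreover have "closure \<Omega> \<noteq> {}" using z by (metis empty_iff)
  ultimately obtain z1 where
    z1: "z1 \<in> closure \<Omega>" "\<And>z. z \<in> closure \<Omega> \<Longrightarrow> s z \<le> s z1"
    using continuous_attains_sup[OF comp] by blast
  have z1K: "z1 \<in> K"
  proof (rule ccontr)
    assume "z1 \<notin> K"
    then have "u z1 - v z1 < \<eta>" using z1 by (simp add: K_def)
    moreover have "\<gamma> * (norm z1)\<^sup>2 \<le> \<gamma> * R\<^sup>2"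
      using R(2)[OF z1(1)] \<gamma> by (intro mult_left_mono power_mono) auto
    moreover have "0 \<le> \<gamma> * (norm z0)\<^sup>2" using \<gamma> by simp
    ultimately show False
      using z1(2)[OF z] abs_le_D2[OF close[OF z]] abs_le_D1[OF close[OF z1(1)]] \<gamma>(2) \<eta>
      unfolding s_def \<eta>_def by argo
  qed
  then have z1\<Omega>: "z1 \<in> \<Omega>" using K\<Omega> by blast
  define q where "q z = ?m z + (\<gamma> * (norm z)\<^sup>2 + (- s z1))" for z
  have z1R: "z1 \<in> ball 0 (R + 1)" using R(2)[OF z1(1)] by simp
  have C2: "Ck_on 2 (ball 0 (R + 1)) q"
    unfolding q_def[abs_def] using Ck_on_norm_squared[of "ball 0 (R+1)" 2 0]
    by (intro Ck_on_add Ck_on_cmult Ck_on_const mollify_C2 h U) auto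
  have "touches_below q (\<lambda>z. ereal (v z)) z1"
  proof -
    have "\<forall>\<^sub>F y in nhds z1. y \<in> \<Omega>" using \<Omega>(1) z1\<Omega> by (rule eventually_nhds_in_open)
    then have "\<forall>\<^sub>F y in nhds z1. ereal (q y) \<le> ereal (v y)"
    proof eventually_elim
      case (elim y)
      then have "s y \<le> s z1" using z1(2) closure_subset by blast
      then show ?case by (simp add: q_def s_def)
    qed
    then show ?thesis by (simp add: touches_below_def q_def s_def)
  qed
  moreover have "C2_near z1 q" unfolding C2_near_def using C2 z1R by blast
  ultimately have "max (\<Lambda>\<^sub>1 (complex_hessian q z1)) 0 \<le> f z1"
    using super z1\<Omega> unfolding viscosity_supersolution_def by blast
  moreover have "f z1 + \<gamma> / 2 \<le> \<Lambda>\<^sub>1 (complex_hessian q z1)"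
  proof (rule submean_imp_le_smallest_eigenvalue[OF open_ball C2 z1R])
    fix c \<xi> assume c: "c < f z1 + \<gamma> / 2"
    have "\<forall>\<^sub>F z in nhds z1. z \<in> ball z1 h" using h by (intro eventually_nhds_in_open) auto
    from eventually_small_disc[OF this, of \<xi>]
    show "\<forall>\<^sub>F r in at_right 0. q z1 + c * (norm \<xi>)\<^sup>2 * r\<^sup>2 \<le> circle_avg q z1 (r *\<^sub>R \<xi>)"
    proof eventually_elim
      case (elim r)
      have small: "norm (c *s (r *\<^sub>R \<xi>)) < h" if "cmod c \<le> 1" for c
        using elim[rule_format, OF that] by (simp add: dist_norm)
      let ?k = "(f z1 - \<gamma> / 2) * (norm (r *\<^sub>R \<xi>))\<^sup>2"
      have m: "?m z1 + ?k \<le> circle_avg ?m z1 (r *\<^sub>R \<xi>)"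
      proof (rule mollify_submean[OF h(1) U(1)])
        fix y :: "complex^'n" assume y: "norm y \<le> h"
        have in\<Omega>: "z1 + y + c *s (r *\<^sub>R \<xi>) \<in> \<Omega> \<and> f z1 - \<gamma> / 2 \<le> f (z1 + y + c *s (r *\<^sub>R \<xi>))"
          if "cmod c \<le> 1" for c
        proof -
          let ?x = "z1 + y + c *s (r *\<^sub>R \<xi>)"
          have near: "dist ?x z1 < 2 * h"
            using norm_triangle_ineq[of y "c *s (r *\<^sub>R \<xi>)"] y small[OF that]
            by (simp add: dist_norm add.assoc)
          then have "?x \<in> (\<Union>x\<in>K. ball x d)"
            using z1K h2(1) by (intro UN_I[of z1]) (simp_all add: dist_commute)
          then have x: "?x \<in> \<Omega>" using d(2) by blast
          moreover have "\<bar>f ?x - f z1\<bar> < \<gamma> / 2"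
            using x near h2(2) closure_subset z1(1) by (intro e(2)) auto
          ultimately show ?thesis by linarith
        qed
        have cl: "z1 + y + c *s (r *\<^sub>R \<xi>) \<in> closure \<Omega>" if "cmod c \<le> 1" for c
          using in\<Omega>[OF that] closure_subset by blast
        have "u (z1 + y) + ?k \<le> circle_avg u (z1 + y) (r *\<^sub>R \<xi>)"
          using sub in\<Omega> unfolding disc_submean_def by blast
        moreover have "circle_avg u (z1 + y) (r *\<^sub>R \<xi>) = circle_avg U (z1 + y) (r *\<^sub>R \<xi>)"
          by (intro circle_avg_cong U(2)[symmetric] cl) simp
        moreover have "U (z1 + y) = u (z1 + y)"
          using cl[of 0] by (intro U(2)) simp
        ultimately show "U (z1 + y) + ?k \<le> circle_avg U (z1 + y) (r *\<^sub>R \<xi>)" by simp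
      qed
      have i1: "circle_integrable ?m z1 (r *\<^sub>R \<xi>)"
        by (rule circle_integrable_continuous[OF mollify_continuous[OF h(1) U(1)]]) auto
      have i2: "circle_integrable (\<lambda>z. \<gamma> * (norm z)\<^sup>2) z1 (r *\<^sub>R \<xi>)"
        by (rule circle_integrable_continuous[of UNIV]) (intro continuous_intros, simp)
      have "circle_avg q z1 (r *\<^sub>R \<xi>) =
          circle_avg ?m z1 (r *\<^sub>R \<xi>) + (\<gamma> * ((norm z1)\<^sup>2 + (norm (r *\<^sub>R \<xi>))\<^sup>2) - s z1)"
        using circle_avg_norm_squared[of 0 z1 "r *\<^sub>R \<xi>"] unfolding q_def[abs_def]
          circle_avg_add[OF i1 circle_integrable_add[OF i2 circle_integrable_const]]
          circle_avg_add[OF i2 circle_integrable_const] circle_avg_cmult by simp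
      also have "\<dots> \<ge> q z1 + (f z1 + \<gamma> / 2) * (norm (r *\<^sub>R \<xi>))\<^sup>2"
        using m by (simp add: q_def algebra_simps)
      finally have "q z1 + (f z1 + \<gamma> / 2) * (norm (r *\<^sub>R \<xi>))\<^sup>2 \<le> circle_avg q z1 (r *\<^sub>R \<xi>)" .
      moreover have "c * (norm (r *\<^sub>R \<xi>))\<^sup>2 \<le> (f z1 + \<gamma> / 2) * (norm (r *\<^sub>R \<xi>))\<^sup>2"
        using c by (intro mult_right_mono) auto
      ultimately show ?case by (simp add: power_mult_distrib mult_ac)
    qed
  qed
  ultimately show False using \<gamma>(1) by simp
qed

section \<open>Operations on local submean functions\<close>

text \<open>A function inherits the submean inequality at \<open>a\<close> from a minorant that agrees with it at \<open>a\<close>. Maxima and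
  gluing rest on this.\<close>

lemma local_submean_dominated:
  fixes v w :: "complex^'n::finite \<Rightarrow> real"
  assumes v: "usc_locally_bounded V v" "a \<in> V" and w: "usc_locally_bounded W w" "a \<in> W"
    and eq: "v a = w a" and le: "\<forall>\<^sub>F z in nhds a. v z \<le> w z"
    and sub: "\<forall>\<^sub>F r in at_right 0. v a + k * (norm \<xi>)\<^sup>2 * r\<^sup>2 \<le> circle_avg v a (r *\<^sub>R \<xi>)"
  shows "\<forall>\<^sub>F r in at_right 0. w a + k * (norm \<xi>)\<^sup>2 * r\<^sup>2 \<le> circle_avg w a (r *\<^sub>R \<xi>)"
  using sub eventually_small_circle[OF le, of \<xi>] usc_eventually_circle_integrable[OF v, of \<xi>]
    usc_eventually_circle_integrable[OF w, of \<xi>]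
proof eventually_elim
  case (elim r)
  have "circle_avg v a (r *\<^sub>R \<xi>) \<le> circle_avg w a (r *\<^sub>R \<xi>)"
    using elim by (intro circle_avg_mono) auto
  then show ?case using elim eq by simp
qed

lemma local_submean_mono:
  assumes "local_submean V f w" "W \<subseteq> V" "\<And>z. z \<in> W \<Longrightarrow> g z \<le> f z"
  shows "local_submean W g w"
  using assms unfolding local_submean_def by (meson less_le_trans subsetD)

lemma local_submean_add:
  fixes v w :: "complex^'n::finite \<Rightarrow> real"
  assumes v: "usc_locally_bounded V v" "local_submean V f v"
    and w: "usc_locally_bounded V w" "local_submean V g w"
  shows "local_submean V (\<lambda>z. f z + g z) (\<lambda>z. v z + w z)"
  unfolding local_submean_def
proof (intro ballI allI impI)
  fix a \<xi> c assume a: "a \<in> V" and c: "c < f a + g a"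
  define m where "m = (f a + g a - c) / 2"
  have m: "f a - m < f a" "g a - m < g a" using c by (simp_all add: m_def)
  show "\<forall>\<^sub>F r in at_right 0. v a + w a + c * (norm \<xi>)\<^sup>2 * r\<^sup>2 \<le> circle_avg (\<lambda>z. v z + w z) a (r *\<^sub>R \<xi>)"
    using local_submeanD[OF v(2) a m(1), of \<xi>] local_submeanD[OF w(2) a m(2), of \<xi>]
      usc_eventually_circle_integrable[OF v(1) a, of \<xi>] usc_eventually_circle_integrable[OF w(1) a, of \<xi>]
  proof eventually_elim
    case (elim r)
    have "c * (norm \<xi>)\<^sup>2 * r\<^sup>2 = ((f a - m) + (g a - m)) * (norm \<xi>)\<^sup>2 * r\<^sup>2"
      by (simp add: m_def field_simps)
    then show ?case using elim(1,2) unfolding circle_avg_add[OF elim(3,4)] distrib_right by linarith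
  qed
qed

lemma local_submean_max:
  fixes v w :: "complex^'n::finite \<Rightarrow> real"
  assumes v: "usc_locally_bounded V v" "local_submean V f v"
    and w: "usc_locally_bounded V w" "local_submean V f w"
  shows "local_submean V f (\<lambda>z. max (v z) (w z))"
  unfolding local_submean_def
proof (intro ballI allI impI)
  fix a \<xi> c assume a: "a \<in> V" and c: "c < f a"
  note usc = usc_locally_bounded_max[OF v(1) w(1)]
  show "\<forall>\<^sub>F r in at_right 0. max (v a) (w a) + c * (norm \<xi>)\<^sup>2 * r\<^sup>2
      \<le> circle_avg (\<lambda>z. max (v z) (w z)) a (r *\<^sub>R \<xi>)"
  proof (cases "v a \<le> w a")
    case True
    then show ?thesis
      by (intro local_submean_dominated[OF w(1) a usc a _ _ local_submeanD[OF w(2) a c]]) auto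
  next
    case False
    then show ?thesis
      by (intro local_submean_dominated[OF v(1) a usc a _ _ local_submeanD[OF v(2) a c]]) auto
  qed
qed

lemma local_submean_cmult:
  assumes "local_submean V f w" "k > 0"
  shows "local_submean V (\<lambda>z. k * f z) (\<lambda>z. k * w z)"
  unfolding local_submean_def
proof (intro ballI allI impI)
  fix a \<xi> c assume a: "a \<in> V" and c: "c < k * f a"
  then have "c / k < f a" using assms(2) by (simp add: field_simps)
  from local_submeanD[OF assms(1) a this, of \<xi>]
  show "\<forall>\<^sub>F r in at_right 0. k * w a + c * (norm \<xi>)\<^sup>2 * r\<^sup>2 \<le> circle_avg (\<lambda>z. k * w z) a (r *\<^sub>R \<xi>)"
  proof eventually_elim
    case (elim r)
    then have "k * (w a + c / k * (norm \<xi>)\<^sup>2 * r\<^sup>2) \<le> k * circle_avg w a (r *\<^sub>R \<xi>)"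
      using assms(2) by (intro mult_left_mono) auto
    moreover have "k * (w a + c / k * (norm \<xi>)\<^sup>2 * r\<^sup>2) = k * w a + c * (norm \<xi>)\<^sup>2 * r\<^sup>2"
      using assms(2) by (simp add: distrib_left)
    ultimately show ?case by (simp add: circle_avg_cmult)
  qed
qed

lemma local_submean_translate:
  assumes "local_submean V f w"
  shows "local_submean {z. z + h \<in> V} (\<lambda>z. f (z + h)) (\<lambda>z. w (z + h))"
  using assms unfolding local_submean_def circle_avg_translate by simp

lemma local_submean_norm_squared:
  fixes V :: "(complex^'n::finite) set"
  shows "local_submean V (\<lambda>_. k) (\<lambda>z. k * (norm (z - p))\<^sup>2 + l)"
  unfolding local_submean_def
proof (intro ballI allI impI)
  fix a \<xi> :: "complex^'n" and c assume c: "c < k"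
  have "circle_avg (\<lambda>z. k * (norm (z - p))\<^sup>2 + l) a (r *\<^sub>R \<xi>) =
      k * ((norm (a - p))\<^sup>2 + (norm (r *\<^sub>R \<xi>))\<^sup>2) + l" for r
  proof -
    have "circle_integrable (\<lambda>z. k * (norm (z - p))\<^sup>2) a (r *\<^sub>R \<xi>)"
      by (rule circle_integrable_continuous[of UNIV]) (intro continuous_intros, simp)
    from circle_avg_add[OF this circle_integrable_const[of l]] show ?thesis
      by (simp only: circle_avg_const circle_avg_cmult circle_avg_norm_squared)
  qed
  moreover have "c * (norm \<xi>)\<^sup>2 * r\<^sup>2 \<le> k * (norm (r *\<^sub>R \<xi>))\<^sup>2" for r
  proof -
    have "c * (norm (r *\<^sub>R \<xi>))\<^sup>2 \<le> k * (norm (r *\<^sub>R \<xi>))\<^sup>2" using c by (intro mult_right_mono) auto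
    then show ?thesis by (simp add: power_mult_distrib mult_ac)
  qed
  ultimately show "\<forall>\<^sub>F r in at_right 0. k * (norm (a - p))\<^sup>2 + l + c * (norm \<xi>)\<^sup>2 * r\<^sup>2
      \<le> circle_avg (\<lambda>z. k * (norm (z - p))\<^sup>2 + l) a (r *\<^sub>R \<xi>)"
    by (simp add: distrib_left del: norm_scaleR)
qed

lemma usc_locally_bounded_norm_squared:
  "open V \<Longrightarrow> usc_locally_bounded V (\<lambda>z::'a::real_inner. k * (norm (z - p))\<^sup>2 + l)"
  by (intro usc_locally_bounded_continuous continuous_intros)

section \<open>Behaviour near the boundary\<close>

text \<open>Complements of compact subsets: for a bounded open set these are the neighbourhoods of its boundary.\<close>

definition near_boundary :: "'a::topological_space set \<Rightarrow> ('a \<Rightarrow> bool) \<Rightarrow> bool" where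
  "near_boundary \<Omega> P \<longleftrightarrow> (\<exists>K. compact K \<and> K \<subseteq> \<Omega> \<and> (\<forall>z\<in>\<Omega> - K. P z))"

lemma near_boundary_conj:
  assumes "near_boundary \<Omega> P" "near_boundary \<Omega> Q"
  shows "near_boundary \<Omega> (\<lambda>z. P z \<and> Q z)"
proof -
  obtain K L where "compact K" "K \<subseteq> \<Omega>" "\<forall>z\<in>\<Omega> - K. P z" "compact L" "L \<subseteq> \<Omega>" "\<forall>z\<in>\<Omega> - L. Q z"
    using assms unfolding near_boundary_def by blast
  then show ?thesis unfolding near_boundary_def by (intro exI[of _ "K \<union> L"]) auto
qed

lemma near_boundary_mono:
  "near_boundary \<Omega> P \<Longrightarrow> (\<And>z. z \<in> \<Omega> \<Longrightarrow> P z \<Longrightarrow> Q z) \<Longrightarrow> near_boundary \<Omega> Q"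
  unfolding near_boundary_def by (meson DiffD1)

text \<open>The exceptional set is the closure minus all open sets on which the property holds; the assumption
  puts every boundary point into one of them.\<close>

lemma near_boundaryI:
  fixes \<Omega> :: "'a::euclidean_space set"
  assumes \<Omega>: "open \<Omega>" "bounded \<Omega>" and ev: "\<And>\<zeta>. \<zeta> \<in> frontier \<Omega> \<Longrightarrow> \<forall>\<^sub>F z in at \<zeta> within \<Omega>. P z"
  shows "near_boundary \<Omega> P"
proof -
  define W where "W = \<Union>{S. open S \<and> (\<forall>z\<in>S \<inter> \<Omega>. P z)}"
  have "open W" unfolding W_def by auto
  then have "compact (closure \<Omega> - W)" using \<Omega>(2) by (simp add: compact_diff)
  moreover have "closure \<Omega> - W \<subseteq> \<Omega>"
  proof
    fix \<zeta> assume \<zeta>: "\<zeta> \<in> closure \<Omega> - W"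
    show "\<zeta> \<in> \<Omega>"
    proof (rule ccontr)
      assume "\<zeta> \<notin> \<Omega>"
      then have "\<zeta> \<in> frontier \<Omega>" using \<zeta> \<Omega>(1) by (simp add: frontier_def interior_open)
      from ev[OF this] obtain S where S: "open S" "\<zeta> \<in> S" "\<forall>z\<in>S. z \<noteq> \<zeta> \<longrightarrow> z \<in> \<Omega> \<longrightarrow> P z"
        unfolding eventually_at_topological by blast
      have "P z" if "z \<in> S \<inter> \<Omega>" for z
        using S(3)[rule_format, of z] that \<open>\<zeta> \<notin> \<Omega>\<close> by (cases "z = \<zeta>") simp_all
      then have "S \<in> {S. open S \<and> (\<forall>z\<in>S \<inter> \<Omega>. P z)}" using S(1) by simp
      then have "\<zeta> \<in> W" using S(2) unfolding W_def by (rule UnionI)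
      then show False using \<zeta> by simp
    qed
  qed
  moreover have "\<forall>z\<in>\<Omega> - (closure \<Omega> - W). P z"
  proof
    fix z assume z: "z \<in> \<Omega> - (closure \<Omega> - W)"
    then have "z \<in> W" using closure_subset[of \<Omega>] by blast
    then obtain S where "z \<in> S" "\<forall>z\<in>S \<inter> \<Omega>. P z" unfolding W_def by blast
    then show "P z" using z by blast
  qed
  ultimately show ?thesis unfolding near_boundary_def by blast
qed

lemma near_boundary_imp_eventually:
  fixes \<Omega> :: "'a::metric_space set"
  assumes "open \<Omega>" "near_boundary \<Omega> P" "\<zeta> \<in> frontier \<Omega>"
  shows "\<forall>\<^sub>F z in nhds \<zeta>. z \<in> \<Omega> \<longrightarrow> P z"
proof -
  obtain K where K: "compact K" "K \<subseteq> \<Omega>" "\<forall>z\<in>\<Omega> - K. P z"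
    using assms(2) unfolding near_boundary_def by blast
  have "\<zeta> \<in> - K" using assms(1,3) K(2) by (auto simp: frontier_def interior_open)
  then have "\<forall>\<^sub>F z in nhds \<zeta>. z \<in> - K"
    using compact_imp_closed[OF K(1)] by (intro eventually_nhds_in_open) auto
  then show ?thesis by eventually_elim (use K(3) in blast)
qed

text \<open>At an interior maximum the strict excess \<open>f > 0\<close> contradicts the mean over any small circle being at
  most the maximum.\<close>

lemma local_submean_maximum_principle:
  fixes s :: "complex^'n::finite \<Rightarrow> real"
  assumes usc: "usc_locally_bounded \<Omega> s" and sub: "local_submean \<Omega> f s"
    and f: "\<And>z. z \<in> \<Omega> \<Longrightarrow> f z > 0" and bd: "near_boundary \<Omega> (\<lambda>z. s z < e)" and z: "z \<in> \<Omega>"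
  shows "s z \<le> e"
proof (rule ccontr)
  assume neg: "\<not> s z \<le> e"
  obtain K where K: "compact K" "K \<subseteq> \<Omega>" "\<forall>z\<in>\<Omega> - K. s z < e"
    using bd unfolding near_boundary_def by blast
  have zK: "z \<in> K" using K(3) neg z by force
  then obtain a where a: "a \<in> K" "\<And>y. y \<in> K \<Longrightarrow> s y \<le> s a"
    using usc_attains_max[OF usc K(1) _ K(2)] by blast
  have max: "s y \<le> s a" if "y \<in> \<Omega>" for y
    using a(2)[of y] a(2)[OF zK] K(3) that neg by (cases "y \<in> K") force+
  have a\<Omega>: "a \<in> \<Omega>" using a K by blast
  obtain \<xi> :: "complex^'n" where \<xi>: "\<xi> \<noteq> 0" using nonempty_Basis nonzero_Basis by blast
  have "\<forall>\<^sub>F z in nhds a. z \<in> \<Omega>" using usc_locally_boundedD(1)[OF usc] a\<Omega> by (rule eventually_nhds_in_open)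
  then have ev: "\<forall>\<^sub>F z in nhds a. s z \<le> s a" by eventually_elim (rule max)
  have half: "0 < f a / 2" "f a / 2 < f a" using f[OF a\<Omega>] by simp_all
  have "\<forall>\<^sub>F r in at_right (0::real). False"
    using local_submeanD[OF sub a\<Omega> half(2), of \<xi>] eventually_small_circle[OF ev, of \<xi>]
      usc_eventually_circle_integrable[OF usc a\<Omega>, of \<xi>] eventually_at_right_less[of "0::real"]
  proof eventually_elim
    case (elim r)
    have "circle_avg s a (r *\<^sub>R \<xi>) \<le> circle_avg (\<lambda>_. s a) a (r *\<^sub>R \<xi>)"
      using elim by (intro circle_avg_mono circle_integrable_const) auto
    moreover have "0 < f a / 2 * (norm \<xi>)\<^sup>2 * r\<^sup>2" using elim \<xi> half(1) by simp
    ultimately show ?case using elim by simp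
  qed
  then show False by (simp add: eventually_const_iff)
qed

section \<open>Perron's method\<close>

text \<open>The common consequence of the three forms of B-regularity from which the solution is constructed.\<close>

definition has_barriers :: "(complex^'n::finite) set \<Rightarrow> bool" where
  "has_barriers \<Omega> \<longleftrightarrow> (\<forall>G C e. continuous_on UNIV G \<longrightarrow> 0 \<le> C \<longrightarrow> 0 < e \<longrightarrow>
     (\<exists>b. usc_locally_bounded \<Omega> b \<and> local_submean \<Omega> (\<lambda>_. C) b \<and>
       near_boundary \<Omega> (\<lambda>z. b z < G z) \<and> near_boundary \<Omega> (\<lambda>z. G z - e < b z)))"

lemma has_barriersE:
  assumes "has_barriers \<Omega>" "continuous_on UNIV G" "0 \<le> C" "0 < e"
  obtains b where "usc_locally_bounded \<Omega> b" "local_submean \<Omega> (\<lambda>_. C) b"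
    "near_boundary \<Omega> (\<lambda>z. b z < G z)" "near_boundary \<Omega> (\<lambda>z. G z - e < b z)"
  using assms unfolding has_barriers_def by blast

definition perron_family ::
    "(complex^'n::finite) set \<Rightarrow> (complex^'n \<Rightarrow> real) \<Rightarrow> (complex^'n \<Rightarrow> real) \<Rightarrow> (complex^'n \<Rightarrow> real) set" where
  "perron_family \<Omega> f G = {w. usc_locally_bounded \<Omega> w \<and> local_submean \<Omega> f w \<and>
     (\<forall>e>0. near_boundary \<Omega> (\<lambda>z. w z < G z + e))}"

lemma perron_familyD:
  assumes "w \<in> perron_family \<Omega> f G"
  shows "usc_locally_bounded \<Omega> w" "local_submean \<Omega> f w"
    "\<And>e. e > 0 \<Longrightarrow> near_boundary \<Omega> (\<lambda>z. w z < G z + e)"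
  using assms unfolding perron_family_def by auto

lemma perron_family_max:
  assumes "v \<in> perron_family \<Omega> f G" "w \<in> perron_family \<Omega> f G"
  shows "(\<lambda>z. max (v z) (w z)) \<in> perron_family \<Omega> f G"
proof -
  note v = perron_familyD[OF assms(1)] note w = perron_familyD[OF assms(2)]
  have "near_boundary \<Omega> (\<lambda>z. max (v z) (w z) < G z + e)" if "e > 0" for e
    by (rule near_boundary_mono[OF near_boundary_conj[OF v(3)[OF that] w(3)[OF that]]]) auto
  then show ?thesis
    unfolding perron_family_def
    using usc_locally_bounded_max[OF v(1) w(1)] local_submean_max[OF v(1,2) w(1,2)] by blast
qed

text \<open>Off \<open>S\<close> the glued function is \<open>w\<close>, on the open set \<open>V\<close> it is a maximum; together these sets cover
  \<open>\<Omega>\<close>, and all conditions on the family are local or concern the boundary.\<close>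

lemma perron_family_glue:
  fixes w :: "complex^'n::finite \<Rightarrow> real"
  assumes w: "w \<in> perron_family \<Omega> f G" and v: "usc_locally_bounded V v" "local_submean V f v"
    and V: "V \<subseteq> \<Omega>" and S: "compact S" "S \<subseteq> V" and le: "\<And>z. z \<in> V - S \<Longrightarrow> v z \<le> w z"
  shows "(\<lambda>z. if z \<in> V then max (w z) (v z) else w z) \<in> perron_family \<Omega> f G"
proof -
  note wD = perron_familyD[OF w]
  define g where "g z = (if z \<in> V then max (w z) (v z) else w z)" for z
  note openV = usc_locally_boundedD(1)[OF v(1)]
  have off: "g z = w z" if "z \<notin> S" for z using le[of z] that by (auto simp: g_def)
  have ge: "w z \<le> g z" for z by (simp add: g_def)
  have nearV: "\<forall>\<^sub>F z in nhds a. g z = max (w z) (v z)" if "a \<in> V" for a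
    using eventually_nhds_in_open[OF openV that] by eventually_elim (simp add: g_def)
  have nearS: "\<forall>\<^sub>F z in nhds a. g z = w z" if "a \<notin> V" for a
  proof -
    have "\<forall>\<^sub>F z in nhds a. z \<in> - S"
      using that S compact_imp_closed[OF S(1)] by (intro eventually_nhds_in_open) auto
    then show ?thesis by eventually_elim (simp add: off)
  qed
  note uscV = usc_locally_bounded_max[OF usc_locally_bounded_subset[OF wD(1) openV V] v(1)]
  have usc: "usc_locally_bounded \<Omega> g"
  proof (rule usc_locally_boundedI[OF usc_locally_boundedD(1)[OF wD(1)]])
    fix a t assume a: "a \<in> \<Omega>" and t: "g a < t"
    show "\<forall>\<^sub>F z in nhds a. g z < t"
    proof (cases "a \<in> V")
      case True
      then have "max (w a) (v a) < t" using t by (simp add: g_def)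
      from usc_locally_boundedD(4)[OF uscV True this] nearV[OF True] show ?thesis
        by eventually_elim simp
    next
      case False
      then have "w a < t" using t by (simp add: g_def)
      from usc_locally_boundedD(4)[OF wD(1) a this] nearS[OF False] show ?thesis
        by eventually_elim simp
    qed
  next
    fix a assume a: "a \<in> \<Omega>"
    obtain B where "\<forall>\<^sub>F z in nhds a. B \<le> w z" using usc_locally_boundedD(3)[OF wD(1) a] ..
    then have "\<forall>\<^sub>F z in nhds a. B \<le> g z" by eventually_elim (use ge order_trans in blast)
    then show "\<exists>B. \<forall>\<^sub>F z in nhds a. B \<le> g z" ..
  qed
  have sub: "local_submean \<Omega> f g"
    unfolding local_submean_def
  proof (intro ballI allI impI)
    fix a \<xi> c assume a: "a \<in> \<Omega>" and c: "c < f a"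
    show "\<forall>\<^sub>F r in at_right 0. g a + c * (norm \<xi>)\<^sup>2 * r\<^sup>2 \<le> circle_avg g a (r *\<^sub>R \<xi>)"
    proof (cases "g a = w a")
      case True
      then show ?thesis
        by (intro local_submean_dominated[OF wD(1) a usc a _ _ local_submeanD[OF wD(2) a c]]) (auto simp: ge)
    next
      case False
      then have aV: "a \<in> V" and eq: "v a = g a" by (auto simp: g_def max_def split: if_splits)
      have "\<forall>\<^sub>F z in nhds a. v z \<le> g z" using nearV[OF aV] by eventually_elim simp
      then show ?thesis
        by (intro local_submean_dominated[OF v(1) aV usc a eq _ local_submeanD[OF v(2) aV c]])
    qed
  qed
  have "near_boundary \<Omega> (\<lambda>z. g z < G z + e)" if "e > 0" for e
  proof -
    have "near_boundary \<Omega> (\<lambda>z. z \<notin> S)" unfolding near_boundary_def using S V by blast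
    from near_boundary_conj[OF wD(3)[OF that] this] show ?thesis
      by (rule near_boundary_mono) (simp add: off)
  qed
  then have "g \<in> perron_family \<Omega> f G" using usc sub unfolding perron_family_def by blast
  then show ?thesis unfolding g_def[abs_def] .
qed

lemma continuous_imp_usc_lsc_on:
  assumes "continuous_on S u"
  shows "usc_on S (\<lambda>z. ereal (u z))" and "lsc_on S (\<lambda>z. ereal (u z))"
proof -
  have "((\<lambda>z. ereal (u z)) \<longlongrightarrow> ereal (u x)) (at x within S)" if "x \<in> S" for x
    using assms that by (intro tendsto_ereal) (simp add: continuous_on_def)
  then show "usc_on S (\<lambda>z. ereal (u z))" "lsc_on S (\<lambda>z. ereal (u z))"
    unfolding usc_on_def lsc_on_def using order_tendstoD by blast+
qed

lemma local_submean_imp_viscosity_subsolution: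
  fixes u :: "complex^'n::finite \<Rightarrow> real"
  assumes \<Omega>: "open \<Omega>" "\<Omega> \<noteq> {}" and u: "continuous_on \<Omega> u" and sub: "local_submean \<Omega> f u"
  shows "viscosity_subsolution \<Omega> f (\<lambda>z. ereal (u z))"
  unfolding viscosity_subsolution_def
proof (intro conjI ballI allI impI)
  show "usc_on \<Omega> (\<lambda>z. ereal (u z))" by (rule continuous_imp_usc_lsc_on(1)[OF u])
  show "\<exists>z\<in>\<Omega>. ereal (u z) \<noteq> - \<infinity>" using \<Omega>(2) by auto
next
  fix z q assume z: "z \<in> \<Omega>" and q: "C2_near z q \<and> touches_above q (\<lambda>z. ereal (u z)) z"
  then obtain U where U: "open U" "z \<in> U" "Ck_on 2 U q" unfolding C2_near_def by blast
  have eq: "u z = q z" and le: "\<forall>\<^sub>F y in nhds z. u y \<le> q y"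
    using q unfolding touches_above_def by (auto elim: eventually_mono)
  show "f z \<le> \<Lambda>\<^sub>1 (complex_hessian q z)"
  proof (rule submean_imp_le_smallest_eigenvalue[OF U(1,3,2)])
    fix c \<xi> assume "c < f z"
    from local_submean_dominated[OF usc_locally_bounded_continuous[OF \<Omega>(1) u] z
        usc_locally_bounded_continuous[OF U(1) C2_on_imp_continuous[OF U(3)]] U(2) eq le
        local_submeanD[OF sub z this]]
    show "\<forall>\<^sub>F r in at_right 0. q z + c * (norm \<xi>)\<^sup>2 * r\<^sup>2 \<le> circle_avg q z (r *\<^sub>R \<xi>)" .
  qed
qed simp

definition perron :: "(complex^'n::finite) set \<Rightarrow> (complex^'n \<Rightarrow> real) \<Rightarrow> (complex^'n \<Rightarrow> real) \<Rightarrow> complex^'n \<Rightarrow> real" where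
  "perron \<Omega> f G z = (if z \<in> \<Omega> then SUP w\<in>perron_family \<Omega> f G. w z else G z)"

context
  fixes \<Omega> :: "(complex^'n::finite) set" and f G :: "complex^'n \<Rightarrow> real"
  assumes open_\<Omega>: "open \<Omega>" and bounded_\<Omega>: "bounded \<Omega>" and barriers: "has_barriers \<Omega>"
    and cont_f: "continuous_on (closure \<Omega>) f" and pos_f: "\<forall>z\<in>closure \<Omega>. f z > 0"
    and cont_G: "continuous_on UNIV G"
begin

abbreviation (input) "\<F> \<equiv> perron_family \<Omega> f G"
abbreviation (input) "\<U> \<equiv> perron \<Omega> f G"

lemma perron_family_lower_barrier:
  assumes e: "e > 0"
  shows "\<exists>b\<in>\<F>. near_boundary \<Omega> (\<lambda>z. G z - e < b z)"
proof -
  have "bounded (f ` closure \<Omega>)"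
    using compact_continuous_image[OF cont_f] bounded_\<Omega> by (simp add: compact_imp_bounded)
  then obtain C where C: "C > 0" "\<And>z. z \<in> closure \<Omega> \<Longrightarrow> \<bar>f z\<bar> \<le> C"
    unfolding bounded_pos by auto
  obtain b where b: "usc_locally_bounded \<Omega> b" "local_submean \<Omega> (\<lambda>_. C) b"
    "near_boundary \<Omega> (\<lambda>z. b z < G z)" "near_boundary \<Omega> (\<lambda>z. G z - e < b z)"
    using has_barriersE[OF barriers cont_G less_imp_le[OF C(1)] e] by blast
  have "local_submean \<Omega> f b"
    using local_submean_mono[OF b(2), of \<Omega> f] C(2) closure_subset abs_le_D1 by blast
  moreover have "near_boundary \<Omega> (\<lambda>z. b z < G z + e)" if "e > 0" for e
    by (rule near_boundary_mono[OF b(3)]) (use that in simp)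
  ultimately show ?thesis using b unfolding perron_family_def by blast
qed

text \<open>A member \<open>w\<close> and a barrier \<open>b\<close> for \<open>- G\<close> add up to a function that is at most \<open>0\<close> at the boundary, hence
  everywhere. The bound does not depend on \<open>w\<close>.\<close>

lemma perron_family_upper_barrier:
  assumes e: "e > 0"
  shows "\<exists>b. (\<forall>w\<in>\<F>. \<forall>z\<in>\<Omega>. w z \<le> b z) \<and> near_boundary \<Omega> (\<lambda>z. b z < G z + e)"
proof -
  have cont_mG: "continuous_on UNIV (\<lambda>z. - G z)" by (intro continuous_intros cont_G)
  obtain b where b: "usc_locally_bounded \<Omega> b" "local_submean \<Omega> (\<lambda>_. 0) b"
    "near_boundary \<Omega> (\<lambda>z. b z < - G z)" "near_boundary \<Omega> (\<lambda>z. - G z - e < b z)"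
    using has_barriersE[OF barriers cont_mG order_refl e] by blast
  have "w z \<le> - b z" if w: "w \<in> \<F>" and z: "z \<in> \<Omega>" for w z
  proof -
    note wD = perron_familyD[OF w]
    have "w z + b z \<le> 0 + d" if d: "d > 0" for d
    proof (simp, rule local_submean_maximum_principle[OF usc_locally_bounded_add[OF wD(1) b(1)]
          local_submean_add[OF wD(1,2) b(1,2)] _ _ z])
      show "0 < f y + 0" if "y \<in> \<Omega>" for y
        using pos_f that closure_subset[of \<Omega>] by auto
      show "near_boundary \<Omega> (\<lambda>z. w z + b z < d)"
        by (rule near_boundary_mono[OF near_boundary_conj[OF wD(3)[OF d] b(3)]]) auto
    qed
    then have "w z + b z \<le> 0" by (rule field_le_epsilon)
    then show ?thesis by simp
  qed
  moreover have "near_boundary \<Omega> (\<lambda>z. - b z < G z + e)"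
    by (rule near_boundary_mono[OF b(4)]) simp
  ultimately show ?thesis by (intro exI[of _ "\<lambda>z. - b z"]) blast
qed

lemma perron_family_nonempty: "\<F> \<noteq> {}"
  using perron_family_lower_barrier[of 1] by auto

lemma perron_family_bdd_above:
  assumes "z \<in> \<Omega>" shows "bdd_above ((\<lambda>w. w z) ` \<F>)"
proof -
  obtain b where "\<forall>w\<in>\<F>. \<forall>z\<in>\<Omega>. w z \<le> b z"
    using perron_family_upper_barrier[OF zero_less_one] by blast
  then show ?thesis using assms by (intro bdd_aboveI2[of _ _ "b z"]) blast
qed

lemma perron_upper: "w \<in> \<F> \<Longrightarrow> z \<in> \<Omega> \<Longrightarrow> w z \<le> \<U> z"
  unfolding perron_def by (simp add: cSUP_upper[OF _ perron_family_bdd_above])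

lemma perron_least: "z \<in> \<Omega> \<Longrightarrow> (\<And>w. w \<in> \<F> \<Longrightarrow> w z \<le> t) \<Longrightarrow> \<U> z \<le> t"
  unfolding perron_def by (simp add: cSUP_least[OF perron_family_nonempty])

lemma perron_approx:
  assumes "z \<in> \<Omega>" "\<eta> > 0"
  shows "\<exists>w\<in>\<F>. \<U> z - \<eta> < w z"
  using less_cSUP_iff[OF perron_family_nonempty perron_family_bdd_above[OF assms(1)], of "\<U> z - \<eta>"]
    assms by (simp add: perron_def)

lemma perron_near_boundary:
  assumes e: "e > 0"
  shows "near_boundary \<Omega> (\<lambda>z. \<bar>\<U> z - G z\<bar> < e)"
proof -
  obtain b where b: "b \<in> \<F>" "near_boundary \<Omega> (\<lambda>z. G z - e < b z)"
    using perron_family_lower_barrier[OF e] by blast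
  obtain b' where b': "\<forall>w\<in>\<F>. \<forall>z\<in>\<Omega>. w z \<le> b' z" "near_boundary \<Omega> (\<lambda>z. b' z < G z + e)"
    using perron_family_upper_barrier[OF e] by blast
  show ?thesis
  proof (rule near_boundary_mono[OF near_boundary_conj[OF b(2) b'(2)]])
    fix z assume z: "z \<in> \<Omega>" and *: "G z - e < b z \<and> b' z < G z + e"
    have "\<U> z \<le> b' z" using b'(1) z by (intro perron_least[OF z]) blast
    then show "\<bar>\<U> z - G z\<bar> < e" using perron_upper[OF b(1) z] * by linarith
  qed
qed

text \<open>Walsh's translation argument. The function \<open>v z = w1 (z + h) + \<epsilon> |z|\<^sup>2 - const\<close> has excess at least
  \<open>f (z + h) + \<epsilon> \<ge> f z\<close>. Where neither \<open>z\<close> nor \<open>z + h\<close> lies in \<open>K\<close>, the barriers pin \<open>w1\<close> at both points to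
  within \<open>\<epsilon>\<close> of \<open>G\<close>, and the constant is chosen so that \<open>v \<le> w1\<close> there. So \<open>v\<close> can be glued to \<open>w1\<close>.\<close>

lemma perron_family_translate:
  assumes e: "e > 0"
  shows "\<exists>\<delta>>0. \<forall>w\<in>\<F>. \<forall>h. norm h < \<delta> \<longrightarrow>
    (\<exists>w'\<in>\<F>. \<forall>z\<in>\<Omega>. z + h \<in> \<Omega> \<longrightarrow> w (z + h) - e \<le> w' z)"
proof -
  have comp: "compact (closure \<Omega>)" using bounded_\<Omega> by simp
  obtain R where R: "R > 0" "\<And>z. z \<in> \<Omega> \<Longrightarrow> norm z \<le> R"
    using bounded_\<Omega> unfolding bounded_pos by blast
  define \<epsilon> where "\<epsilon> = e / (4 + R\<^sup>2)"
  have "4 + R\<^sup>2 > 0" by (simp add: add_pos_nonneg)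
  then have \<epsilon>: "\<epsilon> > 0" "\<epsilon> * (4 + R\<^sup>2) = e" using e by (simp_all add: \<epsilon>_def)
  obtain b where b: "b \<in> \<F>" "near_boundary \<Omega> (\<lambda>z. G z - \<epsilon> < b z)"
    using perron_family_lower_barrier[OF \<epsilon>(1)] by blast
  obtain b' where b': "\<forall>w\<in>\<F>. \<forall>z\<in>\<Omega>. w z \<le> b' z" "near_boundary \<Omega> (\<lambda>z. b' z < G z + \<epsilon>)"
    using perron_family_upper_barrier[OF \<epsilon>(1)] by blast
  obtain K where K: "compact K" "K \<subseteq> \<Omega>" "\<And>z. z \<in> \<Omega> - K \<Longrightarrow> G z - \<epsilon> < b z \<and> b' z < G z + \<epsilon>"
    using near_boundary_conj[OF b(2) b'(2)] unfolding near_boundary_def by blast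
  obtain d where d: "d > 0" "(\<Union>x\<in>K. ball x d) \<subseteq> \<Omega>"
    using compact_subset_open_imp_ball_epsilon_subset[OF K(1) open_\<Omega> K(2)] by blast
  have "uniformly_continuous_on (cball 0 (R + 1)) G"
    by (rule compact_uniformly_continuous[OF continuous_on_subset[OF cont_G]]) auto
  from this[unfolded uniformly_continuous_on_def, rule_format, OF \<epsilon>(1)] obtain d1 where
    d1: "d1 > 0" "\<And>x y. x \<in> cball 0 (R + 1) \<Longrightarrow> y \<in> cball 0 (R + 1) \<Longrightarrow> dist y x < d1 \<Longrightarrow> \<bar>G y - G x\<bar> < \<epsilon>"
    unfolding dist_real_def by blast
  from compact_uniformly_continuous[OF cont_f comp, unfolded uniformly_continuous_on_def, rule_format, OF \<epsilon>(1)]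
  obtain d2 where d2: "d2 > 0" "\<And>x y. x \<in> closure \<Omega> \<Longrightarrow> y \<in> closure \<Omega> \<Longrightarrow> dist y x < d2 \<Longrightarrow> \<bar>f y - f x\<bar> < \<epsilon>"
    unfolding dist_real_def by blast
  define \<delta> where "\<delta> = Min {d, d1, d2}"
  have \<delta>: "\<delta> > 0" "\<delta> \<le> d" "\<delta> \<le> d1" "\<delta> \<le> d2" using d(1) d1(1) d2(1) by (simp_all add: \<delta>_def)
  have "\<exists>w'\<in>\<F>. \<forall>z\<in>\<Omega>. z + h \<in> \<Omega> \<longrightarrow> w (z + h) - e \<le> w' z"
    if w: "w \<in> \<F>" and h: "norm h < \<delta>" for w h
  proof -
    define w1 where "w1 z = max (w z) (b z)" for z
    have w1: "w1 \<in> \<F>" unfolding w1_def[abs_def] by (rule perron_family_max[OF w b(1)])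
    note w1D = perron_familyD[OF w1]
    define V where "V = \<Omega> \<inter> {z. z + h \<in> \<Omega>}"
    define p where "p z = \<epsilon> * (norm (z - 0))\<^sup>2 + (- 4 * \<epsilon> - \<epsilon> * R\<^sup>2)" for z :: "complex^'n"
    define v where "v z = w1 (z + h) + p z" for z
    define S where "S = K \<union> {z. z + h \<in> K}"
    note tr = usc_locally_bounded_translate[OF w1D(1), of h]
    have oV: "open V" unfolding V_def using open_\<Omega> usc_locally_boundedD(1)[OF tr] by blast
    have uscV: "usc_locally_bounded V (\<lambda>z. w1 (z + h))"
      by (rule usc_locally_bounded_subset[OF tr oV]) (auto simp: V_def)
    have uscp: "usc_locally_bounded V p"
      unfolding p_def[abs_def] by (rule usc_locally_bounded_norm_squared[OF oV])
    have usc: "usc_locally_bounded V v"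
      unfolding v_def[abs_def] by (rule usc_locally_bounded_add[OF uscV uscp])
    have "local_submean V (\<lambda>z. f (z + h)) (\<lambda>z. w1 (z + h))"
      by (rule local_submean_mono[OF local_submean_translate[OF w1D(2)]]) (auto simp: V_def)
    from local_submean_add[OF uscV this uscp local_submean_norm_squared[of V \<epsilon> 0 "- 4 * \<epsilon> - \<epsilon> * R\<^sup>2", folded p_def[abs_def]]]
    have "local_submean V (\<lambda>z. f (z + h) + \<epsilon>) v" unfolding v_def[abs_def] .
    then have sub: "local_submean V f v"
    proof (rule local_submean_mono[OF _ order_refl])
      fix z assume "z \<in> V"
      then have "z \<in> closure \<Omega>" "z + h \<in> closure \<Omega>" using closure_subset by (auto simp: V_def)
      then have "\<bar>f (z + h) - f z\<bar> < \<epsilon>" using h \<delta> by (intro d2(2)) (simp_all add: dist_norm)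
      then show "f z \<le> f (z + h) + \<epsilon>" by linarith
    qed
    have S: "compact S"
    proof -
      have "{z. z + h \<in> K} = (\<lambda>z. z - h) ` K" by (auto simp: image_iff algebra_simps)
      then have "compact {z. z + h \<in> K}" using compact_translation_subtract[OF K(1), of h] by simp
      then show ?thesis unfolding S_def using K(1) by (rule compact_Un[rotated])
    qed
    have near: "z \<in> \<Omega>" if "x \<in> K" "norm (z - x) < \<delta>" for x z
    proof -
      have "z \<in> (\<Union>x\<in>K. ball x d)"
        using that \<delta> by (intro UN_I[of x]) (simp_all add: dist_norm norm_minus_commute)
      then show ?thesis using d(2) by blast
    qed
    have SV: "S \<subseteq> V"
    proof
      fix z assume "z \<in> S"
      then show "z \<in> V"
        unfolding S_def V_def using near[of z "z + h"] near[of "z + h" z] K(2) h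
        by (auto simp: norm_minus_commute)
    qed
    have le: "v z \<le> w1 z" if z: "z \<in> V - S" for z
    proof -
      have z': "z \<in> \<Omega> - K" "z + h \<in> \<Omega> - K" using z by (auto simp: V_def S_def)
      have "norm z \<le> R" "norm (z + h) \<le> R" using R(2) z' by auto
      then have "\<bar>G (z + h) - G z\<bar> < \<epsilon>" using h \<delta> by (intro d1(2)) (simp_all add: dist_norm[of "z + h"])
      moreover have "w1 (z + h) < G (z + h) + \<epsilon>" using b'(1) w1 z'(2) K(3)[OF z'(2)] by force
      moreover have "\<epsilon> * (norm z)\<^sup>2 \<le> \<epsilon> * R\<^sup>2"
        using \<open>norm z \<le> R\<close> \<epsilon>(1) by (intro mult_left_mono power_mono) auto
      moreover have "G z - \<epsilon> < b z" using K(3)[OF z'(1)] by simp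
      moreover have "v z = w1 (z + h) + \<epsilon> * (norm z)\<^sup>2 - 4 * \<epsilon> - \<epsilon> * R\<^sup>2" by (simp add: v_def p_def)
      ultimately have "v z < b z" using \<epsilon>(1) by linarith
      then show ?thesis by (simp add: w1_def)
    qed
    let ?w' = "\<lambda>z. if z \<in> V then max (w1 z) (v z) else w1 z"
    have "?w' \<in> \<F>"
      by (rule perron_family_glue[OF w1 usc sub _ S SV le]) (simp add: V_def)
    moreover have "\<forall>z\<in>\<Omega>. z + h \<in> \<Omega> \<longrightarrow> w (z + h) - e \<le> ?w' z"
    proof (intro ballI impI)
      fix z assume that: "z \<in> \<Omega>" "z + h \<in> \<Omega>"
      have "0 \<le> \<epsilon> * (norm z)\<^sup>2" using \<epsilon>(1) by simp
      then have "w (z + h) - e \<le> v z"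
        by (simp add: v_def w1_def p_def \<epsilon>(2)[symmetric] algebra_simps)
      then show "w (z + h) - e \<le> ?w' z" using that by (simp add: V_def)
    qed
    ultimately show ?thesis by (rule bexI[rotated, where x="?w'"])
  qed
  then show ?thesis using \<delta>(1) by blast
qed

lemma perron_uniformly_continuous:
  assumes e: "e > 0"
  shows "\<exists>\<delta>>0. \<forall>x\<in>\<Omega>. \<forall>y\<in>\<Omega>. dist x y < \<delta> \<longrightarrow> \<bar>\<U> x - \<U> y\<bar> \<le> e"
proof -
  obtain \<delta> where \<delta>: "\<delta> > 0" "\<And>w h. w \<in> \<F> \<Longrightarrow> norm h < \<delta> \<Longrightarrow>
    \<exists>w'\<in>\<F>. \<forall>z\<in>\<Omega>. z + h \<in> \<Omega> \<longrightarrow> w (z + h) - e \<le> w' z"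
    using perron_family_translate[OF e] by blast
  have one: "\<U> y \<le> \<U> x + e" if xy: "x \<in> \<Omega>" "y \<in> \<Omega>" "dist x y < \<delta>" for x y
  proof (rule perron_least[OF xy(2)])
    fix w assume w: "w \<in> \<F>"
    have "norm (y - x) < \<delta>" using xy(3) by (simp add: dist_norm norm_minus_commute)
    from \<delta>(2)[OF w this] obtain w' where w': "w' \<in> \<F>"
      "\<forall>z\<in>\<Omega>. z + (y - x) \<in> \<Omega> \<longrightarrow> w (z + (y - x)) - e \<le> w' z" by blast
    have "w y - e \<le> w' x" using w'(2)[rule_format, of x] xy by simp
    then show "w y \<le> \<U> x + e" using perron_upper[OF w'(1) xy(1)] by linarith
  qed
  have "\<bar>\<U> x - \<U> y\<bar> \<le> e" if "x \<in> \<Omega>" "y \<in> \<Omega>" "dist x y < \<delta>" for x y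
    using one[of x y] one[of y x] that by (simp add: dist_commute abs_le_iff)
  then show ?thesis using \<delta>(1) by blast
qed

lemma perron_continuous: "continuous_on \<Omega> (\<U>)"
  unfolding continuous_on_iff
proof (intro ballI allI impI)
  fix x and e :: real assume x: "x \<in> \<Omega>" and e: "e > 0"
  have "e / 2 > 0" using e by simp
  from perron_uniformly_continuous[OF this] obtain \<delta> where \<delta>: "\<delta> > 0"
    "\<And>x y. x \<in> \<Omega> \<Longrightarrow> y \<in> \<Omega> \<Longrightarrow> dist x y < \<delta> \<Longrightarrow> \<bar>\<U> x - \<U> y\<bar> \<le> e / 2"
    by blast
  have "dist (\<U> y) (\<U> x) < e" if "y \<in> \<Omega>" "dist y x < \<delta>" for y
    using \<delta>(2)[OF that(1) x that(2)] e by (simp add: dist_real_def)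
  then show "\<exists>d>0. \<forall>x'\<in>\<Omega>. dist x' x < d \<longrightarrow> dist (\<U> x') (\<U> x) < e"
    using \<delta>(1) by blast
qed

text \<open>The approximating functions in \<open>submean_on_discs\<close> are the members of the family.\<close>

lemma perron_disc_submean: "disc_submean \<Omega> f (\<U>)"
  unfolding disc_submean_def
proof (intro allI impI)
  fix a \<xi> k assume disc: "\<forall>c. cmod c \<le> 1 \<longrightarrow> a + c *s \<xi> \<in> \<Omega> \<and> k \<le> f (a + c *s \<xi>)"
  show "\<U> a + k * (norm \<xi>)\<^sup>2 \<le> circle_avg (\<U>) a \<xi>"
  proof (rule submean_on_discs[OF open_\<Omega> perron_continuous continuous_on_subset[OF cont_f closure_subset] _ disc[rule_format]])
    fix x and \<eta> :: real assume "x \<in> \<Omega>" "\<eta> > 0"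
    then obtain w where w: "w \<in> \<F>" "\<U> x - \<eta> < w x"
      using perron_approx by blast
    then show "\<exists>w. usc_locally_bounded \<Omega> w \<and> (\<forall>z\<in>\<Omega>. w z \<le> \<U> z) \<and>
        \<U> x - \<eta> < w x \<and> model_tested \<Omega> f w"
      using perron_familyD[OF w(1)] perron_upper[OF w(1)] local_submean_imp_model_tested by blast
  qed
qed

lemma perron_local_submean: "local_submean \<Omega> f (\<U>)"
  by (rule submean_on_discs_imp_local_submean[OF open_\<Omega> continuous_on_subset[OF cont_f closure_subset]])
     (use perron_disc_submean in \<open>unfold disc_submean_def, blast\<close>)

lemma perron_in_family: "\<U> \<in> \<F>"
proof -
  have "near_boundary \<Omega> (\<lambda>z. \<U> z < G z + e)" if "e > 0" for e
    by (rule near_boundary_mono[OF perron_near_boundary[OF that]]) linarith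
  then show ?thesis
    unfolding perron_family_def
    using usc_locally_bounded_continuous[OF open_\<Omega> perron_continuous] perron_local_submean by blast
qed

lemma perron_boundary_continuous: "continuous_on (closure \<Omega>) (\<U>)"
  unfolding continuous_on_eq_continuous_within
proof
  fix x assume x: "x \<in> closure \<Omega>"
  have "(\<U> \<longlongrightarrow> \<U> x) (nhds x)"
  proof (cases "x \<in> \<Omega>")
    case True
    then have "isCont (\<U>) x"
      using perron_continuous continuous_on_eq_continuous_at[OF open_\<Omega>] by blast
    then show ?thesis by (simp add: isCont_def tendsto_at_iff_tendsto_nhds)
  next
    case False
    then have fr: "x \<in> frontier \<Omega>" using x open_\<Omega> by (simp add: frontier_def interior_open)
    have G: "(G \<longlongrightarrow> G x) (nhds x)"
      using cont_G continuous_on_eq_continuous_at isCont_def tendsto_at_iff_tendsto_nhds open_UNIV by blast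
    have "\<forall>\<^sub>F z in nhds x. dist (\<U> z) (G x) < e" if e: "e > 0" for e
    proof -
      have "e / 2 > 0" using e by simp
      from near_boundary_imp_eventually[OF open_\<Omega> perron_near_boundary[OF this] fr] tendstoD[OF G this]
      show ?thesis
      proof eventually_elim
        case (elim z)
        have "\<bar>\<U> z - G z\<bar> < e / 2"
          using elim(1) e by (cases "z \<in> \<Omega>") (simp_all add: perron_def)
        then show ?case using elim(2) unfolding dist_real_def by linarith
      qed
    qed
    then show ?thesis using False by (simp add: tendsto_iff perron_def)
  qed
  then show "continuous (at x within closure \<Omega>) (\<U>)"
    unfolding continuous_within by (rule filterlim_mono[OF _ order_refl]) (simp add: at_within_def)
qed

lemma perron_viscosity_subsolution:
  "\<Omega> \<noteq> {} \<Longrightarrow> viscosity_subsolution \<Omega> f (\<lambda>z. ereal (\<U> z))"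
  by (rule local_submean_imp_viscosity_subsolution[OF open_\<Omega> _ perron_continuous perron_local_submean])

text \<open>If \<open>q\<close> touches from below with smallest eigenvalue above \<open>f\<close>, then \<open>q - (m / 2) |z - z0|\<^sup>2\<close> still has excess
  above \<open>f\<close> near \<open>z0\<close> and lies strictly below the Perron function away from \<open>z0\<close>. Raised by a small
  constant, it can be glued in and gives a member that is too large at \<open>z0\<close>.\<close>

lemma perron_viscosity_supersolution: "viscosity_supersolution \<Omega> f (\<lambda>z. ereal (\<U> z))"
  unfolding viscosity_supersolution_def
proof (intro conjI ballI allI impI)
  show "lsc_on \<Omega> (\<lambda>z. ereal (\<U> z))" by (rule continuous_imp_usc_lsc_on(2)[OF perron_continuous])
next
  fix z0 q assume z0: "z0 \<in> \<Omega>" and q: "C2_near z0 q \<and> touches_below q (\<lambda>z. ereal (\<U> z)) z0"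
  then obtain U where U: "open U" "z0 \<in> U" "Ck_on 2 U q" unfolding C2_near_def by blast
  have eq: "\<U> z0 = q z0" and le: "\<forall>\<^sub>F y in nhds z0. q y \<le> \<U> y"
    using q unfolding touches_below_def by (auto elim: eventually_mono)
  show "max (\<Lambda>\<^sub>1 (complex_hessian q z0)) 0 \<le> f z0"
  proof (rule ccontr)
    assume neg: "\<not> max (\<Lambda>\<^sub>1 (complex_hessian q z0)) 0 \<le> f z0"
    have "f z0 > 0" using pos_f z0 closure_subset by blast
    then have gt: "f z0 < \<Lambda>\<^sub>1 (complex_hessian q z0)" using neg by (simp add: max_def split: if_splits)
    define m where "m = (\<Lambda>\<^sub>1 (complex_hessian q z0) - f z0) / 2"
    have m: "m > 0" "f z0 + m < \<Lambda>\<^sub>1 (complex_hessian q z0)" using gt by (simp_all add: m_def field_simps)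
    obtain d where d: "d > 0" "ball z0 d \<subseteq> U" "\<And>x. x \<in> ball z0 d \<Longrightarrow> f z0 + m < \<Lambda>\<^sub>1 (complex_hessian q x)"
      using smallest_eigenvalue_greater_nearby[OF U(1,3,2) m(2)] by blast
    have "continuous_on \<Omega> (\<lambda>z. f z)" by (rule continuous_on_subset[OF cont_f closure_subset])
    from usc_locally_boundedD(4)[OF usc_locally_bounded_continuous[OF open_\<Omega> this] z0, of "f z0 + m / 2"] m(1)
    have "\<forall>\<^sub>F z in nhds z0. f z < f z0 + m / 2" by simp
    then have "\<forall>\<^sub>F z in nhds z0. (z \<in> \<Omega> \<and> z \<in> ball z0 d) \<and> f z < f z0 + m / 2 \<and> q z \<le> \<U> z"
      using le open_\<Omega> z0 d(1) by (intro eventually_conj eventually_nhds_in_open) auto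
    then obtain \<rho> where \<rho>: "\<rho> > 0" "\<And>z. dist z z0 < \<rho> \<Longrightarrow> (z \<in> \<Omega> \<and> z \<in> ball z0 d) \<and> f z < f z0 + m / 2 \<and> q z \<le> \<U> z"
      unfolding eventually_nhds_metric by blast
    define V where "V = ball z0 \<rho>"
    have V: "open V" "V \<subseteq> \<Omega>" "V \<subseteq> U" using \<rho>(2) d(2) by (auto simp: V_def dist_commute)
    define p where "p z = - (m / 2) * (norm (z - z0))\<^sup>2 + m * \<rho>\<^sup>2 / 16" for z
    define v where "v z = q z + p z" for z
    have uscq: "usc_locally_bounded V q"
      by (intro usc_locally_bounded_continuous V continuous_on_subset[OF C2_on_imp_continuous[OF U(3)]])
    have subq: "local_submean V (\<lambda>_. f z0 + m) q"
      unfolding local_submean_def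
    proof (intro ballI allI impI)
      fix a \<xi> c assume a: "a \<in> V" and c: "c < f z0 + m"
      have "a \<in> ball z0 d" using \<rho>(2)[of a] a by (simp add: V_def dist_commute)
      then have "c < \<Lambda>\<^sub>1 (complex_hessian q a)" using d(3) c by force
      then show "\<forall>\<^sub>F r in at_right 0. q a + c * (norm \<xi>)\<^sup>2 * r\<^sup>2 \<le> circle_avg q a (r *\<^sub>R \<xi>)"
        using V(3) a by (intro smallest_eigenvalue_imp_submean[OF U(1,3)]) auto
    qed
    have uscp: "usc_locally_bounded V p"
      unfolding p_def[abs_def] by (rule usc_locally_bounded_norm_squared[OF V(1)])
    have uscv: "usc_locally_bounded V v" unfolding v_def[abs_def] by (rule usc_locally_bounded_add[OF uscq uscp])
    from local_submean_add[OF uscq subq uscp local_submean_norm_squared[of V "- (m / 2)" z0 "m * \<rho>\<^sup>2 / 16", folded p_def[abs_def]]]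
    have subv: "local_submean V f v"
      unfolding v_def[abs_def]
    proof (rule local_submean_mono[OF _ order_refl])
      fix z assume "z \<in> V"
      then have "f z < f z0 + m / 2" using \<rho>(2)[of z] by (simp add: V_def dist_commute)
      then show "f z \<le> f z0 + m + - (m / 2)" by simp
    qed
    have le': "v z \<le> \<U> z" if z: "z \<in> V - cball z0 (\<rho> / 2)" for z
    proof -
      have "q z \<le> \<U> z" using \<rho>(2)[of z] z by (simp add: V_def dist_commute)
      moreover have "(\<rho> / 2)\<^sup>2 \<le> (norm (z - z0))\<^sup>2"
        using z \<rho>(1) by (intro power_mono) (simp_all add: dist_norm norm_minus_commute)
      then have "m / 2 * (\<rho> / 2)\<^sup>2 \<le> m / 2 * (norm (z - z0))\<^sup>2" using m(1) by (intro mult_left_mono) auto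
      moreover have "m * \<rho>\<^sup>2 / 16 \<le> m / 2 * (\<rho> / 2)\<^sup>2" using m(1) \<rho>(1) by (simp add: power2_eq_square)
      ultimately show ?thesis by (simp add: v_def p_def)
    qed
    let ?g = "\<lambda>z. if z \<in> V then max (\<U> z) (v z) else \<U> z"
    have "?g \<in> \<F>"
      using \<rho>(1) le'
      by (intro perron_family_glue[OF perron_in_family uscv subv V(2), of "cball z0 (\<rho> / 2)"]) (auto simp: V_def)
    from perron_upper[OF this z0] have "v z0 \<le> \<U> z0" using \<rho>(1) by (simp add: V_def)
    moreover have "v z0 > \<U> z0" using m(1) \<rho>(1) by (simp add: v_def p_def eq)
    ultimately show False by simp
  qed
qed simp

end

section \<open>Barriers on B-regular domains\<close>

lemma C2_imp_local_submean:
  fixes q :: "complex^'n::finite \<Rightarrow> real"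
  assumes "open U" "Ck_on 2 U q" "V \<subseteq> U" "\<And>z. z \<in> V \<Longrightarrow> f z \<le> \<Lambda>\<^sub>1 (complex_hessian q z)"
  shows "local_submean V f q"
  unfolding local_submean_def
  using smallest_eigenvalue_imp_submean[OF assms(1,2)] assms(3,4) by (meson less_le_trans subsetD)

lemma smallest_eigenvalue_bounded_below:
  fixes q :: "complex^'n::finite \<Rightarrow> real"
  assumes U: "open U" "Ck_on 2 U q" and K: "compact K" "K \<subseteq> U"
  shows "\<exists>M. \<forall>z\<in>K. M \<le> \<Lambda>\<^sub>1 (complex_hessian q z)"
proof -
  define E where "E M = {x\<in>U. \<exists>d>0. ball x d \<subseteq> U \<and> (\<forall>y\<in>ball x d. M < \<Lambda>\<^sub>1 (complex_hessian q y))}" for M :: real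
  have "open (E M)" for M
  proof (rule openI)
    fix x assume "x \<in> E M"
    then obtain d where d: "d > 0" "ball x d \<subseteq> U" "\<forall>y\<in>ball x d. M < \<Lambda>\<^sub>1 (complex_hessian q y)"
      unfolding E_def by blast
    have "ball x d \<subseteq> E M"
    proof
      fix y assume y: "y \<in> ball x d"
      then have "M < \<Lambda>\<^sub>1 (complex_hessian q y)" "y \<in> U" using d by auto
      then show "y \<in> E M" using smallest_eigenvalue_greater_nearby[OF U, of y M] unfolding E_def by blast
    qed
    then show "\<exists>e>0. ball x e \<subseteq> E M" using d(1) by blast
  qed
  moreover have "K \<subseteq> (\<Union>M\<in>UNIV. E M)"
  proof
    fix z assume "z \<in> K"
    then have "z \<in> U" using K(2) by blast
    then have "z \<in> E (\<Lambda>\<^sub>1 (complex_hessian q z) - 1)"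
      using smallest_eigenvalue_greater_nearby[OF U, of z "\<Lambda>\<^sub>1 (complex_hessian q z) - 1"] unfolding E_def by simp
    then show "z \<in> (\<Union>M\<in>UNIV. E M)" by blast
  qed
  ultimately obtain T where T: "finite T" "K \<subseteq> (\<Union>M\<in>T. E M)"
    using compactE_image[OF K(1), of UNIV E] by (metis subset_UNIV)
  have low: "M < \<Lambda>\<^sub>1 (complex_hessian q z)" if "z \<in> E M" for z M
    using that centre_in_ball unfolding E_def by blast
  have "Min (insert 0 T) \<le> \<Lambda>\<^sub>1 (complex_hessian q z)" if z: "z \<in> K" for z
  proof -
    obtain M where "M \<in> T" "z \<in> E M" using T(2) z by blast
    then have "Min (insert 0 T) \<le> M" "M < \<Lambda>\<^sub>1 (complex_hessian q z)" using T(1) low by simp_all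
    then show ?thesis by linarith
  qed
  then show ?thesis by blast
qed

text \<open>A mollified datum has Hessian bounded below on the closure, so a large multiple of the exhaustion
  makes the sum have excess \<open>C\<close>, while this multiple tends to \<open>0\<close> at the boundary.\<close>

lemma exhaustion_imp_barriers:
  fixes \<Omega> :: "(complex^'n::finite) set"
  assumes \<Omega>: "open \<Omega>" "bounded \<Omega>" and ex: "B_regular_exhaustion \<Omega>"
  shows "has_barriers \<Omega>"
  unfolding has_barriers_def
proof (intro allI impI)
  fix G :: "complex^'n \<Rightarrow> real" and C e :: real
  assume G: "continuous_on UNIV G" and C: "0 \<le> C" and e: "0 < e"
  obtain \<psi> where \<psi>: "smooth_fun_on \<Omega> \<psi>" "\<And>z. z \<in> \<Omega> \<Longrightarrow> \<psi> z < 0"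
    "\<And>\<zeta>. \<zeta> \<in> frontier \<Omega> \<Longrightarrow> (\<psi> \<longlongrightarrow> 0) (at \<zeta> within \<Omega>)"
    "\<And>z \<xi>. z \<in> \<Omega> \<Longrightarrow> Re (\<Sum>j\<in>UNIV. \<Sum>k\<in>UNIV. complex_hessian \<psi> z $ j $ k * \<xi> $ j * cnj (\<xi> $ k)) \<ge> (norm \<xi>)\<^sup>2"
    using ex unfolding B_regular_exhaustion_def by blast
  have C2\<psi>: "Ck_on 2 \<Omega> \<psi>" using \<psi>(1) by (simp add: smooth_fun_on_def)
  have "1 \<le> \<Lambda>\<^sub>1 (complex_hessian \<psi> z)" if "z \<in> \<Omega>" for z
    unfolding le_smallest_eigenvalue_complex_hessian_iff[OF \<Omega>(1) C2\<psi> that]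
    using \<psi>(4)[OF that] Levi_form_eq[OF \<Omega>(1) C2\<psi> that] by simp
  then have sub\<psi>: "local_submean \<Omega> (\<lambda>_. 1) \<psi>" by (rule C2_imp_local_submean[OF \<Omega>(1) C2\<psi> order_refl])
  have usc\<psi>: "usc_locally_bounded \<Omega> \<psi>"
    by (rule usc_locally_bounded_continuous[OF \<Omega>(1) C2_on_imp_continuous[OF C2\<psi>]])
  have comp: "compact (closure \<Omega>)" using \<Omega>(2) by simp
  obtain R where R: "R > 0" "\<And>z. z \<in> closure \<Omega> \<Longrightarrow> norm z \<le> R"
    using compact_imp_bounded[OF comp] unfolding bounded_pos by blast
  have "e / 4 > 0" using e by simp
  from mollify_uniformly_close[OF G comp this zero_less_one] obtain h where
    h: "h > 0" "\<And>z. z \<in> closure \<Omega> \<Longrightarrow> \<bar>mollify h G z - G z\<bar> \<le> e / 4" by blast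
  define G' where "G' = mollify h G"
  have C2G': "Ck_on 2 (ball 0 (R + 1)) G'" unfolding G'_def by (rule mollify_C2[OF h(1) G])
  have cl: "closure \<Omega> \<subseteq> ball 0 (R + 1)" using R(2) by force
  obtain M where M: "\<And>z. z \<in> closure \<Omega> \<Longrightarrow> M \<le> \<Lambda>\<^sub>1 (complex_hessian G' z)"
    using smallest_eigenvalue_bounded_below[OF open_ball C2G' comp cl] by blast
  have \<Omega>R: "\<Omega> \<subseteq> ball 0 (R + 1)" using cl closure_subset by blast
  have subG': "local_submean \<Omega> (\<lambda>_. M) G'"
    by (rule C2_imp_local_submean[OF open_ball C2G' \<Omega>R]) (use M closure_subset in blast)
  have uscG': "usc_locally_bounded \<Omega> G'"
    by (rule usc_locally_bounded_continuous[OF \<Omega>(1)]) (unfold G'_def, rule mollify_continuous[OF h(1) G])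
  define K where "K = C + \<bar>M\<bar> + 1"
  have K: "K > 0" using C by (simp add: K_def add_nonneg_pos)
  \<comment> \<open>The constant is written as a quadratic polynomial so that the lemmas on those apply to it.\<close>
  define b where "b z = (G' z + (0 * (norm (z - 0))\<^sup>2 + (- e / 2))) + K * \<psi> z" for z
  note uscc = usc_locally_bounded_norm_squared[OF \<Omega>(1), of 0 0 "- e / 2"]
  note usc1 = usc_locally_bounded_add[OF uscG' uscc]
  note sub1 = local_submean_add[OF uscG' subG' uscc local_submean_norm_squared]
  note uscK = usc_locally_bounded_cmult[OF usc\<psi> K] and subK = local_submean_cmult[OF sub\<psi> K]
  have usc_b: "usc_locally_bounded \<Omega> b"
    unfolding b_def[abs_def] by (rule usc_locally_bounded_add[OF usc1 uscK])
  have sub_b: "local_submean \<Omega> (\<lambda>_. C) b"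
    unfolding b_def[abs_def]
    by (rule local_submean_mono[OF local_submean_add[OF usc1 sub1 uscK subK] order_refl]) (simp add: K_def)
  have small: "near_boundary \<Omega> (\<lambda>z. - (e / (4 * K)) < \<psi> z)"
    by (rule near_boundaryI[OF \<Omega>]) (use order_tendstoD(1)[OF \<psi>(3), of _ "- (e / (4 * K))"] e K in simp)
  have key: "b z < G z \<and> G z - e < b z" if z: "z \<in> \<Omega>" and s: "- (e / (4 * K)) < \<psi> z" for z
  proof -
    have "K * - (e / (4 * K)) < K * \<psi> z" using s K by (rule mult_strict_left_mono)
    then have "- (e / 4) < K * \<psi> z" using K by simp
    moreover have "K * \<psi> z < 0" using \<psi>(2)[OF z] K by (simp add: mult_pos_neg)
    moreover have "\<bar>G' z - G z\<bar> \<le> e / 4" using z closure_subset unfolding G'_def by (intro h(2)) blast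
    moreover have "b z = G' z - e / 2 + K * \<psi> z" by (simp add: b_def)
    ultimately show ?thesis by linarith
  qed
  have "near_boundary \<Omega> (\<lambda>z. b z < G z)" "near_boundary \<Omega> (\<lambda>z. G z - e < b z)"
    by (rule near_boundary_mono[OF small], use key in blast)+
  then show "\<exists>b. usc_locally_bounded \<Omega> b \<and> local_submean \<Omega> (\<lambda>_. C) b \<and>
      near_boundary \<Omega> (\<lambda>z. b z < G z) \<and> near_boundary \<Omega> (\<lambda>z. G z - e < b z)"
    using usc_b sub_b by blast
qed

subsection \<open>Truncated plurisubharmonic functions\<close>

text \<open>Truncation from below keeps the submean property and makes the function real and bounded below, so
  that the extended circle mean can be compared with an ordinary integral.\<close>

lemma PSH_truncation:
  fixes \<Omega> :: "(complex^'n::finite) set"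
  assumes \<Omega>: "open \<Omega>" and w: "w \<in> PSH \<Omega>" and m: "\<And>z. z \<in> \<Omega> \<Longrightarrow> ereal (m z) = max (w z) (ereal L)"
  shows "usc_locally_bounded \<Omega> m" and "local_submean \<Omega> (\<lambda>_. 0) m"
proof -
  have L: "L \<le> m z" and wm: "w z \<le> ereal (m z)" if "z \<in> \<Omega>" for z
    using m[OF that] by (metis ereal_less_eq(3) max.cobounded2, metis max.cobounded1)
  have in\<Omega>: "\<forall>\<^sub>F z in nhds a. z \<in> \<Omega>" if "a \<in> \<Omega>" for a using \<Omega> that by (rule eventually_nhds_in_open)
  show usc: "usc_locally_bounded \<Omega> m"
  proof (rule usc_locally_boundedI[OF \<Omega>])
    fix a t assume a: "a \<in> \<Omega>" and t: "m a < t"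
    have wt: "w a < ereal t" by (rule le_less_trans[OF wm[OF a]]) (simp add: t)
    have "L < t" using L[OF a] t by simp
    have "\<forall>\<^sub>F y in at a within \<Omega>. w y < ereal t"
      using w a wt unfolding PSH_def usc_on_def by blast
    then have "\<forall>\<^sub>F y in nhds a. y \<in> \<Omega> \<longrightarrow> w y < ereal t"
      using wt unfolding eventually_at_filter by (auto elim: eventually_mono)
    with in\<Omega>[OF a] show "\<forall>\<^sub>F y in nhds a. m y < t"
    proof eventually_elim
      case (elim y)
      then have "ereal (m y) < ereal t" unfolding m[OF elim(1)] using \<open>L < t\<close> by simp
      then show ?case by simp
    qed
  next
    fix a assume "a \<in> \<Omega>"
    from in\<Omega>[OF this] have "\<forall>\<^sub>F z in nhds a. L \<le> m z" by eventually_elim (rule L)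
    then show "\<exists>B. \<forall>\<^sub>F z in nhds a. B \<le> m z" ..
  qed
  have mean: "m a \<le> circle_avg m a \<xi>"
    if disc: "\<And>c. cmod c \<le> 1 \<Longrightarrow> a + c *s \<xi> \<in> \<Omega>" and int: "circle_integrable m a \<xi>" for a \<xi>
  proof -
    have a: "a \<in> \<Omega>" using disc[of 0] by simp
    have circ: "a + cis \<theta> *s \<xi> \<in> \<Omega>" for \<theta> by (rule disc) simp
    show ?thesis
    proof (cases "w a \<le> ereal L")
      case True
      then have "m a = L" using m[OF a] by (simp add: max_def split: if_splits)
      also have "L = circle_avg (\<lambda>_. L) a \<xi>" by simp
      also have "\<dots> \<le> circle_avg m a \<xi>" by (intro circle_avg_mono int circle_integrable_const L circ)
      finally show ?thesis .
    next
      case False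
      let ?A = "{0..2*pi}"
      define k where "k \<theta> = indicator ?A \<theta> *\<^sub>R m (a + cis \<theta> *s \<xi>)" for \<theta>
      have k: "integrable lborel k"
        using int unfolding circle_integrable_def set_integrable_def k_def[abs_def] .
      define P where "P = (\<integral>\<^sup>+\<theta>. ennreal (k \<theta>) \<partial>lborel)"
      define N where "N = (\<integral>\<^sup>+\<theta>. ennreal (- k \<theta>) \<partial>lborel)"
      have fin: "P \<noteq> \<infinity>" "N \<noteq> \<infinity>"
        using k unfolding real_integrable_def P_def N_def by auto
      have avg: "circle_avg m a \<xi> = (enn2real P - enn2real N) / (2*pi)"
        unfolding circle_avg_def set_lebesgue_integral_def k_def[symmetric] P_def N_def
        by (simp add: real_lebesgue_integral_def[OF k])
      have P: "(\<integral>\<^sup>+\<theta>\<in>?A. e2ennreal (w (a + cis \<theta> *s \<xi>)) \<partial>lborel) \<le> P"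
        unfolding P_def
      proof (rule nn_integral_mono)
        fix \<theta> :: real
        have "e2ennreal (w (a + cis \<theta> *s \<xi>)) \<le> e2ennreal (ereal (m (a + cis \<theta> *s \<xi>)))"
          by (rule e2ennreal_mono) (rule wm[OF circ])
        then show "e2ennreal (w (a + cis \<theta> *s \<xi>)) * indicator ?A \<theta> \<le> ennreal (k \<theta>)"
          by (simp add: k_def e2ennreal_ereal indicator_def)
      qed
      have N: "N \<le> (\<integral>\<^sup>+\<theta>\<in>?A. e2ennreal (- w (a + cis \<theta> *s \<xi>)) \<partial>lborel)"
        unfolding N_def
      proof (rule nn_integral_mono)
        fix \<theta> :: real
        have "e2ennreal (ereal (- m (a + cis \<theta> *s \<xi>))) \<le> e2ennreal (- w (a + cis \<theta> *s \<xi>))"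
          using wm[OF circ, of \<theta>] by (intro e2ennreal_mono) (metis ereal_minus_le_minus uminus_ereal.simps(1))
        then show "ennreal (- k \<theta>) \<le> e2ennreal (- w (a + cis \<theta> *s \<xi>)) * indicator ?A \<theta>"
          by (simp add: k_def e2ennreal_ereal indicator_def)
      qed
      have "{a + c *s \<xi> |c. cmod c \<le> 1} \<subseteq> \<Omega>"
      proof
        fix z assume "z \<in> {a + c *s \<xi> |c. cmod c \<le> 1}"
        then obtain c where "z = a + c *s \<xi>" "cmod c \<le> 1" by (rule CollectE) (elim exE conjE)
        then show "z \<in> \<Omega>" using disc by simp
      qed
      then have psh: "w a \<le> circle_mean w a \<xi>" using w unfolding PSH_def by blast
      have "ereal (m a) = w a" using m[OF a] False by (simp add: max_def)
      also have "\<dots> \<le> circle_mean w a \<xi>" by (rule psh)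
      also have "\<dots> \<le> (enn2ereal P - enn2ereal N) / ereal (2*pi)"
        unfolding circle_mean_def using P N
        by (intro ereal_divide_right_mono ereal_minus_mono) (auto simp: less_eq_ennreal.rep_eq)
      also have "\<dots> = ereal (circle_avg m a \<xi>)"
      proof -
        have "enn2ereal X = ereal (enn2real X)" if "X \<noteq> \<infinity>" for X
          using that by (cases X) (auto simp: enn2ereal_ennreal)
        then have "enn2ereal P = ereal (enn2real P)" "enn2ereal N = ereal (enn2real N)" using fin by blast+
        then show ?thesis unfolding avg by simp
      qed
      finally show ?thesis by simp
    qed
  qed
  show "local_submean \<Omega> (\<lambda>_. 0) m"
    unfolding local_submean_def
  proof (intro ballI allI impI)
    fix a \<xi> and c :: real assume a: "a \<in> \<Omega>" and c: "c < 0"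
    show "\<forall>\<^sub>F r in at_right 0. m a + c * (norm \<xi>)\<^sup>2 * r\<^sup>2 \<le> circle_avg m a (r *\<^sub>R \<xi>)"
      using eventually_small_disc[OF in\<Omega>[OF a], of \<xi>] usc_eventually_circle_integrable[OF usc a, of \<xi>]
    proof eventually_elim
      case (elim r)
      have "m a \<le> circle_avg m a (r *\<^sub>R \<xi>)" using elim by (intro mean) auto
      moreover have "c * (norm \<xi>)\<^sup>2 * r\<^sup>2 \<le> 0" using c by (simp add: mult_nonpos_nonneg)
      ultimately show ?case by linarith
    qed
  qed
qed

text \<open>The term \<open>C |z|\<^sup>2\<close> subtracted from the datum is added back to the extension and supplies the excess.\<close>

lemma extension_imp_barriers:
  fixes \<Omega> :: "(complex^'n::finite) set"
  assumes \<Omega>: "open \<Omega>" "bounded \<Omega>" and ex: "B_regular_extension \<Omega>"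
  shows "has_barriers \<Omega>"
  unfolding has_barriers_def
proof (intro allI impI)
  fix G :: "complex^'n \<Rightarrow> real" and C e :: real
  assume G: "continuous_on UNIV G" and C: "0 \<le> C" and e: "0 < e"
  have "continuous_on (frontier \<Omega>) (\<lambda>z. G z - C * (norm z)\<^sup>2 - e / 2)"
    by (intro continuous_intros continuous_on_subset[OF G]) auto
  then obtain w where w: "(\<lambda>z. ereal (w z)) \<in> PSH \<Omega>" "continuous_on (closure \<Omega>) w"
    "\<forall>z\<in>frontier \<Omega>. w z = G z - C * (norm z)\<^sup>2 - e / 2"
    using ex[unfolded B_regular_extension_def, rule_format, of "\<lambda>z. G z - C * (norm z)\<^sup>2 - e / 2"] by blast
  have "bounded (w ` closure \<Omega>)"
    using compact_continuous_image[OF w(2)] \<Omega>(2) by (simp add: compact_imp_bounded)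
  then obtain B where B: "\<And>z. z \<in> closure \<Omega> \<Longrightarrow> \<bar>w z\<bar> \<le> B" unfolding bounded_iff by auto
  have trunc: "ereal (w z) = max (ereal (w z)) (ereal (- B))" if "z \<in> \<Omega>" for z
  proof -
    have "z \<in> closure \<Omega>" using closure_subset that by blast
    then have "- B \<le> w z" using abs_le_D2[OF B] by force
    then show ?thesis by (simp add: max_def)
  qed
  note psh = PSH_truncation[OF \<Omega>(1) w(1) trunc]
  define b where "b z = w z + (C * (norm (z - 0))\<^sup>2 + 0)" for z
  note uscC = usc_locally_bounded_norm_squared[OF \<Omega>(1), of C 0 0]
  have usc_b: "usc_locally_bounded \<Omega> b"
    unfolding b_def[abs_def] by (rule usc_locally_bounded_add[OF psh(1) uscC])
  have sub_b: "local_submean \<Omega> (\<lambda>_. C) b"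
    using local_submean_add[OF psh uscC local_submean_norm_squared] unfolding b_def[abs_def] by simp
  define k where "k z = b z - G z + e / 2" for z
  have k0: "k z = 0" if "z \<in> frontier \<Omega>" for z using w(3) that by (simp add: k_def b_def)
  have contk: "continuous_on (closure \<Omega>) k"
    unfolding k_def[abs_def] b_def[abs_def] by (intro continuous_intros w(2) continuous_on_subset[OF G]) auto
  have small: "near_boundary \<Omega> (\<lambda>z. \<bar>k z\<bar> < e / 2)"
  proof (rule near_boundaryI[OF \<Omega>])
    fix \<zeta> assume \<zeta>: "\<zeta> \<in> frontier \<Omega>"
    then have "(k \<longlongrightarrow> k \<zeta>) (at \<zeta> within closure \<Omega>)"
      using contk by (simp add: continuous_on_def frontier_def)
    then have "(k \<longlongrightarrow> 0) (at \<zeta> within \<Omega>)"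
      using tendsto_within_subset closure_subset k0[OF \<zeta>] by metis
    from tendstoD[OF this, of "e / 2"] e show "\<forall>\<^sub>F z in at \<zeta> within \<Omega>. \<bar>k z\<bar> < e / 2"
      by (simp add: dist_real_def)
  qed
  have "near_boundary \<Omega> (\<lambda>z. b z < G z)" "near_boundary \<Omega> (\<lambda>z. G z - e < b z)"
    by (rule near_boundary_mono[OF small], unfold k_def abs_less_iff, linarith)+
  then show "\<exists>b. usc_locally_bounded \<Omega> b \<and> local_submean \<Omega> (\<lambda>_. C) b \<and>
      near_boundary \<Omega> (\<lambda>z. b z < G z) \<and> near_boundary \<Omega> (\<lambda>z. G z - e < b z)"
    using usc_b sub_b by blast
qed

text \<open>The barrier at \<open>\<zeta>\<close> is bounded away from \<open>0\<close> off every neighbourhood of \<open>\<zeta>\<close>, by compactness. A large multiple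
  of it therefore outweighs \<open>p - G\<close> there. Close to \<open>\<zeta>\<close> the function \<open>p\<close> itself lies below \<open>G\<close>.\<close>

lemma barrier_at_boundary_point:
  fixes \<Omega> :: "(complex^'n::finite) set"
  assumes \<Omega>: "open \<Omega>" "bounded \<Omega>" and \<zeta>: "\<zeta> \<in> frontier \<Omega>"
    and w: "w \<in> PSH \<Omega>" "(w \<longlongrightarrow> 0) (at \<zeta> within \<Omega>)" "\<forall>z\<in>closure \<Omega> - {\<zeta>}. usc_reg \<Omega> w z < 0"
    and G: "continuous_on UNIV G" and C: "0 \<le> C" and e: "0 < e"
  shows "\<exists>b. usc_locally_bounded \<Omega> b \<and> local_submean \<Omega> (\<lambda>_. C) b \<and> (\<forall>z\<in>\<Omega>. b z < G z) \<and>
    (\<forall>\<^sub>F z in nhds \<zeta>. z \<in> \<Omega> \<longrightarrow> G z - e < b z)"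
proof -
  have \<zeta>\<Omega>: "\<zeta> \<notin> \<Omega>" using \<zeta> \<Omega>(1) by (simp add: frontier_def interior_open)
  have fin: "w z < \<infinity>" if "z \<in> \<Omega>" for z using w(1) that unfolding PSH_def by blast
  define m where "m z = real_of_ereal (max (w z) (ereal (- 1)))" for z
  have m: "ereal (m z) = max (w z) (ereal (- 1))" if "z \<in> \<Omega>" for z
  proof -
    have "\<bar>max (w z) (ereal (- 1))\<bar> \<noteq> \<infinity>" using fin[OF that] by (cases "w z") (auto simp: max_def)
    then show ?thesis unfolding m_def by (simp add: ereal_real)
  qed
  note psh = PSH_truncation[OF \<Omega>(1) w(1) m]
  have local_neg: "\<exists>s<0. \<exists>r>0. \<forall>y\<in>\<Omega>. dist y x < r \<longrightarrow> m y \<le> s" if x: "x \<in> closure \<Omega> - {\<zeta>}" for x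
  proof -
    have "usc_reg \<Omega> w x < 0" using w(3) x by blast
    then obtain r where r: "r > 0" "(SUP y\<in>{y\<in>\<Omega>. dist y x < r}. w y) < 0"
      unfolding usc_reg_def INF_less_iff by auto
    obtain t where t: "(SUP y\<in>{y\<in>\<Omega>. dist y x < r}. w y) < ereal t" "ereal t < 0"
      using ereal_dense2[OF r(2)] by blast
    have "m y \<le> max t (- 1)" if y: "y \<in> \<Omega>" "dist y x < r" for y
    proof -
      have "w y \<le> (SUP y\<in>{y\<in>\<Omega>. dist y x < r}. w y)" by (rule SUP_upper) (use y in simp)
      then have "w y \<le> ereal t" using t(1) by simp
      then have "ereal (m y) \<le> ereal (max t (- 1))"
        unfolding m[OF y(1)] ereal_max by (intro max.mono order_refl)
      then show ?thesis by (simp only: ereal_less_eq(3))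
    qed
    then show ?thesis using r(1) t(2) by (intro exI[of _ "max t (- 1)"]) auto
  qed
  have neg: "m z < 0" if "z \<in> \<Omega>" for z
  proof -
    have "z \<in> closure \<Omega> - {\<zeta>}" using that \<zeta>\<Omega> closure_subset by auto
    then show ?thesis using local_neg[of z] that by force
  qed
  have away: "\<exists>s<0. \<forall>y\<in>\<Omega>. \<rho> \<le> dist y \<zeta> \<longrightarrow> m y \<le> s" if \<rho>: "\<rho> > 0" for \<rho>
  proof -
    define T where "T = closure \<Omega> - ball \<zeta> \<rho>"
    have "compact T" unfolding T_def using \<Omega>(2) by (simp add: compact_diff)
    have "\<exists>s r. s < 0 \<and> r > 0 \<and> (\<forall>y\<in>\<Omega>. dist y x < r \<longrightarrow> m y \<le> s)" if "x \<in> T" for x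
    proof -
      have "x \<in> closure \<Omega> - {\<zeta>}" using that \<rho> by (auto simp: T_def)
      then show ?thesis using local_neg by blast
    qed
    then obtain s r where sr: "\<And>x. x \<in> T \<Longrightarrow> s x < 0 \<and> r x > 0 \<and> (\<forall>y\<in>\<Omega>. dist y x < r x \<longrightarrow> m y \<le> s x)"
      by metis
    have "T \<subseteq> (\<Union>x\<in>T. ball x (r x))" using sr by force
    then obtain D where D: "D \<subseteq> T" "finite D" "T \<subseteq> (\<Union>x\<in>D. ball x (r x))"
      using compactE_image[OF \<open>compact T\<close>, of T "\<lambda>x. ball x (r x)"] by auto
    define S where "S = Max (insert (- 1) (s ` D))"
    have "S < 0" unfolding S_def using D(1,2) sr by (subst Max_less_iff) auto
    moreover have "m y \<le> S" if y: "y \<in> \<Omega>" "\<rho> \<le> dist y \<zeta>" for y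
    proof -
      have "y \<in> T" using y closure_subset unfolding T_def by (auto simp: dist_commute)
      then obtain x where x: "x \<in> D" "y \<in> ball x (r x)" using D(3) by blast
      then have "m y \<le> s x" using sr[of x] D(1) y(1) by (auto simp: dist_commute)
      also have "s x \<le> S" unfolding S_def using x(1) D(2) by (intro Max_ge) auto
      finally show ?thesis .
    qed
    ultimately show ?thesis by blast
  qed
  define p where "p z = C * (norm (z - \<zeta>))\<^sup>2 + (G \<zeta> - e / 2)" for z
  have contp: "continuous_on S p" for S unfolding p_def[abs_def] by (intro continuous_intros)
  have "(p \<longlongrightarrow> p \<zeta>) (nhds \<zeta>)" "(G \<longlongrightarrow> G \<zeta>) (nhds \<zeta>)"
    using contp[of UNIV] G continuous_on_eq_continuous_at[OF open_UNIV] isCont_def tendsto_at_iff_tendsto_nhds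
    by (metis UNIV_I)+
  then have "((\<lambda>z. p z - G z) \<longlongrightarrow> p \<zeta> - G \<zeta>) (nhds \<zeta>)" by (rule tendsto_diff)
  moreover have "p \<zeta> - G \<zeta> = - e / 2" by (simp add: p_def)
  ultimately have pG: "((\<lambda>z. p z - G z) \<longlongrightarrow> - e / 2) (nhds \<zeta>)" by simp
  have "\<forall>\<^sub>F z in nhds \<zeta>. p z - G z < 0" using e by (intro order_tendstoD(2)[OF pG]) simp
  then obtain \<rho> where \<rho>: "\<rho> > 0" "\<And>z. dist z \<zeta> < \<rho> \<Longrightarrow> p z - G z < 0"
    unfolding eventually_nhds_metric by blast
  obtain s where s: "s < 0" "\<And>y. y \<in> \<Omega> \<Longrightarrow> \<rho> \<le> dist y \<zeta> \<Longrightarrow> m y \<le> s" using away[OF \<rho>(1)] by blast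
  have "continuous_on (closure \<Omega>) (\<lambda>z. p z - G z)"
    by (intro continuous_intros contp continuous_on_subset[OF G]) auto
  from compact_continuous_image[OF this] have "bounded ((\<lambda>z. p z - G z) ` closure \<Omega>)"
    using \<Omega>(2) by (simp add: compact_imp_bounded)
  then obtain B where B: "B > 0" "\<And>z. z \<in> closure \<Omega> \<Longrightarrow> \<bar>p z - G z\<bar> \<le> B" unfolding bounded_pos by auto
  define K where "K = (B + 1) / (- s)"
  have K: "K > 0" "K * s = - (B + 1)" using B(1) s(1) by (simp_all add: K_def field_simps)
  define b where "b z = K * m z + p z" for z
  note uscK = usc_locally_bounded_cmult[OF psh(1) K(1)]
  note uscp = usc_locally_bounded_norm_squared[OF \<Omega>(1), of C \<zeta> "G \<zeta> - e / 2", folded p_def[abs_def]]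
  have usc_b: "usc_locally_bounded \<Omega> b"
    unfolding b_def[abs_def] by (rule usc_locally_bounded_add[OF uscK uscp])
  have sub_b: "local_submean \<Omega> (\<lambda>_. C) b"
    using local_submean_add[OF uscK local_submean_cmult[OF psh(2) K(1)] uscp
        local_submean_norm_squared[of \<Omega> C \<zeta> "G \<zeta> - e / 2", folded p_def[abs_def]]]
    unfolding b_def[abs_def] by simp
  have below: "b z < G z" if z: "z \<in> \<Omega>" for z
  proof (cases "dist z \<zeta> < \<rho>")
    case True
    have "K * m z < 0" using K(1) neg[OF z] by (simp add: mult_pos_neg)
    then show ?thesis using \<rho>(2)[OF True] unfolding b_def by linarith
  next
    case False
    then have "K * m z \<le> K * s" using s(2)[OF z] K(1) by (intro mult_left_mono) auto
    moreover have "p z - G z \<le> B" using B(2)[of z] z closure_subset by (force simp: abs_le_iff)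
    ultimately show ?thesis using K(2) unfolding b_def by linarith
  qed
  have "\<forall>\<^sub>F z in nhds \<zeta>. - e * (3 / 4) < p z - G z" using e by (intro order_tendstoD(1)[OF pG]) simp
  moreover have "\<forall>\<^sub>F z in nhds \<zeta>. z \<in> \<Omega> \<longrightarrow> - e / 4 < K * m z"
  proof -
    have "ereal (- e / (4 * K)) < 0" using e K(1) by simp
    from order_tendstoD(1)[OF w(2) this]
    have "\<forall>\<^sub>F z in nhds \<zeta>. z \<in> \<Omega> \<longrightarrow> ereal (- e / (4 * K)) < w z"
      unfolding eventually_at_filter by eventually_elim (use \<zeta>\<Omega> in auto)
    then show ?thesis
    proof (eventually_elim, intro impI)
      fix z assume "z \<in> \<Omega> \<longrightarrow> ereal (- e / (4 * K)) < w z" and z: "z \<in> \<Omega>"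
      then have "ereal (- e / (4 * K)) < ereal (m z)" unfolding m[OF z] by (simp add: less_max_iff_disj)
      then have "K * (- e / (4 * K)) < K * m z" using K(1) by (intro mult_strict_left_mono) auto
      then show "- e / 4 < K * m z" using K(1) by simp
    qed
  qed
  ultimately have "\<forall>\<^sub>F z in nhds \<zeta>. z \<in> \<Omega> \<longrightarrow> G z - e < b z"
    by eventually_elim (auto simp: b_def)
  then show ?thesis using usc_b sub_b below by blast
qed

text \<open>Finitely many of the barriers at boundary points suffice, and their maximum is a barrier along the
  whole boundary.\<close>

lemma barrier_imp_barriers:
  fixes \<Omega> :: "(complex^'n::finite) set"
  assumes \<Omega>: "open \<Omega>" "bounded \<Omega>" and ex: "B_regular_barrier \<Omega>"
  shows "has_barriers \<Omega>"
  unfolding has_barriers_def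
proof (intro allI impI)
  fix G :: "complex^'n \<Rightarrow> real" and C e :: real
  assume G: "continuous_on UNIV G" and C: "0 \<le> C" and e: "0 < e"
  have "\<exists>b S. usc_locally_bounded \<Omega> b \<and> local_submean \<Omega> (\<lambda>_. C) b \<and> (\<forall>z\<in>\<Omega>. b z < G z) \<and>
      open S \<and> \<zeta> \<in> S \<and> (\<forall>z\<in>S. z \<in> \<Omega> \<longrightarrow> G z - e < b z)" if \<zeta>: "\<zeta> \<in> frontier \<Omega>" for \<zeta>
  proof -
    obtain w where "w \<in> PSH \<Omega>" "(w \<longlongrightarrow> 0) (at \<zeta> within \<Omega>)" "\<forall>z\<in>closure \<Omega> - {\<zeta>}. usc_reg \<Omega> w z < 0"
      using ex \<zeta> unfolding B_regular_barrier_def by blast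
    from barrier_at_boundary_point[OF \<Omega> \<zeta> this G C e] show ?thesis
      unfolding eventually_nhds by blast
  qed
  then obtain \<beta> S where \<beta>: "\<And>\<zeta>. \<zeta> \<in> frontier \<Omega> \<Longrightarrow> usc_locally_bounded \<Omega> (\<beta> \<zeta>) \<and>
      local_submean \<Omega> (\<lambda>_. C) (\<beta> \<zeta>) \<and> (\<forall>z\<in>\<Omega>. \<beta> \<zeta> z < G z) \<and>
      open (S \<zeta>) \<and> \<zeta> \<in> S \<zeta> \<and> (\<forall>z\<in>S \<zeta>. z \<in> \<Omega> \<longrightarrow> G z - e < \<beta> \<zeta> z)"
    by metis
  have "compact (frontier \<Omega>)" using \<Omega>(2) by (rule compact_frontier_bounded)
  moreover have "frontier \<Omega> \<subseteq> (\<Union>\<zeta>\<in>frontier \<Omega>. S \<zeta>)" using \<beta> by blast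
  ultimately obtain D where D: "D \<subseteq> frontier \<Omega>" "finite D" "frontier \<Omega> \<subseteq> (\<Union>\<zeta>\<in>D. S \<zeta>)"
    using compactE_image[of "frontier \<Omega>" "frontier \<Omega>" S] \<beta> by metis
  have "\<exists>b. usc_locally_bounded \<Omega> b \<and> local_submean \<Omega> (\<lambda>_. C) b \<and> (\<forall>z\<in>\<Omega>. b z < G z) \<and>
      (\<forall>\<zeta>\<in>D. \<forall>z\<in>S \<zeta>. z \<in> \<Omega> \<longrightarrow> G z - e < b z)"
    using D(2,1)
  proof (induction D rule: finite_induct)
    case empty
    have "continuous_on (closure \<Omega>) (\<lambda>z. C * (norm (z - 0))\<^sup>2 - G z)"
      by (intro continuous_intros continuous_on_subset[OF G]) auto
    from compact_continuous_image[OF this] have "bounded ((\<lambda>z. C * (norm (z - 0))\<^sup>2 - G z) ` closure \<Omega>)"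
      using \<Omega>(2) by (simp add: compact_imp_bounded)
    then obtain B where B: "\<And>z. z \<in> closure \<Omega> \<Longrightarrow> \<bar>C * (norm (z - 0))\<^sup>2 - G z\<bar> \<le> B"
      unfolding bounded_pos by auto
    have "C * (norm (z - 0))\<^sup>2 + (- B - 1) < G z" if "z \<in> \<Omega>" for z
      using abs_le_D1[OF B[of z]] that closure_subset by force
    then show ?case
      using usc_locally_bounded_norm_squared[OF \<Omega>(1), of C 0 "- B - 1"]
        local_submean_norm_squared[of \<Omega> C 0 "- B - 1"]
      by (intro exI[of _ "\<lambda>z. C * (norm (z - 0))\<^sup>2 + (- B - 1)"]) blast
  next
    case (insert \<zeta> D)
    then obtain b where b: "usc_locally_bounded \<Omega> b" "local_submean \<Omega> (\<lambda>_. C) b" "\<forall>z\<in>\<Omega>. b z < G z"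
      "\<forall>\<zeta>\<in>D. \<forall>z\<in>S \<zeta>. z \<in> \<Omega> \<longrightarrow> G z - e < b z" by blast
    have \<beta>': "usc_locally_bounded \<Omega> (\<beta> \<zeta>)" "local_submean \<Omega> (\<lambda>_. C) (\<beta> \<zeta>)" "\<forall>z\<in>\<Omega>. \<beta> \<zeta> z < G z"
      "\<forall>z\<in>S \<zeta>. z \<in> \<Omega> \<longrightarrow> G z - e < \<beta> \<zeta> z" using \<beta>[of \<zeta>] insert.prems by auto
    show ?case
    proof (intro exI[of _ "\<lambda>z. max (b z) (\<beta> \<zeta> z)"] conjI)
      show "usc_locally_bounded \<Omega> (\<lambda>z. max (b z) (\<beta> \<zeta> z))" by (rule usc_locally_bounded_max[OF b(1) \<beta>'(1)])
      show "local_submean \<Omega> (\<lambda>_. C) (\<lambda>z. max (b z) (\<beta> \<zeta> z))"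
        by (rule local_submean_max[OF b(1,2) \<beta>'(1,2)])
      show "\<forall>z\<in>\<Omega>. max (b z) (\<beta> \<zeta> z) < G z" using b(3) \<beta>'(3) by simp
      show "\<forall>\<zeta>'\<in>insert \<zeta> D. \<forall>z\<in>S \<zeta>'. z \<in> \<Omega> \<longrightarrow> G z - e < max (b z) (\<beta> \<zeta> z)"
        using b(4) \<beta>'(4) by (simp add: less_max_iff_disj)
    qed
  qed
  then obtain b where b: "usc_locally_bounded \<Omega> b" "local_submean \<Omega> (\<lambda>_. C) b" "\<forall>z\<in>\<Omega>. b z < G z"
    "\<forall>\<zeta>\<in>D. \<forall>z\<in>S \<zeta>. z \<in> \<Omega> \<longrightarrow> G z - e < b z" by blast
  have "near_boundary \<Omega> (\<lambda>z. b z < G z)"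
    unfolding near_boundary_def using b(3) by (intro exI[of _ "{}"]) auto
  moreover have "near_boundary \<Omega> (\<lambda>z. G z - e < b z)"
  proof (rule near_boundaryI[OF \<Omega>])
    fix \<zeta>' assume "\<zeta>' \<in> frontier \<Omega>"
    then obtain \<zeta> where \<zeta>: "\<zeta> \<in> D" "\<zeta>' \<in> S \<zeta>" using D(3) by blast
    then have "open (S \<zeta>)" using \<beta> D(1) by blast
    then show "\<forall>\<^sub>F z in at \<zeta>' within \<Omega>. G z - e < b z"
      unfolding eventually_at_topological using \<zeta> b(4) by blast
  qed
  ultimately show "\<exists>b. usc_locally_bounded \<Omega> b \<and> local_submean \<Omega> (\<lambda>_. C) b \<and>
      near_boundary \<Omega> (\<lambda>z. b z < G z) \<and> near_boundary \<Omega> (\<lambda>z. G z - e < b z)" using b(1,2) by blast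
qed

lemma B_regular_imp_barriers:
  fixes \<Omega> :: "(complex^'n::finite) set"
  assumes "open \<Omega>" "bounded \<Omega>" "B_regular \<Omega>"
  shows "has_barriers \<Omega>"
  using assms barrier_imp_barriers exhaustion_imp_barriers extension_imp_barriers
  unfolding B_regular_def by blast

section \<open>Existence and uniqueness\<close>

theorem theoremB:
  fixes \<Omega> :: "(complex^'n::finite) set"
    and f \<phi> :: "complex^'n \<Rightarrow> real"
  assumes "open \<Omega>" and "connected \<Omega>" and "\<Omega> \<noteq> {}" and "bounded \<Omega>"
    and "B_regular \<Omega>"
    and "continuous_on (closure \<Omega>) f" and "\<forall>z\<in>closure \<Omega>. f z > 0"
    and "continuous_on (frontier \<Omega>) \<phi>"
  shows "\<exists>u. (continuous_on (closure \<Omega>) u \<and> dirichlet_viscosity_solution \<Omega> f \<phi> u) \<and>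
    (\<forall>v. continuous_on (closure \<Omega>) v \<and> dirichlet_viscosity_solution \<Omega> f \<phi> v \<longrightarrow>
      (\<forall>z\<in>closure \<Omega>. v z = u z))"
proof -
  obtain G where G: "continuous_on UNIV G" "\<And>z. z \<in> frontier \<Omega> \<Longrightarrow> G z = \<phi> z"
    using Tietze_unbounded[OF assms(8), of UNIV] by auto
  note data = assms(1,4) B_regular_imp_barriers[OF assms(1,4,5)] assms(6,7) G(1)
  define u where "u = perron \<Omega> f G"
  have cu: "continuous_on (closure \<Omega>) u"
    unfolding u_def by (rule perron_boundary_continuous[OF data])
  have "u z = \<phi> z" if "z \<in> frontier \<Omega>" for z
    using that G(2)[OF that] assms(1) by (simp add: u_def perron_def frontier_def interior_open)
  then have sol: "dirichlet_viscosity_solution \<Omega> f \<phi> u"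
    using perron_viscosity_subsolution[OF data assms(3)] perron_viscosity_supersolution[OF data]
    unfolding dirichlet_viscosity_solution_def viscosity_solution_def u_def by blast
  have le: "v z \<le> w z"
    if v: "continuous_on (closure \<Omega>) v" "dirichlet_viscosity_solution \<Omega> f \<phi> v"
      and w: "continuous_on (closure \<Omega>) w" "dirichlet_viscosity_solution \<Omega> f \<phi> w"
      and z: "z \<in> closure \<Omega>" for v w z
  proof (rule comparison_principle[OF assms(1,4) v(1) w(1) assms(6) _ _ _ z])
    show "disc_submean \<Omega> f v"
      using v(2) unfolding dirichlet_viscosity_solution_def viscosity_solution_def
      by (intro viscosity_subsolution_disc_submean[OF assms(1) continuous_on_subset[OF v(1) closure_subset]
            continuous_on_subset[OF assms(6) closure_subset]]) blast
    show "viscosity_supersolution \<Omega> f (\<lambda>z. ereal (w z))"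
      using w(2) unfolding dirichlet_viscosity_solution_def viscosity_solution_def by blast
    show "v y \<le> w y" if "y \<in> frontier \<Omega>" for y
      using v(2) w(2) that unfolding dirichlet_viscosity_solution_def by simp
  qed
  have "v z = u z" if "continuous_on (closure \<Omega>) v" "dirichlet_viscosity_solution \<Omega> f \<phi> v" "z \<in> closure \<Omega>" for v z
    using le[OF that(1,2) cu sol that(3)] le[OF cu sol that] by simp
  then show ?thesis using cu sol by blast
qed

end
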